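(* Let $T\subset\mathbb{Z}$ be finite and let $d$ be an integer with $1\le d<|T|$. Let $C_d(T)=\operatorname{conv}\{(t,t^2,\ldots,t^d):t\in T\}\subset\mathbb{R}^d$. Then all magic coefficients $a_i(T,d)$, $0\le i\le d$, of the Ehrhart polynomial $E_{C_d(T)}$ are nonnegative integers. Moreover, the $h^\ast$-polynomial $h^\ast_{C_d(T)}(z)$ is real-rooted, and its coefficient sequence is log-concave and unimodal.
   Context: For a $d$-dimensional lattice polytope $P\subset\mathbb{R}^d$, the Ehrhart polynomial $E_P$ (of degree $d$) is characterized by $E_P(m)=|mP\cap\mathbb{Z}^d|$ for all integers $m>0$, and the $h^\ast$-polynomial $h^\ast_P$ is defined by $1+\sum_{m\ge1}E_P(m)z^m=\dfrac{h^\ast_P(z)}{(1-z)^{d+1}}$. The polytope $C_d(T)$ is a $d$-dimensional lattice polytope. The magic coefficients of a polynomial $f$ of degree $d$ are the unique coefficients $a_0,\ldots,a_d$ in the expansion $f(x)=\sum_{i=0}^d a_i x^i(1+x)^{d-i}$; $a_i(T,d)$ denotes the $i$-th magic coefficient of $E_{C_d(T)}$. A polynomial is real-rooted if all its complex roots are real. A nonnegative sequence $(h_0,\ldots,h_d)$ is log-concave if $h_i^2\ge h_{i-1}h_{i+1}$ for $0<i<d$, and unimodal if $h_0\le\cdots\le h_k\ge\cdots\ge h_d$ for some $k$. *)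

theory Defs
  imports
    "HOL-Analysis.Analysis"
    "HOL-Computational_Algebra.Computational_Algebra"
    "HOL-Library.Function_Algebras"
begin

text \<open>
  Since the dimension \<open>d\<close> is a natural number, \<open>\<real>\<^sup>d\<close> is represented by the functions
  \<open>x :: nat \<Rightarrow> real\<close> that vanish outside the coordinates \<open>{1..d}\<close>. With the pointwise
  real vector space structure on functions, the library's \<^const>\<open>hull\<close> applies.
\<close>

instantiation "fun" :: (type, real_vector) real_vector
begin

definition scaleR_fun :: "real \<Rightarrow> ('a \<Rightarrow> 'b) \<Rightarrow> 'a \<Rightarrow> 'b"
  where "scaleR_fun c f = (\<lambda>x. c *\<^sub>R f x)"

instance
  by standard (simp_all add: scaleR_fun_def fun_eq_iff scaleR_add_right scaleR_add_left)

end

definition int_lattice :: "nat \<Rightarrow> (nat \<Rightarrow> real) set"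
  where "int_lattice d = {x. (\<forall>i\<in>{1..d}. x i \<in> \<int>) \<and> (\<forall>i. i \<notin> {1..d} \<longrightarrow> x i = 0)}"

definition moment_point :: "nat \<Rightarrow> int \<Rightarrow> nat \<Rightarrow> real"
  where "moment_point d t = (\<lambda>i. if i \<in> {1..d} then of_int t ^ i else 0)"

definition cyclic_polytope :: "nat \<Rightarrow> int set \<Rightarrow> (nat \<Rightarrow> real) set"
  where "cyclic_polytope d T = convex hull (moment_point d ` T)"

definition ehrhart_poly :: "nat \<Rightarrow> (nat \<Rightarrow> real) set \<Rightarrow> real poly"
  where "ehrhart_poly d P =
    (THE E. \<forall>m>0. poly E (real m) = real (card ((*\<^sub>R) (real m) ` P \<inter> int_lattice d)))"

lemma ehrhart_poly_eqI:
  assumes "\<And>m. m > 0 \<Longrightarrow> poly E (real m) = real (card ((*\<^sub>R) (real m) ` P \<inter> int_lattice d))"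
  shows "ehrhart_poly d P = E"
  unfolding ehrhart_poly_def
proof (rule the_equality)
  fix F :: "real poly"
  assume F: "\<forall>m>0. poly F (real m) = real (card ((*\<^sub>R) (real m) ` P \<inter> int_lattice d))"
  have "real ` {0<..} \<subseteq> {x. poly (F - E) x = 0}"
    using F assms by auto
  moreover have "infinite (real ` {0<..})"
    by (simp add: finite_image_iff infinite_Ioi inj_on_def)
  ultimately have "infinite {x. poly (F - E) x = 0}"
    using finite_subset by blast
  then show "F = E"
    using poly_roots_finite[of "F - E"] by auto
qed (use assms in auto)

text \<open>
  For a polytope of full dimension \<open>d\<close>; the series has constant term \<open>1\<close> by definition,
  independently of the value of the Ehrhart polynomial at \<open>0\<close>.
\<close>

definition hstar_poly :: "nat \<Rightarrow> (nat \<Rightarrow> real) set \<Rightarrow> real poly"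
  where "hstar_poly d P =
    (THE h. 1 + Abs_fps (\<lambda>m. if m = 0 then 0 else poly (ehrhart_poly d P) (real m)) =
      fps_of_poly h / (1 - fps_X) ^ (d + 1))"

lemma hstar_poly_eqI:
  assumes "1 + Abs_fps (\<lambda>m. if m = 0 then 0 else poly (ehrhart_poly d P) (real m)) =
    fps_of_poly h / (1 - fps_X) ^ (d + 1)"
  shows "hstar_poly d P = h"
  unfolding hstar_poly_def
proof (rule the_equality)
  fix g :: "real poly"
  assume "1 + Abs_fps (\<lambda>m. if m = 0 then 0 else poly (ehrhart_poly d P) (real m)) =
    fps_of_poly g / (1 - fps_X) ^ (d + 1)"
  with assms have "fps_of_poly g / (1 - fps_X) ^ (d + 1) = fps_of_poly h / (1 - fps_X) ^ (d + 1)"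
    by simp
  moreover have "((1 - fps_X) ^ (d + 1) :: real fps) dvd f" for f
    by (rule unit_imp_dvd) (simp add: fps_is_unit_iff fps_nth_power_0)
  ultimately have "fps_of_poly g = fps_of_poly h"
    by (metis dvd_div_eq_iff)
  then show "g = h"
    by (simp add: fps_of_poly_eq_iff)
qed (fact assms)

definition magic_expansion :: "real poly \<Rightarrow> nat \<Rightarrow> (nat \<Rightarrow> real) \<Rightarrow> bool"
  where "magic_expansion f d a \<longleftrightarrow>
    f = (\<Sum>i\<le>d. smult (a i) ([:0, 1:] ^ i * [:1, 1:] ^ (d - i)))"

text \<open>Coefficients with index beyond the degree are set to \<open>0\<close> to make the family unique.\<close>

definition magic_coeff :: "real poly \<Rightarrow> nat \<Rightarrow> real"
  where "magic_coeff f = (THE a. magic_expansion f (degree f) a \<and> (\<forall>i>degree f. a i = 0))"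

lemma magic_expansion_Suc:
  "magic_expansion f (Suc d) a \<longleftrightarrow>
    f = [:1, 1:] * (\<Sum>i\<le>d. smult (a i) ([:0, 1:] ^ i * [:1, 1:] ^ (d - i)))
        + smult (a (Suc d)) ([:0, 1:] ^ Suc d)"
proof -
  have "(\<Sum>i\<le>d. smult (a i) ([:0, 1:] ^ i * [:1, 1:] ^ (Suc d - i))) =
    [:1, 1:] * (\<Sum>i\<le>d. smult (a i) ([:0, 1:] ^ i * [:1, 1:] ^ (d - i)))"
    unfolding sum_distrib_left
    by (rule sum.cong) (simp_all only: atMost_iff Suc_diff_le power_Suc mult_smult_right
        mult.left_commute mult_smult_left)
  then show ?thesis
    unfolding magic_expansion_def sum.atMost_Suc by simp
qed

lemma magic_expansion_exists:
  assumes "degree f \<le> d"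
  shows "\<exists>a. magic_expansion f d a \<and> (\<forall>i>d. a i = 0)"
  using assms
proof (induction d arbitrary: f)
  case 0
  then obtain c where "f = [:c:]"
    by (metis degree_eq_zeroE le_zero_eq)
  then show ?case
    by (intro exI[of _ "\<lambda>i. if i = 0 then c else 0"]) (simp add: magic_expansion_def)
next
  case (Suc d)
  define c where "c = (- 1) ^ Suc d * poly f (- 1)"
  define g where "g = f - smult c ([:0, 1:] ^ Suc d)"
  have "poly g (- 1) = 0"
    unfolding g_def c_def by (simp flip: power_mult_distrib)
  then obtain h where h: "g = [:1, 1:] * h"
    by (metis add.inverse_inverse dvdE poly_eq_0_iff_dvd)
  have "degree g \<le> Suc d"
    unfolding g_def
    by (intro degree_diff_le Suc.prems order.trans[OF degree_smult_le])
       (simp add: degree_power_eq del: power_Suc)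
  then have "degree h \<le> d"
    using degree_mult_eq[of "[:1, 1:]" h] by (cases "h = 0") (auto simp: h)
  from Suc.IH[OF this] obtain a where a: "magic_expansion h d a"
    by blast
  define b where "b = (\<lambda>i. if i \<le> d then a i else if i = Suc d then c else 0)"
  have "(\<Sum>i\<le>d. smult (b i) ([:0, 1:] ^ i * [:1, 1:] ^ (d - i))) = h"
    using a by (simp add: magic_expansion_def b_def)
  moreover have "f = [:1, 1:] * h + smult (b (Suc d)) ([:0, 1:] ^ Suc d)"
    using h by (simp add: g_def b_def diff_eq_eq del: power_Suc)
  ultimately have "magic_expansion f (Suc d) b"
    unfolding magic_expansion_Suc by simp
  then show ?case
    by (intro exI[of _ b]) (simp add: b_def)
qed

lemma magic_expansion_unique:
  assumes "magic_expansion f d a" "magic_expansion f d b" "i \<le> d"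
  shows "a i = b i"
  using assms
proof (induction d arbitrary: f i)
  case 0
  then show ?case
    by (simp add: magic_expansion_def)
next
  case (Suc d)
  define g where
    "g = (\<lambda>a::nat \<Rightarrow> real. \<Sum>i\<le>d. smult (a i) ([:0, 1:] ^ i * [:1, 1:] ^ (d - i)))"
  have fa: "f = [:1, 1:] * g a + smult (a (Suc d)) ([:0, 1:] ^ Suc d)"
    and fb: "f = [:1, 1:] * g b + smult (b (Suc d)) ([:0, 1:] ^ Suc d)"
    using Suc.prems(1,2) unfolding magic_expansion_Suc g_def by simp_all
  have "poly f (- 1) = a (Suc d) * (- 1) ^ Suc d"
    by (subst fa) simp
  moreover have "poly f (- 1) = b (Suc d) * (- 1) ^ Suc d"
    by (subst fb) simp
  ultimately have top: "a (Suc d) = b (Suc d)"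
    by simp
  then have "[:1, 1:] * g a = [:1, 1:] * g b"
    using fa fb by (metis add_right_cancel)
  then have "g a = g b"
    by (metis mult_left_cancel one_neq_zero pCons_eq_0_iff)
  then have "magic_expansion (g a) d a" "magic_expansion (g a) d b"
    by (simp_all add: magic_expansion_def g_def)
  with Suc.IH Suc.prems(3) top show ?case
    by (metis le_Suc_eq)
qed

lemma magic_coeff_expansion:
  "f = (\<Sum>i\<le>degree f. smult (magic_coeff f i) ([:0, 1:] ^ i * [:1, 1:] ^ (degree f - i)))"
proof -
  have "\<exists>!a. magic_expansion f (degree f) a \<and> (\<forall>i>degree f. a i = 0)"
  proof (rule ex_ex1I)
    show "\<exists>a. magic_expansion f (degree f) a \<and> (\<forall>i>degree f. a i = 0)"
      by (rule magic_expansion_exists) simp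
    show "a = b" if "magic_expansion f (degree f) a \<and> (\<forall>i>degree f. a i = 0)"
      "magic_expansion f (degree f) b \<and> (\<forall>i>degree f. b i = 0)" for a b
      using that magic_expansion_unique by (metis ext linorder_not_less)
  qed
  from theI'[OF this, folded magic_coeff_def] show ?thesis
    by (simp add: magic_expansion_def)
qed

definition real_rooted :: "real poly \<Rightarrow> bool"
  where "real_rooted f \<longleftrightarrow> (\<forall>z::complex. poly (map_poly of_real f) z = 0 \<longrightarrow> z \<in> \<real>)"

definition log_concave_seq :: "nat \<Rightarrow> (nat \<Rightarrow> real) \<Rightarrow> bool"
  where "log_concave_seq d h \<longleftrightarrow>
    (\<forall>i\<le>d. 0 \<le> h i) \<and> (\<forall>i. 0 < i \<and> i < d \<longrightarrow> (h i)\<^sup>2 \<ge> h (i - 1) * h (i + 1))"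

definition unimodal_seq :: "nat \<Rightarrow> (nat \<Rightarrow> real) \<Rightarrow> bool"
  where "unimodal_seq d h \<longleftrightarrow>
    (\<forall>i\<le>d. 0 \<le> h i) \<and>
    (\<exists>k\<le>d. (\<forall>i<k. h i \<le> h (i + 1)) \<and> (\<forall>i. k \<le> i \<and> i < d \<longrightarrow> h i \<ge> h (i + 1)))"

end

theory Submission
  imports Defs
begin

text \<open>
  Let \<open>V\<^sub>k\<close> be the volume of \<open>C_k(T)\<close>. The Ehrhart polynomial of \<open>C_d(T)\<close> is the sum of the
  \<open>V\<^sub>k x ^ k\<close>, \<open>k \<le> d\<close>: forgetting the last coordinate maps the lattice points of \<open>m C_d(T)\<close> on or
  above the lower boundary to \<open>m C_{d-1}(T)\<close>, the facets are graphs of functions that are integral at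
  lattice points, and the number of lattice points strictly above the lower boundary is \<open>V\<^sub>d m ^ d\<close>.
  The latter is obtained by summing out one coordinate at a time, starting with the last one. At each
  stage the fibre volume of a simplex is a spline with simple integral knots in the next coordinate,
  and for such a spline the sum over the integers equals the integral.

  For magic positivity it suffices to treat simplices, because dropping the top coefficient replaces
  the magic coefficients by their partial sums. Adding a largest node to \<open>T\<close> turns the polynomial \<open>F\<close>
  into \<open>(1 + x) F + x H\<close>, and comparing the upper triangulations of consecutive dimensions shows
  that the coefficients of \<open>H\<close> grow fast enough to force nonnegative magic coefficients of \<open>H\<close>.

  The \<open>h\<^sup>*\<close>-polynomial is the combination of refined Eulerian polynomials with the magic
  coefficients. At a point of the open upper half-plane their values lie in a convex cone, so no
  nonnegative combination vanishes there. Real-rootedness and nonnegativity of the coefficients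
  yield log-concavity and unimodality.
\<close>

subsection \<open>Linear functionals on polynomials\<close>

text \<open>A point \<open>z\<close> is read as the linear functional sending \<open>x ^ i\<close>
  to \<open>z i\<close>, so that the hyperplane of a facet is the zero set of
  \<open>functional z (node_poly W)\<close>. Node polynomials are monic with integer coefficients;
  this is what makes facets integral over lattice points. Cells have to be half-open in every
  coordinate: only then do their indicators obey the boundary formula exactly. Each fibre of the
  closed polytope then has one lattice point more than its cells, and these extra points are counted
  by the next lower dimension. For magic positivity, the growth needed for the coefficients of
  \<open>H\<close> is \<open>(n - k) * h k \<le> h (Suc k)\<close>. Each upper face is charged to
  its extension by the smallest missing node. The resulting bound fails for just two pairs
  \<open>(Suc k, n)\<close>, namely \<open>(2, 2)\<close> and \<open>(3, 3)\<close>; there the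
  growth inequality is an equality for consecutive nodes, and direct integer estimates replace the
  charging.\<close>

definition functional :: "(nat \<Rightarrow> real) \<Rightarrow> real poly \<Rightarrow> real" where
  "functional z p = (\<Sum>i\<le>degree p. coeff p i * z i)"

lemma functional_eq_sum:
  assumes "degree p \<le> n"
  shows "functional z p = (\<Sum>i\<le>n. coeff p i * z i)"
  unfolding functional_def
  by (rule sum.mono_neutral_left) (use assms in \<open>auto simp: coeff_eq_0\<close>)

lemma functional_add: "functional z (p + q) = functional z p + functional z q"
proof -
  define n where "n = max (degree p) (degree q)"
  have "degree (p + q) \<le> n" "degree p \<le> n" "degree q \<le> n"
    by (auto simp: n_def degree_add_le_max)
  then show ?thesis
    by (simp add: functional_eq_sum algebra_simps sum.distrib)
qed

lemma functional_smult: "functional z (smult a p) = a * functional z p"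
  using functional_eq_sum[OF degree_smult_le, of z a p]
  by (simp add: functional_def sum_distrib_left mult.assoc)

lemma functional_diff: "functional z (p - q) = functional z p - functional z q"
  using functional_add[of z p "smult (-1) q"] functional_smult[of z "-1" q] by simp

lemma functional_cong:
  assumes "\<And>i. i \<le> degree p \<Longrightarrow> z i = z' i"
  shows "functional z p = functional z' p"
  unfolding functional_def using assms by (auto intro!: sum.cong)

lemma functional_linear_mult:
  "functional z ([:- a, 1:] * p) = functional z (pCons 0 p) - a * functional z p"
proof -
  have "[:- a, 1:] * p = pCons 0 p - smult a p" by simp
  then show ?thesis by (simp only: functional_diff functional_smult)
qed

lemma functional_moments:
  assumes "\<And>i. i \<le> degree p \<Longrightarrow> z i = (\<Sum>t\<in>T. c t * x t ^ i)"
  shows "functional z p = (\<Sum>t\<in>T. c t * poly p (x t))"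
proof -
  have "functional z p = (\<Sum>i\<le>degree p. \<Sum>t\<in>T. c t * (coeff p i * x t ^ i))"
    unfolding functional_def using assms
    by (auto intro!: sum.cong simp: sum_distrib_left mult_ac)
  also have "\<dots> = (\<Sum>t\<in>T. \<Sum>i\<le>degree p. c t * (coeff p i * x t ^ i))"
    by (rule sum.swap)
  finally show ?thesis
    by (simp add: poly_altdef sum_distrib_left)
qed

text \<open>A monic polynomial gives slope 1 in the top coordinate. Hence the height at which the
  hyperplane of a face is met is minus the functional with that coordinate set to 0, an integer at
  lattice points.\<close>

lemma functional_update_degree:
  assumes "lead_coeff p = 1" "degree p = k"
  shows "functional (z(k := x)) p = functional (z(k := 0)) p + x"
proof (cases k)
  case 0
  then show ?thesis using assms by (simp add: functional_def)
next
  case (Suc n)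
  then show ?thesis
    using assms unfolding functional_def by simp
qed

subsection \<open>Node polynomials and Vandermonde products\<close>

definition node_poly :: "int set \<Rightarrow> real poly" where
  "node_poly W = (\<Prod>w\<in>W. [:- of_int w, 1:])"

lemma poly_node_poly: "poly (node_poly W) x = (\<Prod>w\<in>W. x - of_int w)"
  by (simp add: node_poly_def poly_prod)

lemma node_poly_insert:
  assumes "finite W" "w \<notin> W"
  shows "node_poly (insert w W) = [:- of_int w, 1:] * node_poly W"
  using assms by (simp add: node_poly_def)

lemma node_poly_empty [simp]: "node_poly {} = 1"
  by (simp add: node_poly_def)

lemma lead_coeff_node_poly [simp]: "lead_coeff (node_poly W) = 1"
  by (simp add: node_poly_def lead_coeff_prod)

lemma node_poly_nonzero [simp]: "node_poly W \<noteq> 0"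
  using lead_coeff_node_poly[of W] by (metis leading_coeff_0_iff zero_neq_one)

lemma degree_node_poly: "finite W \<Longrightarrow> degree (node_poly W) = card W"
proof (induction W rule: finite_induct)
  case (insert w W)
  then show ?case
    by (simp add: node_poly_insert degree_mult_eq del: mult_pCons_left)
qed simp

lemma functional_node_poly_update:
  assumes "finite W" "card W = k"
  shows "functional (z(k := x)) (node_poly W) = functional (z(k := 0)) (node_poly W) + x"
  by (rule functional_update_degree[OF lead_coeff_node_poly]) (simp add: degree_node_poly assms)

lemma node_poly_eq_0_iff:
  "finite W \<Longrightarrow> poly (node_poly W) (of_int s) = 0 \<longleftrightarrow> s \<in> W"
  by (auto simp: poly_node_poly)

lemma coeff_node_poly_Ints: "finite W \<Longrightarrow> coeff (node_poly W) i \<in> \<int>"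
proof (induction W arbitrary: i rule: finite_induct)
  case empty
  then show ?case by (simp add: coeff_1)
next
  case (insert w W)
  have "coeff (node_poly (insert w W)) i =
      (case i of 0 \<Rightarrow> 0 | Suc j \<Rightarrow> coeff (node_poly W) j) - of_int w * coeff (node_poly W) i"
    using insert.hyps by (simp add: node_poly_insert coeff_pCons split: nat.splits)
  then show ?case
    using insert.IH by (auto split: nat.splits)
qed

text \<open>For \<open>card W = k + 1\<close> this is \<open>fact k\<close> times the volume of the
  simplex with its vertices on the moment curve in dimension \<open>k\<close>.\<close>

definition vandermonde :: "int set \<Rightarrow> real" where
  "vandermonde W = (\<Prod>(u, v)\<in>{(u, v). u \<in> W \<and> v \<in> W \<and> u < v}. of_int (v - u))"

lemma vandermonde_empty [simp]: "vandermonde {} = 1"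
  by (simp add: vandermonde_def)

lemma finite_less_pairs: "finite W \<Longrightarrow> finite {(u::int, v). u \<in> W \<and> v \<in> W \<and> u < v}"
  by (rule finite_subset[of _ "W \<times> W"]) auto

lemma vandermonde_pos: "finite W \<Longrightarrow> vandermonde W > 0"
  unfolding vandermonde_def by (intro prod_pos) auto

lemma vandermonde_insert:
  assumes W: "finite W" "w \<notin> W"
  shows "vandermonde (insert w W) = vandermonde W * \<bar>poly (node_poly W) (of_int w)\<bar>"
proof -
  define f where "f = (\<lambda>(u::int, v). real_of_int (v - u))"
  let ?A = "{(u, v). u \<in> W \<and> v \<in> W \<and> u < v}"
  let ?B = "(\<lambda>u. (u, w)) ` {u\<in>W. u < w}"
  let ?C = "(\<lambda>v. (w, v)) ` {v\<in>W. w < v}"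
  have set: "{(u, v). u \<in> insert w W \<and> v \<in> insert w W \<and> u < v} = ?A \<union> (?B \<union> ?C)"
    by auto
  have "prod f (?A \<union> (?B \<union> ?C)) = prod f ?A * prod f (?B \<union> ?C)"
    by (rule prod.union_disjoint) (use W finite_less_pairs[of W] in auto)
  also have "prod f (?B \<union> ?C) = prod f ?B * prod f ?C"
    by (rule prod.union_disjoint) (use W in auto)
  finally have "vandermonde (insert w W) = prod f ?A * (prod f ?B * prod f ?C)"
    unfolding vandermonde_def set f_def .
  also have "prod f ?B * prod f ?C =
      (\<Prod>u\<in>{u\<in>W. u < w}. \<bar>real_of_int (w - u)\<bar>) * (\<Prod>u\<in>{u\<in>W. w < u}. \<bar>real_of_int (w - u)\<bar>)"
    by (subst (1 2) prod.reindex) (auto simp: inj_on_def f_def intro!: arg_cong2[of _ _ _ _ "(*)"] prod.cong)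
  also have "\<dots> = (\<Prod>u\<in>{u\<in>W. u < w} \<union> {u\<in>W. w < u}. \<bar>real_of_int (w - u)\<bar>)"
    using W by (subst prod.union_disjoint) auto
  also have "{u\<in>W. u < w} \<union> {u\<in>W. w < u} = W"
    using W(2) by (auto simp: not_less le_less)
  finally show ?thesis
    by (simp add: vandermonde_def f_def poly_node_poly abs_prod)
qed

lemma vandermonde_remove:
  assumes "finite W" "w \<in> W"
  shows "vandermonde W = vandermonde (W - {w}) * \<bar>poly (node_poly (W - {w})) (of_int w)\<bar>"
  using vandermonde_insert[of "W - {w}" w] assms by (simp add: insert_absorb)

subsection \<open>Lower and upper faces\<close>

text \<open>
  Gale's evenness condition: for \<open>card W = k\<close>, the points of the moment curve in \<open>\<real>\<^sup>k\<close> with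
  parameters in \<open>W\<close> span the hyperplane given by the coefficients of \<^term>\<open>node_poly W\<close>, and
  its sign on \<open>T\<close> decides whether they form a lower or an upper facet of \<open>C_k(T)\<close>.
  Projecting along the last coordinate, both families triangulate \<open>C_{k-1}(T)\<close>.
\<close>

definition lower_faces :: "nat \<Rightarrow> int set \<Rightarrow> int set set" where
  "lower_faces k T = {W. W \<subseteq> T \<and> card W = k \<and> (\<forall>s\<in>T. 0 \<le> poly (node_poly W) (of_int s))}"

definition upper_faces :: "nat \<Rightarrow> int set \<Rightarrow> int set set" where
  "upper_faces k T = {W. W \<subseteq> T \<and> card W = k \<and> (\<forall>s\<in>T. poly (node_poly W) (of_int s) \<le> 0)}"

lemma finite_lower_faces [simp]: "finite T \<Longrightarrow> finite (lower_faces k T)"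
  by (rule finite_subset[of _ "Pow T"]) (auto simp: lower_faces_def)

lemma finite_upper_faces [simp]: "finite T \<Longrightarrow> finite (upper_faces k T)"
  by (rule finite_subset[of _ "Pow T"]) (auto simp: upper_faces_def)

lemma lower_faces_0: "finite T \<Longrightarrow> lower_faces 0 T = {{}}"
  by (auto simp: lower_faces_def dest: finite_subset)

lemma upper_faces_0: "finite T \<Longrightarrow> upper_faces 0 T = (if T = {} then {{}} else {})"
  by (auto simp: upper_faces_def dest: finite_subset)

lemma node_poly_pos_above:
  assumes "\<forall>s\<in>W. s < t"
  shows "poly (node_poly W) (of_int t) > 0"
  unfolding poly_node_poly using assms by (intro prod_pos) auto

lemma poly_node_poly_insert:
  assumes "finite W" "w \<notin> W"
  shows "poly (node_poly (insert w W)) x = (x - of_int w) * poly (node_poly W) x"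
  using assms by (simp add: node_poly_insert algebra_simps)

lemma node_poly_insert_top:
  assumes "finite W" "\<forall>s\<in>T. s < t" "W \<subseteq> T" "s \<in> T"
  shows "poly (node_poly (insert t W)) (of_int s) \<ge> 0 \<longleftrightarrow> poly (node_poly W) (of_int s) \<le> 0"
    and "poly (node_poly (insert t W)) (of_int s) \<le> 0 \<longleftrightarrow> poly (node_poly W) (of_int s) \<ge> 0"
proof -
  have "t \<notin> W" "s < t" using assms by auto
  then show "poly (node_poly (insert t W)) (of_int s) \<ge> 0 \<longleftrightarrow> poly (node_poly W) (of_int s) \<le> 0"
    "poly (node_poly (insert t W)) (of_int s) \<le> 0 \<longleftrightarrow> poly (node_poly W) (of_int s) \<ge> 0"
    using assms by (auto simp: poly_node_poly_insert zero_le_mult_iff mult_le_0_iff)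
qed

lemma subset_insert_cases:
  assumes "W \<subseteq> insert t T"
  obtains "W \<subseteq> T" | U where "W = insert t U" "U \<subseteq> T" "t \<notin> U"
proof (cases "t \<in> W")
  case True
  with assms show ?thesis by (intro that(2)[of "W - {t}"]) auto
next
  case False
  with assms show ?thesis by (intro that(1)) auto
qed

text \<open>On \<open>T\<close> the factor \<open>s - t\<close> is negative, so adjoining
  \<open>t\<close> exchanges the two sign conditions on the node polynomial; for sets without
  \<open>t\<close>, positivity at \<open>t\<close> is automatic.\<close>

lemma lower_faces_insert_top:
  assumes T: "finite T" and t: "\<forall>s\<in>T. s < t"
  shows "lower_faces (Suc k) (insert t T) = lower_faces (Suc k) T \<union> insert t ` upper_faces k T"
proof (intro equalityI subsetI)
  fix W assume W: "W \<in> lower_faces (Suc k) (insert t T)"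
  then have "W \<subseteq> insert t T" by (simp add: lower_faces_def)
  then show "W \<in> lower_faces (Suc k) T \<union> insert t ` upper_faces k T"
  proof (cases rule: subset_insert_cases)
    case 1
    then show ?thesis using W by (auto simp: lower_faces_def)
  next
    case (2 U)
    then have "finite U" using T finite_subset by blast
    then have "U \<in> upper_faces k T"
      using W 2 node_poly_insert_top(1)[OF _ t] by (auto simp: lower_faces_def upper_faces_def)
    then show ?thesis using 2 by auto
  qed
next
  fix W assume "W \<in> lower_faces (Suc k) T \<union> insert t ` upper_faces k T"
  then consider "W \<in> lower_faces (Suc k) T" | U where "U \<in> upper_faces k T" "W = insert t U"
    by auto
  then show "W \<in> lower_faces (Suc k) (insert t T)"
  proof cases
    case 1
    then show ?thesis
      using node_poly_pos_above[of W t] t by (auto simp: lower_faces_def intro: less_imp_le)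
  next
    case (2 U)
    then have U: "U \<subseteq> T" "finite U" "t \<notin> U"
      using T t finite_subset by (auto simp: upper_faces_def)
    then show ?thesis
      using 2 node_poly_insert_top(1)[OF _ t] node_poly_eq_0_iff[of "insert t U" t]
      by (auto simp: lower_faces_def upper_faces_def)
  qed
qed

text \<open>Only sets through \<open>t\<close> survive: the node polynomial of a set below
  \<open>t\<close> is positive at \<open>t\<close>.\<close>

lemma upper_faces_insert_top:
  assumes T: "finite T" and t: "\<forall>s\<in>T. s < t"
  shows "upper_faces (Suc k) (insert t T) = insert t ` lower_faces k T"
proof (intro equalityI subsetI)
  fix W assume W: "W \<in> upper_faces (Suc k) (insert t T)"
  then have "W \<subseteq> insert t T" by (simp add: upper_faces_def)
  then show "W \<in> insert t ` lower_faces k T"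
  proof (cases rule: subset_insert_cases)
    case 1
    then show ?thesis using W node_poly_pos_above[of W t] t by (auto simp: upper_faces_def subset_iff)
  next
    case (2 U)
    then have "finite U" using T finite_subset by blast
    then have "U \<in> lower_faces k T"
      using W 2 node_poly_insert_top(2)[OF _ t] by (auto simp: lower_faces_def upper_faces_def)
    then show ?thesis using 2 by auto
  qed
next
  fix W assume "W \<in> insert t ` lower_faces k T"
  then obtain U where 2: "U \<in> lower_faces k T" "W = insert t U"
    by auto
  then have U: "U \<subseteq> T" "finite U" "t \<notin> U"
    using T t finite_subset by (auto simp: lower_faces_def)
  then show "W \<in> upper_faces (Suc k) (insert t T)"
    using 2 node_poly_insert_top(2)[OF _ t] node_poly_eq_0_iff[of "insert t U" t]
    by (auto simp: lower_faces_def upper_faces_def)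
qed

lemma sum_insert_image:
  assumes "\<forall>W\<in>F. t \<notin> W"
  shows "(\<Sum>W\<in>insert t ` F. g W) = (\<Sum>W\<in>F. g (insert t W))"
  using assms by (subst sum.reindex) (auto simp: inj_on_def)

lemma sum_lower_faces_insert_top:
  assumes T: "finite T" and t: "\<forall>s\<in>T. s < t"
  shows "(\<Sum>W\<in>lower_faces (Suc k) (insert t T). g W) =
    (\<Sum>W\<in>lower_faces (Suc k) T. g W) + (\<Sum>W\<in>upper_faces k T. g (insert t W))"
proof -
  have "(\<Sum>W\<in>lower_faces (Suc k) (insert t T). g W) =
    (\<Sum>W\<in>lower_faces (Suc k) T. g W) + (\<Sum>W\<in>insert t ` upper_faces k T. g W)"
    unfolding lower_faces_insert_top[OF assms]
    by (rule sum.union_disjoint) (use assms in \<open>auto simp: lower_faces_def\<close>)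
  also have "(\<Sum>W\<in>insert t ` upper_faces k T. g W) = (\<Sum>W\<in>upper_faces k T. g (insert t W))"
    by (rule sum_insert_image) (use t in \<open>auto simp: upper_faces_def\<close>)
  finally show ?thesis .
qed

lemma sum_upper_faces_insert_top:
  assumes T: "finite T" and t: "\<forall>s\<in>T. s < t"
  shows "(\<Sum>W\<in>upper_faces (Suc k) (insert t T). g W) = (\<Sum>W\<in>lower_faces k T. g (insert t W))"
  unfolding upper_faces_insert_top[OF assms]
  by (rule sum_insert_image) (use t in \<open>auto simp: lower_faces_def\<close>)

text \<open>Among the points of \<open>U\<close>, only \<open>w\<close> is off the zero set of
  \<open>node_poly (U - {w})\<close>, so the sign tells whether \<open>U - {w}\<close> is a lower
  (positive) or an upper (negative) facet of the simplex of \<open>U\<close>.\<close>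

definition boundary_sum :: "(int set \<Rightarrow> real) \<Rightarrow> int set \<Rightarrow> real" where
  "boundary_sum g U = (\<Sum>w\<in>U. sgn (poly (node_poly (U - {w})) (of_int w)) * g (U - {w}))"

lemma boundary_sum_insert_top:
  assumes U: "finite U" and t: "\<forall>s\<in>U. s < t"
  shows "boundary_sum g (insert t U) = g U - boundary_sum (\<lambda>V. g (insert t V)) U"
proof -
  have "t \<notin> U" using t by auto
  have "sgn (poly (node_poly (insert t U - {w})) (of_int w)) * g (insert t U - {w}) =
     - (sgn (poly (node_poly (U - {w})) (of_int w)) * g (insert t (U - {w})))" if "w \<in> U" for w
  proof -
    have "insert t U - {w} = insert t (U - {w})" using that \<open>t \<notin> U\<close> by auto
    moreover have "poly (node_poly (insert t (U - {w}))) (of_int w) =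
        (of_int w - of_int t) * poly (node_poly (U - {w})) (of_int w)"
      using U \<open>t \<notin> U\<close> by (intro poly_node_poly_insert) auto
    ultimately show ?thesis using t that by (simp add: sgn_mult)
  qed
  moreover have "insert t U - {t} = U" "sgn (poly (node_poly U) (of_int t)) = 1"
    using \<open>t \<notin> U\<close> node_poly_pos_above[OF t] by auto
  ultimately show ?thesis
    using U \<open>t \<notin> U\<close> by (simp add: boundary_sum_def sum_negf)
qed

text \<open>Interior facets cancel. The induction adds a largest node and uses the cone formula
  above; \<open>g\<close> has to vary, because coning replaces it by
  \<open>\<lambda>V. g (insert t V)\<close>.\<close>

lemma sum_boundary_faces:
  assumes "finite T"
  shows "(\<Sum>U\<in>lower_faces (Suc k) T. boundary_sum g U) =
      (\<Sum>W\<in>lower_faces k T. g W) - (\<Sum>W\<in>upper_faces k T. g W) \<and>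
    (\<Sum>U\<in>upper_faces (Suc k) T. boundary_sum g U) =
      (\<Sum>W\<in>lower_faces k T. g W) - (\<Sum>W\<in>upper_faces k T. g W)"
  using assms
proof (induction T arbitrary: k g rule: finite_linorder_max_induct)
  case empty
  have "lower_faces (Suc k) {} = {}" "upper_faces (Suc k) {} = {}"
    "lower_faces k {} = upper_faces k {}" for k
    by (auto simp: lower_faces_def upper_faces_def)
  then show ?case by simp
next
  case (insert t T)
  note T = \<open>finite T\<close> \<open>\<forall>s\<in>T. s < t\<close>
  note IH = insert.IH[THEN conjunct1] insert.IH[THEN conjunct2]
  have bd: "boundary_sum g (insert t U) = g U - boundary_sum (\<lambda>V. g (insert t V)) U"
    if "U \<subseteq> T" for U g
    using that T finite_subset by (intro boundary_sum_insert_top) auto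
  have lower: "(\<Sum>U\<in>lower_faces k T. boundary_sum g (insert t U)) =
      (\<Sum>U\<in>lower_faces k T. g U) - (\<Sum>U\<in>lower_faces k T. boundary_sum (\<lambda>V. g (insert t V)) U)"
    and upper: "(\<Sum>U\<in>upper_faces k T. boundary_sum g (insert t U)) =
      (\<Sum>U\<in>upper_faces k T. g U) - (\<Sum>U\<in>upper_faces k T. boundary_sum (\<lambda>V. g (insert t V)) U)"
    for k g
    unfolding sum_subtractf[symmetric]
    by (rule sum.cong[OF refl], rule bd, simp add: lower_faces_def upper_faces_def)+
  show ?case
  proof (cases k)
    case 0
    then show ?thesis
      using T unfolding sum_lower_faces_insert_top[OF T] sum_upper_faces_insert_top[OF T]
        lower upper IH
      by (simp add: lower_faces_0 upper_faces_0 boundary_sum_def)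
  next
    case (Suc k')
    show ?thesis
      unfolding Suc sum_lower_faces_insert_top[OF T] sum_upper_faces_insert_top[OF T]
        lower upper IH
      by simp
  qed
qed

subsection \<open>Divided differences and power sums\<close>

text \<open>The left-hand side is the divided difference of \<open>p\<close> over \<open>V\<close>.\<close>

lemma divided_difference:
  fixes V :: "'a :: field set"
  assumes V: "finite V" and p: "degree p < card V"
  shows "(\<Sum>w\<in>V. poly p w / (\<Prod>v\<in>V - {w}. w - v)) = coeff p (card V - 1)"
proof -
  define l where "l = (\<lambda>w. \<Prod>v\<in>V - {w}. [:- v, 1:])"
  define q where "q = (\<Sum>w\<in>V. smult (poly p w / (\<Prod>v\<in>V - {w}. w - v)) (l w))"
  have deg: "degree (l w) = card V - 1" if "w \<in> V" for w
    unfolding l_def using V that by (subst degree_prod_sum_eq) auto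
  have lead: "coeff (l w) (card V - 1) = 1" if "w \<in> V" for w
  proof -
    have "lead_coeff (l w) = 1" by (simp add: l_def lead_coeff_prod)
    then show ?thesis using deg[OF that] by simp
  qed
  have "poly p x = poly q x" if "x \<in> V" for x
  proof -
    have zero: "poly (l w) x = 0" if "w \<in> V - {x}" for w
      using that \<open>x \<in> V\<close> V by (auto simp: l_def poly_prod)
    have "poly q x = (\<Sum>w\<in>V. poly p w / (\<Prod>v\<in>V - {w}. w - v) * poly (l w) x)"
      by (simp add: q_def poly_sum)
    also have "\<dots> = (\<Sum>w\<in>{x}. poly p w / (\<Prod>v\<in>V - {w}. w - v) * poly (l w) x)"
      by (rule sum.mono_neutral_right) (use V that zero in auto)
    also have "\<dots> = poly p x"
      using V by (simp add: l_def poly_prod prod_zero_iff)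
    finally show ?thesis by simp
  qed
  moreover have "degree q < card V"
  proof -
    have "degree q \<le> card V - 1"
      unfolding q_def using V deg by (intro degree_sum_le) (auto intro: order.trans[OF degree_smult_le])
    then show ?thesis using p by simp
  qed
  ultimately have "p = q"
    using p by (intro poly_eqI_degree[of V]) auto
  then have "coeff p (card V - 1) = coeff q (card V - 1)" by simp
  also have "\<dots> = (\<Sum>w\<in>V. poly p w / (\<Prod>v\<in>V - {w}. w - v))"
    unfolding q_def coeff_sum using lead by (intro sum.cong) auto
  finally show ?thesis by simp
qed

lemma pcompose_linear_top:
  fixes q :: "'a :: comm_ring_1 poly"
  assumes "degree q \<le> n"
  shows "degree (q \<circ>\<^sub>p [:a, b:]) \<le> n \<and> coeff (q \<circ>\<^sub>p [:a, b:]) n = coeff q n * b ^ n"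
  using assms
proof (induction n arbitrary: q)
  case 0
  then obtain c where "q = [:c:]" by (auto elim: degree_eq_zeroE)
  then show ?case by simp
next
  case (Suc n)
  obtain c p where q: "q = pCons c p" by (cases q)
  then have "degree p \<le> n" using Suc.prems by (auto split: if_splits)
  note IH = Suc.IH[OF this]
  then have "coeff (p \<circ>\<^sub>p [:a, b:]) (Suc n) = 0" by (simp add: coeff_eq_0)
  moreover have "degree ([:a, b:] * (p \<circ>\<^sub>p [:a, b:])) \<le> Suc n"
    using IH by (intro order.trans[OF degree_mult_le]) auto
  ultimately show ?case
    using IH by (simp add: q pcompose_pCons degree_add_le mult_ac)
qed

text \<open>As a polynomial in \<open>w\<close> the numerator has degree at most \<open>n\<close>,
  with coefficient \<open>coeff q n * (- y) ^ n\<close> there; the reversed differences in the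
  denominator supply another \<open>(- 1) ^ n\<close>. All lower coefficients of \<open>q\<close>
  disappear.\<close>

lemma divided_difference_affine:
  fixes q :: "real poly"
  assumes V: "finite V" "card V = Suc n" and q: "degree q \<le> n"
  shows "(\<Sum>w\<in>V. poly q (a - w * y) / (\<Prod>v\<in>V - {w}. v - w)) = coeff q n * y ^ n"
proof -
  define r where "r = q \<circ>\<^sub>p [:a, - y:]"
  have deg: "degree r \<le> n" and coeff: "coeff r n = coeff q n * (- y) ^ n"
    using pcompose_linear_top[OF q, of a "- y"] by (auto simp: r_def)
  have "(\<Sum>w\<in>V. poly q (a - w * y) / (\<Prod>v\<in>V - {w}. v - w)) =
      (\<Sum>w\<in>V. (- 1) ^ n * (poly r w / (\<Prod>v\<in>V - {w}. w - v)))"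
  proof (intro sum.cong refl)
    fix w assume w: "w \<in> V"
    have "(\<Prod>v\<in>V - {w}. v - w) = (\<Prod>v\<in>V - {w}. (- 1) * (w - v))" by simp
    also have "\<dots> = (- 1) ^ n * (\<Prod>v\<in>V - {w}. w - v)"
      using V w by (subst prod.distrib) simp
    finally have "(\<Prod>v\<in>V - {w}. v - w) = (- 1) ^ n * (\<Prod>v\<in>V - {w}. w - v)" .
    moreover have "poly r w = poly q (a - w * y)"
      by (simp add: r_def poly_pcompose)
    moreover have "(- 1 :: real) ^ n = 1 \<or> (- 1 :: real) ^ n = - 1"
      by (cases "even n") auto
    ultimately show "poly q (a - w * y) / (\<Prod>v\<in>V - {w}. v - w) =
        (- 1) ^ n * (poly r w / (\<Prod>v\<in>V - {w}. w - v))"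
      by auto
  qed
  moreover have "(\<Sum>w\<in>V. poly r w / (\<Prod>v\<in>V - {w}. w - v)) = coeff r n"
    using divided_difference[of V r] V deg by simp
  moreover have "(- 1) ^ n * (- y) ^ n = y ^ n"
    by (simp flip: power_mult_distrib)
  ultimately show ?thesis
    by (simp only: coeff flip: sum_distrib_left) simp
qed

text \<open>Faulhaber's formula. Only the leading coefficient will matter, and dividing by
  \<open>fact j\<close> makes it \<open>1 / fact (Suc j)\<close>, the normalization of the next
  truncated power.\<close>

lemma power_sum_poly:
  "\<exists>q :: real poly. degree q \<le> Suc j \<and> coeff q (Suc j) = 1 / fact (Suc j) \<and>
    (\<forall>N. poly q (real N) = (\<Sum>n=1..N. real n ^ j / fact j))"
proof -
  have "\<exists>q :: real poly. degree q \<le> Suc j \<and> coeff q (Suc j) = 1 / real (Suc j) \<and>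
    (\<forall>N. poly q (real N) = (\<Sum>n=1..N. real n ^ j))"
  proof (induction j rule: less_induct)
    case (less j)
    then obtain q where q: "\<And>i. i < j \<Longrightarrow> degree (q i) \<le> Suc i"
      "\<And>i N. i < j \<Longrightarrow> poly (q i) (real N) = (\<Sum>n=1..N. real n ^ i)"
      by metis
    define c where "c = (\<lambda>i. real (Suc j choose i) * (- 1) ^ (Suc j - i))"
    define r where "r = smult (1 / real (Suc j)) (monom 1 (Suc j) + (\<Sum>i<j. smult (c i) (q i)))"
    have deg: "degree (\<Sum>i<j. smult (c i) (q i)) \<le> j"
      using q(1) by (intro degree_sum_le) (auto intro!: order.trans[OF degree_smult_le] Suc_leI intro: order.trans)
    have "degree r \<le> Suc j"
      unfolding r_def using deg
      by (intro order.trans[OF degree_smult_le] degree_add_le) (auto simp: degree_monom_eq)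
    moreover have "coeff r (Suc j) = 1 / real (Suc j)"
      using deg by (simp add: r_def coeff_eq_0)
    moreover have "poly r (real N) = (\<Sum>n=1..N. real n ^ j)" for N
    proof -
      have step: "real n ^ Suc j - (real n - 1) ^ Suc j = real (Suc j) * real n ^ j - (\<Sum>i<j. c i * real n ^ i)" for n
      proof -
        have "(real n - 1) ^ Suc j = (\<Sum>i\<le>Suc j. c i * real n ^ i)"
          using binomial_ring[of "real n" "- 1" "Suc j"] by (simp add: c_def mult_ac)
        also have "\<dots> = (\<Sum>i<j. c i * real n ^ i) + c j * real n ^ j + c (Suc j) * real n ^ Suc j"
          by (simp add: lessThan_Suc_atMost[symmetric] del: lessThan_Suc_atMost)
        finally have "(real n - 1) ^ Suc j =
            (\<Sum>i<j. c i * real n ^ i) + c j * real n ^ j + c (Suc j) * real n ^ Suc j" .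
        moreover have "c j = - real (Suc j)" "c (Suc j) = 1" by (simp_all add: c_def)
        ultimately show ?thesis by (simp add: algebra_simps)
      qed
      have "(\<Sum>n=1..N. real n ^ Suc j - (real n - 1) ^ Suc j) = real N ^ Suc j"
        by (induction N) simp_all
      then have "real N ^ Suc j = real (Suc j) * (\<Sum>n=1..N. real n ^ j) - (\<Sum>n=1..N. \<Sum>i<j. c i * real n ^ i)"
        unfolding step by (simp add: sum_subtractf sum_distrib_left)
      also have "(\<Sum>n=1..N. \<Sum>i<j. c i * real n ^ i) = (\<Sum>i<j. c i * poly (q i) (real N))"
        by (subst sum.swap) (simp add: q(2) sum_distrib_left)
      finally show ?thesis
        by (simp add: r_def poly_sum poly_monom)
    qed
    ultimately show ?case by blast
  qed
  then obtain q :: "real poly" where q: "degree q \<le> Suc j" "coeff q (Suc j) = 1 / real (Suc j)"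
    "\<And>N. poly q (real N) = (\<Sum>n=1..N. real n ^ j)"
    by blast
  show ?thesis
    by (intro exI[of _ "smult (1 / fact j) q"])
      (use q in \<open>auto simp: sum_divide_distrib intro: order.trans[OF degree_smult_le]\<close>)
qed

lemma divided_difference_affine_int:
  fixes q :: "real poly" and V :: "int set"
  assumes V: "finite V" "card V = Suc n" and q: "degree q \<le> n"
  shows "(\<Sum>w\<in>V. poly q (a - of_int w * y) / (\<Prod>v\<in>V - {w}. of_int v - of_int w)) = coeff q n * y ^ n"
proof -
  have inj: "inj_on real_of_int A" for A by (auto simp: inj_on_def)
  have "(\<Sum>w\<in>real_of_int ` V. poly q (a - w * y) / (\<Prod>v\<in>real_of_int ` V - {w}. v - w)) = coeff q n * y ^ n"
    using V q by (intro divided_difference_affine) (auto simp: card_image inj)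
  also have "(\<Sum>w\<in>real_of_int ` V. poly q (a - w * y) / (\<Prod>v\<in>real_of_int ` V - {w}. v - w)) =
      (\<Sum>w\<in>V. poly q (a - of_int w * y) / (\<Prod>v\<in>real_of_int ` V - {of_int w}. v - of_int w))"
    by (simp add: sum.reindex inj)
  also have "\<dots> = (\<Sum>w\<in>V. poly q (a - of_int w * y) / (\<Prod>v\<in>V - {w}. of_int v - of_int w))"
  proof (intro sum.cong refl)
    fix w assume "w \<in> V"
    have "real_of_int ` V - {of_int w} = real_of_int ` (V - {w})" by auto
    then show "poly q (a - of_int w * y) / (\<Prod>v\<in>real_of_int ` V - {of_int w}. v - of_int w) =
      poly q (a - of_int w * y) / (\<Prod>v\<in>V - {w}. of_int v - of_int w)"
      by (simp add: prod.reindex inj)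
  qed
  finally show ?thesis .
qed

subsection \<open>Half-open simplices and their fibre volumes\<close>

text \<open>
  For \<open>card U = k\<close> this is the indicator function of the cone over the simplex with vertices
  \<open>(1, u, \<dots>, u ^ (k - 1))\<close>, \<open>u \<in> U\<close>, without its lower boundary, where recursively also the
  lower boundaries of the projections to fewer coordinates are removed.
\<close>

primrec cell :: "nat \<Rightarrow> int set \<Rightarrow> (nat \<Rightarrow> real) \<Rightarrow> real" where
  "cell 0 U z = 1"
| "cell (Suc k) U z =
    boundary_sum (\<lambda>W. cell k W z * of_bool (functional z (node_poly W) > 0)) U"

lemma cell_cong:
  assumes "finite U" "card U = k" "\<And>i. i < k \<Longrightarrow> z i = z' i"
  shows "cell k U z = cell k U z'"
  using assms
proof (induction k arbitrary: U)
  case (Suc k)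
  have "cell k (U - {w}) z = cell k (U - {w}) z'"
    "functional z (node_poly (U - {w})) = functional z' (node_poly (U - {w}))" if "w \<in> U" for w
    using Suc that by (auto intro!: functional_cong simp: degree_node_poly card_Diff_singleton)
  then show ?case by (simp add: boundary_sum_def)
qed simp

definition normalized_cell :: "nat \<Rightarrow> int set \<Rightarrow> (nat \<Rightarrow> real) \<Rightarrow> real" where
  "normalized_cell k U z = cell k U z / vandermonde U"

text \<open>Since \<open>vandermonde U\<close> is \<open>vandermonde (U - {w})\<close> times the
  absolute value of the node polynomial at \<open>w\<close>, the normalization turns the sign in
  \<open>boundary_sum\<close> into a reciprocal, and the recursion takes the shape of a divided
  difference.\<close>

lemma normalized_cell_Suc:
  assumes "finite U"
  shows "normalized_cell (Suc k) U z =
    (\<Sum>w\<in>U. normalized_cell k (U - {w}) z * of_bool (functional z (node_poly (U - {w})) > 0) /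
      poly (node_poly (U - {w})) (of_int w))"
  unfolding normalized_cell_def cell.simps boundary_sum_def sum_divide_distrib
proof (intro sum.cong refl)
  fix w assume w: "w \<in> U"
  define p where "p = poly (node_poly (U - {w})) (real_of_int w)"
  have "p \<noteq> 0" using assms by (simp add: p_def node_poly_eq_0_iff)
  moreover have "vandermonde U = vandermonde (U - {w}) * \<bar>p\<bar>"
    unfolding p_def using assms w by (rule vandermonde_remove)
  moreover have "vandermonde (U - {w}) > 0" using assms by (intro vandermonde_pos) auto
  ultimately show "sgn (poly (node_poly (U - {w})) (real_of_int w)) *
      (cell k (U - {w}) z * of_bool (0 < functional z (node_poly (U - {w})))) / vandermonde U =
    cell k (U - {w}) z / vandermonde (U - {w}) *
      of_bool (0 < functional z (node_poly (U - {w}))) / poly (node_poly (U - {w})) (real_of_int w)"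
    unfolding p_def[symmetric] by (simp add: field_simps sgn_if abs_if)
qed

text \<open>
  Up to the factor \<^term>\<open>vandermonde U\<close>, this is the volume of the fibre of the cell of \<open>U\<close> over
  \<open>(z\<^sub>0, \<dots>, z\<^sub>k)\<close>. As a function of \<open>z\<^sub>k\<close> it is a spline with simple integral knots, which is why
  summing it over the integers is the same as integrating it.
\<close>

definition fibre_spline :: "nat \<Rightarrow> int set \<Rightarrow> (nat \<Rightarrow> real) \<Rightarrow> real" where
  "fibre_spline k U z = (\<Sum>W | W \<subseteq> U \<and> card W = k.
    normalized_cell k W z * (of_bool (functional z (node_poly W) > 0) *
      functional z (node_poly W) ^ (card U - Suc k) / fact (card U - Suc k)) /
      (\<Prod>v\<in>U - W. poly (node_poly W) (of_int v)))"

text \<open>The bottom stage: over \<open>z 0\<close> alone the fibre is the whole simplex dilated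
  by \<open>z 0\<close>, of volume \<open>vandermonde U * z 0 ^ d / fact d\<close>.\<close>

lemma fibre_spline_0:
  assumes "finite U" "card U = Suc d" "z 0 > 0"
  shows "fibre_spline 0 U z = z 0 ^ d / fact d"
proof -
  have "{W. W \<subseteq> U \<and> card W = 0} = {{}}"
    using assms(1) by (auto dest: finite_subset)
  then show ?thesis
    using assms by (simp add: fibre_spline_def normalized_cell_def functional_def)
qed

text \<open>The top stage: all coordinates are fixed, the exponent is 0, and the spline is the
  normalized cell.\<close>

lemma fibre_spline_top:
  assumes "finite U" "card U = Suc k"
  shows "fibre_spline k U z = normalized_cell (Suc k) U z"
proof -
  have set: "{W. W \<subseteq> U \<and> card W = k} = (\<lambda>w. U - {w}) ` U"
  proof (intro equalityI subsetI)
    fix W assume W: "W \<in> {W. W \<subseteq> U \<and> card W = k}"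
    then have "card (U - W) = 1"
      using assms finite_subset by (subst card_Diff_subset) auto
    then obtain w where "U - W = {w}" by (metis card_1_singletonE)
    then have "W = U - {w}" "w \<in> U" using W by auto
    then show "W \<in> (\<lambda>w. U - {w}) ` U" by auto
  qed (use assms in auto)
  have "inj_on (\<lambda>w. U - {w}) U" by (auto simp: inj_on_def)
  moreover have "U - (U - {w}) = {w}" if "w \<in> U" for w using that by auto
  ultimately show ?thesis
    unfolding fibre_spline_def set normalized_cell_Suc[OF assms(1)]
    using assms by (simp add: sum.reindex)
qed

text \<open>Collects the terms by the smaller set \<open>V\<close>, so that the sum over the added
  node becomes a divided difference over \<open>U - V\<close>.\<close>

lemma sum_subset_remove:
  assumes "finite U"
  shows "(\<Sum>W | W \<subseteq> U \<and> card W = Suc k. \<Sum>w\<in>W. f (W - {w}) w) =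
    (\<Sum>V | V \<subseteq> U \<and> card V = k. \<Sum>w\<in>U - V. f V w)"
proof -
  have fin: "finite {W. W \<subseteq> U \<and> card W = n}" for n
    by (rule finite_subset[of _ "Pow U"]) (use assms in auto)
  have "(\<Sum>W | W \<subseteq> U \<and> card W = Suc k. \<Sum>w\<in>W. f (W - {w}) w) =
    (\<Sum>(W, w)\<in>(SIGMA W:{W. W \<subseteq> U \<and> card W = Suc k}. W). f (W - {w}) w)"
    using assms by (intro sum.Sigma fin) (auto dest: finite_subset)
  also have "\<dots> = (\<Sum>(V, w)\<in>(SIGMA V:{V. V \<subseteq> U \<and> card V = k}. U - V). f V w)"
  proof (rule sum.reindex_bij_witness[of _ "\<lambda>(V, w). (insert w V, w)" "\<lambda>(W, w). (W - {w}, w)"])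
    fix a assume "a \<in> (SIGMA V:{V. V \<subseteq> U \<and> card V = k}. U - V)"
    then show "(case a of (V, w) \<Rightarrow> (insert w V, w)) \<in> (SIGMA W:{W. W \<subseteq> U \<and> card W = Suc k}. W)"
      using assms by (auto simp: card_insert_disjoint dest: finite_subset)
  qed (auto simp: insert_absorb)
  also have "\<dots> = (\<Sum>V | V \<subseteq> U \<and> card V = k. \<Sum>w\<in>U - V. f V w)"
    using assms by (intro sum.Sigma[symmetric] fin) auto
  finally show ?thesis .
qed

lemma functional_Ints:
  assumes "finite W" "\<And>i. i \<le> card W \<Longrightarrow> z i \<in> \<int>"
  shows "functional z (node_poly W) \<in> \<int>"
  unfolding functional_def degree_node_poly[OF assms(1)]
  using assms by (intro Ints_sum Ints_mult coeff_node_poly_Ints) auto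

lemma sum_truncated_power:
  assumes "\<bar>a\<bar> \<le> R"
  shows "(\<Sum>x\<in>{-R..R}. of_bool (real_of_int (a + x) > 0) * real_of_int (a + x) ^ j / fact j) =
    (\<Sum>n=1..nat (R + a). real n ^ j / fact j)"
proof -
  have "(\<Sum>x\<in>{-R..R}. of_bool (real_of_int (a + x) > 0) * real_of_int (a + x) ^ j / fact j) =
    (\<Sum>x\<in>{1 - a..R}. real_of_int (a + x) ^ j / fact j)"
    by (rule sum.mono_neutral_cong_right) (use assms in auto)
  also have "\<dots> = (\<Sum>n=1..nat (R + a). real n ^ j / fact j)"
    by (rule sum.reindex_bij_witness[of _ "\<lambda>n. int n - a" "\<lambda>x. nat (a + x)"]) auto
  finally show ?thesis .
qed

text \<open>Why the sum equals the integral: over a window containing all knots, the sum of a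
  truncated power is a polynomial \<open>q\<close> in the position of the knot. Expanding the cell
  of \<open>W\<close> and regrouping by \<open>V = W - {w}\<close> gives divided differences of
  \<open>q\<close>, of degree at most \<open>j + 1\<close>, over the \<open>j + 2\<close> nodes of
  \<open>U - V\<close>, so only the coefficient \<open>1 / fact (Suc j)\<close> of \<open>q\<close>
  survives.\<close>

lemma sum_fibre_spline:
  assumes U: "finite U" "Suc k < card U" and z: "\<And>i. i \<le> k \<Longrightarrow> z i \<in> \<int>"
    and R: "\<And>W. W \<subseteq> U \<Longrightarrow> card W = Suc k \<Longrightarrow> cell (Suc k) W z \<noteq> 0 \<Longrightarrow>
      \<bar>functional (z(Suc k := 0)) (node_poly W)\<bar> \<le> of_int R"
  shows "(\<Sum>x\<in>{-R..R}. fibre_spline (Suc k) U (z(Suc k := of_int x))) = fibre_spline k U z"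
proof -
  define j where "j = card U - Suc (Suc k)"
  have j: "card U - Suc k = Suc j" using U by (simp add: j_def)
  obtain q :: "real poly" where q: "degree q \<le> Suc j" "coeff q (Suc j) = 1 / fact (Suc j)"
    "\<And>N. poly q (real N) = (\<Sum>n=1..N. real n ^ j / fact j)"
    using power_sum_poly by blast
  define A where "A = (\<lambda>W. functional (z(Suc k := 0)) (node_poly W))"
  define D where "D = (\<lambda>W. \<Prod>v\<in>U - W. poly (node_poly W) (real_of_int v))"
  define f where "f = (\<lambda>V w. normalized_cell k V z * of_bool (functional z (node_poly V) > 0) /
    poly (node_poly V) (of_int w) * poly q (of_int R + A (insert w V)) / D (insert w V))"
  have finW: "finite W" if "W \<subseteq> U" for W using that U finite_subset by blast
  have upd: "functional (z(Suc k := x)) (node_poly W) = A W + x" if "W \<subseteq> U" "card W = Suc k" for W x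
    unfolding A_def using that finW by (intro functional_node_poly_update) auto
  have cell: "normalized_cell (Suc k) W (z(Suc k := x)) = normalized_cell (Suc k) W z"
    if "W \<subseteq> U" "card W = Suc k" for W x
    unfolding normalized_cell_def using that finW by (subst cell_cong[of W _ _ z]) auto
  \<comment> \<open>A vanishing cell gives no bound on \<open>A W\<close>, so the identity carries
    the cell as a factor. Otherwise the knot \<open>- A W\<close> is an integer in the window, and
    \<open>R + a\<close> is a natural number.\<close>
  have 1: "normalized_cell (Suc k) W z * ((\<Sum>x\<in>{-R..R}. of_bool (A W + of_int x > 0) * (A W + of_int x) ^ j) / fact j) =
      normalized_cell (Suc k) W z * poly q (of_int R + A W)" if W: "W \<subseteq> U" "card W = Suc k" for W
  proof (cases "cell (Suc k) W z = 0")
    case True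
    then show ?thesis by (simp add: normalized_cell_def)
  next
    case False
    have "A W \<in> \<int>" unfolding A_def
      using z W finW by (intro functional_Ints) (auto simp: le_Suc_eq)
    then obtain a where a: "A W = of_int a" by (auto elim: Ints_cases)
    have "\<bar>A W\<bar> \<le> of_int R" using R[OF W False] by (simp add: A_def)
    then have "\<bar>a\<bar> \<le> R" unfolding a by linarith
    then have "poly q (of_int R + A W) = poly q (real (nat (R + a)))"
      by (simp add: a)
    then have "poly q (of_int R + A W) =
        (\<Sum>x\<in>{-R..R}. of_bool (real_of_int (a + x) > 0) * real_of_int (a + x) ^ j / fact j)"
      unfolding q(3) sum_truncated_power[OF \<open>\<bar>a\<bar> \<le> R\<close>, symmetric] .
    then show ?thesis
      by (simp only: a of_int_add sum_divide_distrib)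
  qed
  have "(\<Sum>x\<in>{-R..R}. fibre_spline (Suc k) U (z(Suc k := of_int x))) =
    (\<Sum>x\<in>{-R..R}. \<Sum>W | W \<subseteq> U \<and> card W = Suc k. normalized_cell (Suc k) W z *
      (of_bool (A W + of_int x > 0) * (A W + of_int x) ^ j / fact j) / D W)"
    unfolding fibre_spline_def by (intro sum.cong refl) (simp add: upd cell j_def D_def)
  also have "\<dots> = (\<Sum>W | W \<subseteq> U \<and> card W = Suc k. \<Sum>x\<in>{-R..R}. normalized_cell (Suc k) W z *
      (of_bool (A W + of_int x > 0) * (A W + of_int x) ^ j / fact j) / D W)"
    by (rule sum.swap)
  also have "\<dots> = (\<Sum>W | W \<subseteq> U \<and> card W = Suc k. normalized_cell (Suc k) W z * poly q (of_int R + A W) / D W)"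
  proof (intro sum.cong refl)
    fix W assume "W \<in> {W. W \<subseteq> U \<and> card W = Suc k}"
    then show "(\<Sum>x\<in>{-R..R}. normalized_cell (Suc k) W z *
        (of_bool (A W + of_int x > 0) * (A W + of_int x) ^ j / fact j) / D W) =
      normalized_cell (Suc k) W z * poly q (of_int R + A W) / D W"
      unfolding sum_divide_distrib[symmetric] sum_distrib_left[symmetric] by (subst 1) auto
  qed
  also have "\<dots> = (\<Sum>W | W \<subseteq> U \<and> card W = Suc k. \<Sum>w\<in>W. f (W - {w}) w)"
  proof (intro sum.cong refl)
    fix W assume "W \<in> {W. W \<subseteq> U \<and> card W = Suc k}"
    then have "finite W" using finW by auto
    show "normalized_cell (Suc k) W z * poly q (of_int R + A W) / D W = (\<Sum>w\<in>W. f (W - {w}) w)"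
      unfolding normalized_cell_Suc[OF \<open>finite W\<close>] sum_distrib_right sum_divide_distrib f_def
      by (rule sum.cong) (auto simp: insert_absorb)
  qed
  also have "\<dots> = (\<Sum>V | V \<subseteq> U \<and> card V = k. \<Sum>w\<in>U - V. f V w)"
    by (rule sum_subset_remove[OF U(1)])
  also have "\<dots> = fibre_spline k U z"
    unfolding fibre_spline_def
  proof (intro sum.cong refl)
    fix V assume "V \<in> {V. V \<subseteq> U \<and> card V = k}"
    then have V: "V \<subseteq> U" "card V = k" "finite V" using finW by auto
    define y where "y = functional z (node_poly V)"
    define b where "b = functional (z(Suc k := 0)) (pCons 0 (node_poly V))"
    have card: "card (U - V) = Suc (Suc j)"
      using V U by (simp add: card_Diff_subset j_def)
    \<comment> \<open>The functional depends affinely on the added node, with slope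
      \<open>- y\<close>, as the divided difference requires.\<close>
    have A: "A (insert w V) = b - of_int w * y" if "w \<in> U - V" for w
    proof -
      have "functional (z(Suc k := 0)) (node_poly V) = y"
        unfolding y_def by (rule functional_cong) (use V in \<open>auto simp: degree_node_poly\<close>)
      then show ?thesis
        using that V unfolding A_def b_def by (simp add: node_poly_insert functional_linear_mult del: mult_pCons_left)
    qed
    have D: "poly (node_poly V) (of_int w) * D (insert w V) =
      D V * (\<Prod>v\<in>U - V - {w}. of_int v - of_int w)" if w: "w \<in> U - V" for w
    proof -
      have "U - insert w V = U - V - {w}" by auto
      then have "D (insert w V) = (\<Prod>v\<in>U - V - {w}. (of_int v - of_int w) * poly (node_poly V) (of_int v))"
        using w V by (simp add: D_def poly_node_poly_insert)
      moreover have "D V = poly (node_poly V) (of_int w) * (\<Prod>v\<in>U - V - {w}. poly (node_poly V) (of_int v))"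
        unfolding D_def using w U by (intro prod.remove) auto
      ultimately show ?thesis by (simp add: prod.distrib mult_ac)
    qed
    have "(\<Sum>w\<in>U - V. f V w) = (\<Sum>w\<in>U - V. normalized_cell k V z * of_bool (y > 0) / D V *
        (poly q ((of_int R + b) - of_int w * y) / (\<Prod>v\<in>U - V - {w}. of_int v - of_int w)))"
    proof (intro sum.cong refl)
      fix w assume w: "w \<in> U - V"
      have "f V w = normalized_cell k V z * of_bool (y > 0) * poly q ((of_int R + b) - of_int w * y) /
          (poly (node_poly V) (of_int w) * D (insert w V))"
        by (simp add: f_def A[OF w] y_def diff_add_eq add_diff_eq)
      then show "f V w = normalized_cell k V z * of_bool (y > 0) / D V *
        (poly q ((of_int R + b) - of_int w * y) / (\<Prod>v\<in>U - V - {w}. of_int v - of_int w))"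
        unfolding D[OF w] by simp
    qed
    also have "\<dots> = normalized_cell k V z * of_bool (y > 0) / D V * (y ^ Suc j / fact (Suc j))"
      unfolding sum_distrib_left[symmetric]
      using divided_difference_affine_int[OF _ card q(1), of "of_int R + b" y] U(1) q(2) by simp
    finally show "(\<Sum>w\<in>U - V. f V w) =
      normalized_cell k V z * (of_bool (functional z (node_poly V) > 0) *
        functional z (node_poly V) ^ (card U - Suc k) / fact (card U - Suc k)) /
      (\<Prod>v\<in>U - V. poly (node_poly V) (of_int v))"
      unfolding j y_def D_def by simp
  qed
  finally show ?thesis .
qed

text \<open>Points are homogenized: coordinate 0 holds the dilation factor. Coordinates beyond
  \<open>d\<close> are fixed to 0, which makes the box finite.\<close>

definition lattice_box :: "nat \<Rightarrow> int \<Rightarrow> int \<Rightarrow> (nat \<Rightarrow> int) set" where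
  "lattice_box d R m = {z. z 0 = m \<and> (\<forall>i\<in>{1..d}. z i \<in> {-R..R}) \<and> (\<forall>i>d. z i = 0)}"

lemma lattice_box_0: "lattice_box 0 R m = {(\<lambda>_. 0)(0 := m)}"
  by (auto simp: lattice_box_def fun_eq_iff)

lemma lattice_box_Suc:
  "lattice_box (Suc d) R m = (\<lambda>(z, x). z(Suc d := x)) ` (lattice_box d R m \<times> {-R..R})"
proof (intro equalityI subsetI)
  fix z assume "z \<in> lattice_box (Suc d) R m"
  then have "(z(Suc d := 0), z (Suc d)) \<in> lattice_box d R m \<times> {-R..R}"
    "z = (\<lambda>(z, x). z(Suc d := x)) (z(Suc d := 0), z (Suc d))"
    by (auto simp: lattice_box_def)
  then show "z \<in> (\<lambda>(z, x). z(Suc d := x)) ` (lattice_box d R m \<times> {-R..R})"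
    by (rule rev_image_eqI)
qed (auto simp: lattice_box_def)

lemma inj_on_lattice_box_update:
  "inj_on (\<lambda>(z, x). z(Suc d := x)) (lattice_box d R m \<times> X)"
proof (rule inj_onI, clarify)
  fix z x z' x'
  assume z: "z \<in> lattice_box d R m" "z' \<in> lattice_box d R m" and eq: "z(Suc d := x) = z'(Suc d := x')"
  have "z i = z' i" for i
    using fun_cong[OF eq, of i] z by (cases "i = Suc d") (auto simp: lattice_box_def)
  with fun_cong[OF eq, of "Suc d"] show "z = z' \<and> x = x'" by auto
qed

lemma sum_lattice_box_Suc:
  "(\<Sum>z\<in>lattice_box (Suc d) R m. f z) = (\<Sum>z\<in>lattice_box d R m. \<Sum>x\<in>{-R..R}. f (z(Suc d := x)))"
  unfolding lattice_box_Suc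
  by (subst sum.reindex[OF inj_on_lattice_box_update]) (simp add: sum.cartesian_product case_prod_beta')

lemma finite_lattice_box [simp]: "finite (lattice_box d R m)"
  by (induction d) (simp_all add: lattice_box_0 lattice_box_Suc)

text \<open>The sum of \<open>fibre_spline k U\<close> over the box does not depend on
  \<open>k\<close>, since each stage sums out one coordinate. It is the volume for
  \<open>k = 0\<close> and the sum of the cell for \<open>k = d\<close>, both divided by
  \<open>vandermonde U\<close>.\<close>

lemma sum_cell_lattice_box:
  assumes U: "finite U" "card U = Suc d" and m: "m > 0"
    and R: "\<And>k W z. W \<subseteq> U \<Longrightarrow> card W = Suc k \<Longrightarrow> z 0 = real_of_int m \<Longrightarrow> cell (Suc k) W z \<noteq> 0 \<Longrightarrow>
      \<bar>functional (z(Suc k := 0)) (node_poly W)\<bar> \<le> of_int R"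
  shows "(\<Sum>z\<in>lattice_box d R m. cell (Suc d) U (real_of_int \<circ> z)) =
    vandermonde U / fact d * of_int m ^ d"
proof -
  have "(\<Sum>z\<in>lattice_box k R m. fibre_spline k U (real_of_int \<circ> z)) = of_int m ^ d / fact d"
    if "k \<le> d" for k
    using that
  proof (induction k)
    case 0
    then show ?case
      using U m by (simp add: lattice_box_0 fibre_spline_0[OF U])
  next
    case (Suc k)
    have "(\<Sum>x\<in>{-R..R}. fibre_spline (Suc k) U ((real_of_int \<circ> z)(Suc k := of_int x))) =
        fibre_spline k U (real_of_int \<circ> z)" if "z \<in> lattice_box k R m" for z
      using U Suc.prems that by (intro sum_fibre_spline R) (auto simp: lattice_box_def)
    then have "(\<Sum>z\<in>lattice_box (Suc k) R m. fibre_spline (Suc k) U (real_of_int \<circ> z)) =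
        (\<Sum>z\<in>lattice_box k R m. fibre_spline k U (real_of_int \<circ> z))"
      unfolding sum_lattice_box_Suc fun_upd_comp by (rule sum.cong[OF refl])
    with Suc show ?case by (simp only: Suc_leD)
  qed
  from this[of d] have "(\<Sum>z\<in>lattice_box d R m. cell (Suc d) U (real_of_int \<circ> z)) / vandermonde U =
      of_int m ^ d / fact d"
    by (simp add: fibre_spline_top[OF U] normalized_cell_def sum_divide_distrib)
  then show ?thesis
    using vandermonde_pos[OF U(1)] by (simp add: field_simps)
qed

subsection \<open>The moment cone of a finite set\<close>

text \<open>For \<open>k > 0\<close> the cone over \<open>C_{k-1}(T)\<close>, as truncated moment
  sequences of nonnegative measures on \<open>T\<close>. Coordinates from \<open>k\<close> on are
  free, so one \<open>z\<close> can be tested at every level.\<close>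

definition moment_cone :: "nat \<Rightarrow> int set \<Rightarrow> (nat \<Rightarrow> real) set" where
  "moment_cone k T =
    {z. \<exists>c. (\<forall>t\<in>T. 0 \<le> c t) \<and> (\<forall>i<k. z i = (\<Sum>t\<in>T. c t * of_int t ^ i))}"

lemma moment_cone_mono:
  assumes "z \<in> moment_cone k W" "W \<subseteq> T" "finite T"
  shows "z \<in> moment_cone k T"
proof -
  obtain c where c: "\<And>t. t \<in> W \<Longrightarrow> 0 \<le> c t" "\<And>i. i < k \<Longrightarrow> z i = (\<Sum>t\<in>W. c t * of_int t ^ i)"
    using assms(1) unfolding moment_cone_def by blast
  have "(\<Sum>t\<in>W. c t * of_int t ^ i) = (\<Sum>t\<in>T. (if t \<in> W then c t else 0) * of_int t ^ i)" for i
    by (rule sum.mono_neutral_cong_left) (use assms in auto)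
  then show ?thesis
    unfolding moment_cone_def using c by (intro CollectI exI[of _ "\<lambda>t. if t \<in> W then c t else 0"]) auto
qed

lemma moment_cone_le: "z \<in> moment_cone k T \<Longrightarrow> j \<le> k \<Longrightarrow> z \<in> moment_cone j T"
  unfolding moment_cone_def by fastforce

lemma moment_cone_cong:
  assumes "\<And>i. i < k \<Longrightarrow> z i = z' i"
  shows "z \<in> moment_cone k T \<longleftrightarrow> z' \<in> moment_cone k T"
  unfolding moment_cone_def using assms by auto

lemma moment_cone_convex:
  assumes "z \<in> moment_cone k T" "z' \<in> moment_cone k T" "0 \<le> a" "0 \<le> b"
  shows "(\<lambda>i. a * z i + b * z' i) \<in> moment_cone k T"
proof -
  obtain c where c: "\<And>t. t \<in> T \<Longrightarrow> 0 \<le> c t" "\<And>i. i < k \<Longrightarrow> z i = (\<Sum>t\<in>T. c t * of_int t ^ i)"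
    using assms(1) unfolding moment_cone_def by blast
  obtain c' where c': "\<And>t. t \<in> T \<Longrightarrow> 0 \<le> c' t" "\<And>i. i < k \<Longrightarrow> z' i = (\<Sum>t\<in>T. c' t * of_int t ^ i)"
    using assms(2) unfolding moment_cone_def by blast
  show ?thesis
    unfolding moment_cone_def
    by (intro CollectI exI[of _ "\<lambda>t. a * c t + b * c' t"])
      (use c c' assms in \<open>auto simp: sum.distrib sum_distrib_left algebra_simps\<close>)
qed

lemma functional_moment_cone_nonneg:
  assumes "z \<in> moment_cone k T" "degree p < k" "\<And>t. t \<in> T \<Longrightarrow> 0 \<le> poly p (of_int t)"
  shows "0 \<le> functional z p"
proof -
  obtain c where c: "\<And>t. t \<in> T \<Longrightarrow> 0 \<le> c t" "\<And>i. i < k \<Longrightarrow> z i = (\<Sum>t\<in>T. c t * of_int t ^ i)"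
    using assms(1) unfolding moment_cone_def by blast
  have "functional z p = (\<Sum>t\<in>T. c t * poly p (of_int t))"
    by (rule functional_moments) (use c assms in auto)
  then show ?thesis using c assms by (simp add: sum_nonneg)
qed

lemma functional_moment_cone_nonpos:
  assumes "z \<in> moment_cone k T" "degree p < k" "\<And>t. t \<in> T \<Longrightarrow> poly p (of_int t) \<le> 0"
  shows "functional z p \<le> 0"
  using functional_moment_cone_nonneg[of z k T "- p"] assms functional_smult[of z "- 1" p]
  by simp

text \<open>A measure on \<open>W\<close> integrates \<open>node_poly W\<close> to 0, which forces
  its next moment.\<close>

lemma moment_cone_node_extension:
  assumes "finite W" "card W = k" "z \<in> moment_cone k W"
  shows "z(k := - functional (z(k := 0)) (node_poly W)) \<in> moment_cone (Suc k) W"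
proof -
  obtain c where c: "\<And>t. t \<in> W \<Longrightarrow> 0 \<le> c t" "\<And>i. i < k \<Longrightarrow> z i = (\<Sum>t\<in>W. c t * of_int t ^ i)"
    using assms(3) unfolding moment_cone_def by blast
  define x where "x = (\<Sum>t\<in>W. c t * of_int t ^ k)"
  have "functional (z(k := x)) (node_poly W) = (\<Sum>t\<in>W. c t * poly (node_poly W) (of_int t))"
    using c assms by (intro functional_moments) (auto simp: x_def degree_node_poly)
  also have "\<dots> = 0"
    using assms by (intro sum.neutral) (simp add: node_poly_eq_0_iff)
  finally have "x = - functional (z(k := 0)) (node_poly W)"
    using functional_node_poly_update[OF assms(1,2), of z x] by simp
  then show ?thesis
    unfolding moment_cone_def using c
    by (intro CollectI exI[of _ c]) (auto simp: less_Suc_eq x_def)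
qed

text \<open>The measures on \<open>Wl\<close> and \<open>Wu\<close> extend \<open>z\<close> to a
  lower and an upper value of coordinate \<open>k\<close>; as \<open>z k\<close> lies between these,
  a convex combination of the two measures represents \<open>z\<close>.\<close>

lemma moment_cone_between:
  assumes l: "finite Wl" "card Wl = k" "z \<in> moment_cone k Wl" "0 \<le> functional z (node_poly Wl)"
    and u: "finite Wu" "card Wu = k" "z \<in> moment_cone k Wu" "functional z (node_poly Wu) \<le> 0"
    and T: "Wl \<subseteq> T" "Wu \<subseteq> T" "finite T"
  shows "z \<in> moment_cone (Suc k) T"
proof -
  define a where "a = - functional (z(k := 0)) (node_poly Wl)"
  define b where "b = - functional (z(k := 0)) (node_poly Wu)"
  have "a \<le> z k" "z k \<le> b"
    using functional_node_poly_update[OF l(1,2), of z "z k"] l(4)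
      functional_node_poly_update[OF u(1,2), of z "z k"] u(4) by (simp_all add: a_def b_def)
  then obtain s where s: "0 \<le> s" "s \<le> 1" "z k = s * a + (1 - s) * b"
  proof (cases "a = b")
    case True
    then show ?thesis using that[of 0] \<open>a \<le> z k\<close> \<open>z k \<le> b\<close> by simp
  next
    case False
    with \<open>a \<le> z k\<close> \<open>z k \<le> b\<close> have "b - a > 0" by linarith
    moreover define s where "s = (b - z k) / (b - a)"
    ultimately have "s * (b - a) = b - z k" "0 \<le> s" "s \<le> 1"
      using \<open>a \<le> z k\<close> \<open>z k \<le> b\<close> by auto
    then show ?thesis using that[of s] by (simp add: algebra_simps)
  qed
  have "z(k := a) \<in> moment_cone (Suc k) T"
    unfolding a_def using moment_cone_node_extension[OF l(1-3)] T moment_cone_mono by blast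
  moreover have "z(k := b) \<in> moment_cone (Suc k) T"
    unfolding b_def using moment_cone_node_extension[OF u(1-3)] T moment_cone_mono by blast
  ultimately have "(\<lambda>i. s * (z(k := a)) i + (1 - s) * (z(k := b)) i) \<in> moment_cone (Suc k) T"
    by (rule moment_cone_convex) (use s in simp_all)
  also have "?this \<longleftrightarrow> ?thesis"
    by (rule moment_cone_cong) (auto simp: s(3) algebra_simps)
  finally show ?thesis .
qed

subsection \<open>The cells of a triangulation are disjoint\<close>

lemma sum_zero_one:
  fixes f :: "'a \<Rightarrow> real"
  assumes "finite F" "\<And>x. x \<in> F \<Longrightarrow> f x \<in> {0, 1}" "sum f F = 1"
  obtains x where "x \<in> F" "f x = 1" "\<And>y. y \<in> F \<Longrightarrow> y \<noteq> x \<Longrightarrow> f y = 0"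
proof -
  obtain x where x: "x \<in> F" "f x \<noteq> 0"
    using assms(3) by (metis sum.neutral zero_neq_one)
  then have fx: "f x = 1" using assms(2) by fastforce
  have "sum f F = f x + sum f (F - {x})"
    using assms(1) x(1) by (rule sum.remove)
  then have "sum f (F - {x}) = 0" using assms(3) fx by simp
  then have "\<forall>y\<in>F - {x}. f y = 0"
    using assms by (subst (asm) sum_nonneg_eq_0_iff) fastforce+
  then show ?thesis using that x(1) fx by blast
qed

lemma sum_zero_one_mult:
  fixes f :: "'a \<Rightarrow> real"
  assumes "finite F" "\<And>x. x \<in> F \<Longrightarrow> f x \<in> {0, 1}" "sum f F = 1"
  obtains x where "x \<in> F" "f x = 1" "\<forall>g. (\<Sum>y\<in>F. f y * g y) = g x"
proof -
  obtain x where x: "x \<in> F" "f x = 1" "\<And>y. y \<in> F \<Longrightarrow> y \<noteq> x \<Longrightarrow> f y = 0"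
    using sum_zero_one[OF assms] by metis
  have "(\<Sum>y\<in>F. f y * g y) = (\<Sum>y\<in>{x}. f y * g y)" for g
    by (rule sum.mono_neutral_right) (use assms(1) x in auto)
  then show ?thesis using that x by simp
qed

lemma sum_zero_mult:
  fixes f :: "'a \<Rightarrow> real"
  assumes "finite F" "\<And>x. x \<in> F \<Longrightarrow> f x \<in> {0, 1}" "sum f F = 0"
  shows "(\<Sum>y\<in>F. f y * g y) = 0"
proof -
  have "\<forall>y\<in>F. f y = 0"
    using assms by (subst (asm) sum_nonneg_eq_0_iff) fastforce+
  then show ?thesis by simp
qed

lemma lower_faces_1:
  assumes "finite T" "T \<noteq> {}"
  shows "lower_faces 1 T = {{Min T}}"
proof (intro equalityI subsetI)
  fix W assume W: "W \<in> lower_faces 1 T"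
  then obtain w where w: "W = {w}" "w \<in> T" "\<forall>s\<in>T. w \<le> s"
    by (auto simp: lower_faces_def poly_node_poly card_1_singleton_iff)
  then show "W \<in> {{Min T}}" using assms by (metis Min_eqI singletonI)
qed (use assms in \<open>auto simp: lower_faces_def poly_node_poly\<close>)

lemma upper_faces_1:
  assumes "finite T" "T \<noteq> {}"
  shows "upper_faces 1 T = {{Max T}}"
proof (intro equalityI subsetI)
  fix W assume W: "W \<in> upper_faces 1 T"
  then obtain w where w: "W = {w}" "w \<in> T" "\<forall>s\<in>T. s \<le> w"
    by (auto simp: upper_faces_def poly_node_poly card_1_singleton_iff)
  then show "W \<in> {{Max T}}" using assms by (metis Max_eqI singletonI)
qed (use assms in \<open>auto simp: upper_faces_def poly_node_poly\<close>)

lemma lower_faces_self: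
  assumes "finite W" "card W = k"
  shows "lower_faces k W = {W}"
  using assms by (auto simp: lower_faces_def node_poly_eq_0_iff dest: card_subset_eq)
    (auto simp: node_poly_eq_0_iff[symmetric] simp del: node_poly_eq_0_iff)

lemma cell_1: "card W = 1 \<Longrightarrow> cell 1 W z = of_bool (z 0 > 0)"
  by (auto simp: card_1_singleton_iff boundary_sum_def functional_def)

text \<open>Both functionals have slope 1 in coordinate \<open>k\<close>, so their difference may be
  evaluated at the point over \<open>z\<close> on the facet of \<open>Wl\<close>, where the lower
  one vanishes and the upper one is nonpositive.\<close>

lemma upper_le_lower_functional:
  assumes T: "finite T" and l: "Wl \<in> lower_faces k T" "z \<in> moment_cone k Wl"
    and u: "Wu \<in> upper_faces k T"
  shows "functional z (node_poly Wu) \<le> functional z (node_poly Wl)"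
proof -
  have W: "Wl \<subseteq> T" "finite Wl" "finite Wu" "card Wl = k" "card Wu = k"
    using l u T finite_subset by (auto simp: lower_faces_def upper_faces_def)
  let ?z = "z(k := - functional (z(k := 0)) (node_poly Wl))"
  have "?z \<in> moment_cone (Suc k) Wl"
    using W l by (intro moment_cone_node_extension)
  then have "functional ?z (node_poly Wu) \<le> 0"
    using W u by (intro functional_moment_cone_nonpos[of _ "Suc k" Wl])
      (auto simp: degree_node_poly upper_faces_def)
  moreover have "functional ?z (node_poly Wl) = 0"
    using W by (subst functional_node_poly_update) auto
  moreover have "functional z (node_poly W) = functional ?z (node_poly W) + (z k - ?z k)"
    if "finite W" "card W = k" for W
    using functional_node_poly_update[OF that, of z "z k"]
      functional_node_poly_update[OF that, of z "?z k"] by simp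
  ultimately show ?thesis using W by simp
qed

text \<open>
  The induction step rests on the boundary formula: both triangulations of \<open>C_{k+1}(T)\<close> have the
  boundary consisting of the lower facets minus the upper facets, so over each point of the
  projection exactly the points between the two are covered, and they are covered once.
\<close>

lemma cell_zero_one_aux:
  "(\<forall>W z. finite W \<and> card W = Suc k \<longrightarrow>
      cell (Suc k) W z \<in> {0, 1} \<and> (cell (Suc k) W z = 1 \<longrightarrow> z \<in> moment_cone (Suc k) W)) \<and>
    (\<forall>T z. finite T \<and> Suc k \<le> card T \<longrightarrow>
      (\<Sum>W\<in>lower_faces (Suc k) T. cell (Suc k) W z) = (\<Sum>W\<in>upper_faces (Suc k) T. cell (Suc k) W z) \<and>
      (\<Sum>W\<in>lower_faces (Suc k) T. cell (Suc k) W z) \<in> {0, 1})"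
  (is "?A k \<and> ?B k")
proof (induction k)
  let ?L = "\<lambda>k T z. \<Sum>W\<in>lower_faces (Suc k) T. cell (Suc k) W z"
  let ?U = "\<lambda>k T z. \<Sum>W\<in>upper_faces (Suc k) T. cell (Suc k) W z"
  case 0
  have "z \<in> moment_cone 1 W" if "card W = 1" "z 0 > 0" for z W
    unfolding moment_cone_def using that
    by (intro CollectI exI[of _ "\<lambda>_. z 0"]) (auto simp: card_1_singleton_iff)
  then have "?A 0" using cell_1 by auto
  moreover have "?B 0"
  proof (intro allI impI)
    fix T :: "int set" and z :: "nat \<Rightarrow> real"
    assume T: "finite T \<and> Suc 0 \<le> card T"
    then have "T \<noteq> {}" by auto
    then show "?L 0 T z = ?U 0 T z \<and> ?L 0 T z \<in> {0, 1}"
      using T lower_faces_1[of T] upper_faces_1[of T] cell_1[of "{Min T}" z] cell_1[of "{Max T}" z]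
      by simp
  qed
  ultimately show ?case by blast
next
  case (Suc k)
  let ?L = "\<lambda>k T z. \<Sum>W\<in>lower_faces (Suc k) T. cell (Suc k) W z"
  let ?U = "\<lambda>k T z. \<Sum>W\<in>upper_faces (Suc k) T. cell (Suc k) W z"
  from Suc have A: "\<And>W z. finite W \<Longrightarrow> card W = Suc k \<Longrightarrow> cell (Suc k) W z \<in> {0, 1}"
    "\<And>W z. finite W \<Longrightarrow> card W = Suc k \<Longrightarrow> cell (Suc k) W z = 1 \<Longrightarrow> z \<in> moment_cone (Suc k) W"
    and B: "\<And>T z. finite T \<Longrightarrow> Suc k \<le> card T \<Longrightarrow>
      ?L k T z = ?U k T z"
    "\<And>T z. finite T \<Longrightarrow> Suc k \<le> card T \<Longrightarrow>
      ?L k T z \<in> {0, 1}"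
    by blast+
  \<comment> \<open>Cone membership is included because a simplex is its own only lower face: the
    case \<open>T = W\<close> then gives the claim on single cells.\<close>
  have step: "?L (Suc k) T z = ?U (Suc k) T z \<and> ?L (Suc k) T z \<in> {0, 1} \<and>
    (?L (Suc k) T z = 1 \<longrightarrow> z \<in> moment_cone (Suc (Suc k)) T)"
    if T: "finite T" "Suc k \<le> card T" for T z
  proof -
    define g where "g = (\<lambda>W. of_bool (functional z (node_poly W) > 0) :: real)"
    have lower: "finite W \<and> card W = Suc k \<and> W \<subseteq> T" if "W \<in> lower_faces (Suc k) T" for W
      using that T finite_subset by (auto simp: lower_faces_def)
    have upper: "finite W \<and> card W = Suc k \<and> W \<subseteq> T" if "W \<in> upper_faces (Suc k) T" for W
      using that T finite_subset by (auto simp: upper_faces_def)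
    have sums: "?L (Suc k) T z =
        (\<Sum>W\<in>lower_faces (Suc k) T. cell (Suc k) W z * g W) -
        (\<Sum>W\<in>upper_faces (Suc k) T. cell (Suc k) W z * g W)"
      "?U (Suc k) T z =
        (\<Sum>W\<in>lower_faces (Suc k) T. cell (Suc k) W z * g W) -
        (\<Sum>W\<in>upper_faces (Suc k) T. cell (Suc k) W z * g W)"
      unfolding g_def cell.simps(2)[where k = "Suc k"]
      using sum_boundary_faces[OF T(1)] by blast+
    consider "?L k T z = 0" | "?L k T z = 1"
      using B(2)[OF T] by blast
    then show ?thesis
    proof cases
      case 1
      then have zero: "?U k T z = 0"
        using B(1)[OF T] by simp
      have "(\<Sum>W\<in>lower_faces (Suc k) T. cell (Suc k) W z * g W) = 0"
        by (rule sum_zero_mult[OF finite_lower_faces[OF T(1)] _ 1]) (use A(1) lower in blast)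
      moreover have "(\<Sum>W\<in>upper_faces (Suc k) T. cell (Suc k) W z * g W) = 0"
        by (rule sum_zero_mult[OF finite_upper_faces[OF T(1)] _ zero]) (use A(1) upper in blast)
      ultimately show ?thesis unfolding sums by simp
    next
      case 2
      obtain Wl where Wl: "Wl \<in> lower_faces (Suc k) T" "cell (Suc k) Wl z = 1"
        "\<forall>g. (\<Sum>W\<in>lower_faces (Suc k) T. cell (Suc k) W z * g W) = g Wl"
      proof (rule sum_zero_one_mult[OF finite_lower_faces[OF T(1)] _ 2])
        show "cell (Suc k) W z \<in> {0, 1}" if "W \<in> lower_faces (Suc k) T" for W
          using A(1) lower[OF that] by blast
      qed blast
      have 3: "?U k T z = 1" using 2 B(1)[OF T] by simp
      obtain Wu where Wu: "Wu \<in> upper_faces (Suc k) T" "cell (Suc k) Wu z = 1"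
        "\<forall>g. (\<Sum>W\<in>upper_faces (Suc k) T. cell (Suc k) W z * g W) = g Wu"
      proof (rule sum_zero_one_mult[OF finite_upper_faces[OF T(1)] _ 3])
        show "cell (Suc k) W z \<in> {0, 1}" if "W \<in> upper_faces (Suc k) T" for W
          using A(1) upper[OF that] by blast
      qed blast
      have cone: "z \<in> moment_cone (Suc k) Wl" "z \<in> moment_cone (Suc k) Wu"
        using A(2) Wl Wu lower upper by auto
      have le: "functional z (node_poly Wu) \<le> functional z (node_poly Wl)"
        using upper_le_lower_functional[OF T(1) Wl(1) cone(1) Wu(1)] .
      have "z \<in> moment_cone (Suc (Suc k)) T"
        if "0 < functional z (node_poly Wl)" "functional z (node_poly Wu) \<le> 0"
        using lower[OF Wl(1)] upper[OF Wu(1)] cone that T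
        by (intro moment_cone_between[of Wl "Suc k" z Wu T]) auto
      then show ?thesis
        unfolding sums Wl(3)[rule_format] Wu(3)[rule_format] using le by (auto simp: g_def)
    qed
  qed
  have "?A (Suc k)"
  proof (intro allI impI)
    fix W :: "int set" and z :: "nat \<Rightarrow> real"
    assume W: "finite W \<and> card W = Suc (Suc k)"
    show "cell (Suc (Suc k)) W z \<in> {0, 1} \<and>
      (cell (Suc (Suc k)) W z = 1 \<longrightarrow> z \<in> moment_cone (Suc (Suc k)) W)"
      using step[of W z, THEN conjunct2] W lower_faces_self[of W "Suc (Suc k)"]
      by (simp del: cell.simps)
  qed
  moreover have "?B (Suc k)"
  proof (intro allI impI)
    fix T :: "int set" and z :: "nat \<Rightarrow> real"
    assume T: "finite T \<and> Suc (Suc k) \<le> card T"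
    then have "finite T" "Suc k \<le> card T" by auto
    from step[OF this, of z] show "?L (Suc k) T z = ?U (Suc k) T z \<and> ?L (Suc k) T z \<in> {0, 1}"
      by blast
  qed
  ultimately show ?case by blast
qed

lemma cell_zero_one:
  assumes "finite W" "card W = Suc k"
  shows "cell (Suc k) W z \<in> {0, 1}"
  using cell_zero_one_aux[of k] assms by blast

lemma cell_moment_cone:
  assumes "finite W" "card W = Suc k" "cell (Suc k) W z \<noteq> 0"
  shows "z \<in> moment_cone (Suc k) W"
  using cell_zero_one_aux[of k] assms by blast

lemma sum_cell_lower_upper:
  assumes "finite T" "Suc k \<le> card T"
  shows "(\<Sum>W\<in>lower_faces (Suc k) T. cell (Suc k) W z) = (\<Sum>W\<in>upper_faces (Suc k) T. cell (Suc k) W z)"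
  using cell_zero_one_aux[of k] assms by blast

lemma sum_cell_zero_one:
  assumes "finite T" "Suc k \<le> card T"
  shows "(\<Sum>W\<in>lower_faces (Suc k) T. cell (Suc k) W z) \<in> {0, 1}"
  using cell_zero_one_aux[of k] assms by blast

subsection \<open>Counting lattice points\<close>

lemma cell_update:
  assumes "finite W" "card W = k"
  shows "cell k W (z(k := x)) = cell k W z"
  using assms by (intro cell_cong) auto

lemma functional_node_poly_update_iff:
  assumes "finite W" "card W = k"
  shows "0 < functional (z(k := x)) (node_poly W) \<longleftrightarrow> - functional (z(k := 0)) (node_poly W) < x"
    and "0 \<le> functional (z(k := x)) (node_poly W) \<longleftrightarrow> - functional (z(k := 0)) (node_poly W) \<le> x"
    and "functional (z(k := x)) (node_poly W) \<le> 0 \<longleftrightarrow> x \<le> - functional (z(k := 0)) (node_poly W)"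
  using functional_node_poly_update[OF assms, of z x] by auto

lemma faces_finite_card:
  assumes "finite T"
  shows "W \<in> lower_faces k T \<Longrightarrow> W \<subseteq> T \<and> finite W \<and> card W = k"
    and "W \<in> upper_faces k T \<Longrightarrow> W \<subseteq> T \<and> finite W \<and> card W = k"
  using assms finite_subset by (auto simp: lower_faces_def upper_faces_def)

lemma sum_cell_update:
  assumes "finite T"
  shows "(\<Sum>W\<in>lower_faces (Suc (Suc k)) T. cell (Suc (Suc k)) W (z(Suc k := x))) =
    (\<Sum>W\<in>lower_faces (Suc k) T. cell (Suc k) W z * of_bool (0 < functional (z(Suc k := x)) (node_poly W))) -
    (\<Sum>W\<in>upper_faces (Suc k) T. cell (Suc k) W z * of_bool (0 < functional (z(Suc k := x)) (node_poly W)))"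
proof -
  have cell: "cell (Suc k) W (z(Suc k := x)) = cell (Suc k) W z"
    if "W \<in> lower_faces (Suc k) T \<union> upper_faces (Suc k) T" for W
    using that faces_finite_card[OF assms] by (intro cell_update) blast+
  show ?thesis
    unfolding cell.simps(2)[where k = "Suc k"] sum_boundary_faces[OF assms, THEN conjunct1]
    by (intro arg_cong2[of _ _ _ _ "(-)"] sum.cong refl arg_cong2[of _ _ _ _ "(*)"] cell) blast+
qed

text \<open>Exactly one lower cell and one upper cell lie below \<open>z\<close> in the projection,
  so the next level consists of the points strictly above the facet of \<open>Wl\<close> but not
  strictly above that of \<open>Wu\<close>.\<close>

lemma sum_cell_Suc:
  assumes T: "finite T" "Suc k \<le> card T"
    and one: "(\<Sum>W\<in>lower_faces (Suc k) T. cell (Suc k) W z) = 1"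
  obtains Wl Wu where "Wl \<in> lower_faces (Suc k) T" "Wu \<in> upper_faces (Suc k) T"
    "z \<in> moment_cone (Suc k) Wl" "z \<in> moment_cone (Suc k) Wu"
    "\<forall>x. (\<Sum>W\<in>lower_faces (Suc (Suc k)) T. cell (Suc (Suc k)) W (z(Suc k := x))) =
      of_bool (0 < functional (z(Suc k := x)) (node_poly Wl)) -
      of_bool (0 < functional (z(Suc k := x)) (node_poly Wu))"
proof -
  note faces = faces_finite_card[OF T(1), of _ "Suc k"]
  obtain Wl where Wl: "Wl \<in> lower_faces (Suc k) T" "cell (Suc k) Wl z = 1"
    "\<forall>g. (\<Sum>W\<in>lower_faces (Suc k) T. cell (Suc k) W z * g W) = g Wl"
  proof (rule sum_zero_one_mult[OF finite_lower_faces[OF T(1)] _ one])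
    show "cell (Suc k) W z \<in> {0, 1}" if "W \<in> lower_faces (Suc k) T" for W
      using cell_zero_one faces(1)[OF that] by blast
  qed blast
  have one': "(\<Sum>W\<in>upper_faces (Suc k) T. cell (Suc k) W z) = 1"
    using one sum_cell_lower_upper[OF T, of z] by simp
  obtain Wu where Wu: "Wu \<in> upper_faces (Suc k) T" "cell (Suc k) Wu z = 1"
    "\<forall>g. (\<Sum>W\<in>upper_faces (Suc k) T. cell (Suc k) W z * g W) = g Wu"
  proof (rule sum_zero_one_mult[OF finite_upper_faces[OF T(1)] _ one'])
    show "cell (Suc k) W z \<in> {0, 1}" if "W \<in> upper_faces (Suc k) T" for W
      using cell_zero_one faces(2)[OF that] by blast
  qed blast
  have cone: "z \<in> moment_cone (Suc k) Wl" "z \<in> moment_cone (Suc k) Wu"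
    using cell_moment_cone Wl(1,2) Wu(1,2) faces by (metis zero_neq_one)+
  show ?thesis
  proof (rule that[OF Wl(1) Wu(1) cone], rule allI)
    fix x
    show "(\<Sum>W\<in>lower_faces (Suc (Suc k)) T. cell (Suc (Suc k)) W (z(Suc k := x))) =
      of_bool (0 < functional (z(Suc k := x)) (node_poly Wl)) -
      of_bool (0 < functional (z(Suc k := x)) (node_poly Wu))"
      unfolding sum_cell_update[OF T(1)] Wl(3)[rule_format] Wu(3)[rule_format] ..
  qed
qed

lemma sum_cell_Suc_zero:
  assumes T: "finite T" "Suc k \<le> card T"
    and zero: "(\<Sum>W\<in>lower_faces (Suc k) T. cell (Suc k) W z) = 0"
  shows "(\<Sum>W\<in>lower_faces (Suc (Suc k)) T. cell (Suc (Suc k)) W (z(Suc k := x))) = 0"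
proof -
  note faces = faces_finite_card[OF T(1), of _ "Suc k"]
  have "(\<Sum>W\<in>upper_faces (Suc k) T. cell (Suc k) W z) = 0"
    using zero sum_cell_lower_upper[OF T, of z] by simp
  then have "(\<Sum>W\<in>upper_faces (Suc k) T. cell (Suc k) W z * g W) = 0" for g
    using faces(2) cell_zero_one T(1) by (intro sum_zero_mult) (simp, blast, simp)
  moreover have "(\<Sum>W\<in>lower_faces (Suc k) T. cell (Suc k) W z * g W) = 0" for g
    using zero faces(1) cell_zero_one T(1) by (intro sum_zero_mult) (simp, blast, simp)
  ultimately show ?thesis
    unfolding sum_cell_update[OF T(1)] by simp
qed

lemma functional_Ints_general:
  assumes "\<And>i. coeff p i \<in> \<int>" "\<And>i. i \<le> degree p \<Longrightarrow> z i \<in> \<int>"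
  shows "functional z p \<in> \<int>"
  unfolding functional_def using assms by (intro Ints_sum Ints_mult) auto

text \<open>A point on the lower boundary of some projection lies on a face which the next moments
  cannot leave, so its fibre is a single lattice point.\<close>

lemma fibre_degenerate:
  assumes T: "finite T" "Suc k \<le> card T"
    and z: "z \<in> moment_cone (Suc k) T" "0 < z 0" "\<And>i. i \<le> k \<Longrightarrow> z i \<in> \<int>"
    and zero: "(\<Sum>W\<in>lower_faces (Suc k) T. cell (Suc k) W z) = 0"
  obtains a :: int where "{x::int. z(Suc k := of_int x) \<in> moment_cone (Suc (Suc k)) T} = {a}"
proof -
  define S where "S = (\<lambda>i. \<Sum>W\<in>lower_faces (Suc i) T. cell (Suc i) W z)"
  have "S 0 = 1"
  proof -
    have "T \<noteq> {}" using T by auto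
    then show ?thesis
      using lower_faces_1[of T] cell_1[of "{Min T}" z] T z(2) by (simp add: S_def)
  qed
  moreover have "S k = 0" using zero by (simp add: S_def)
  \<comment> \<open>A level above which \<open>z\<close> drops out of the cells; there
    \<open>z\<close> must lie on the facet of the lower face \<open>Wl\<close>.\<close>
  ultimately obtain n where n: "n < k" "S n \<noteq> 0" "S (Suc n) = 0"
  proof -
    define n where "n = (LEAST i. S i = 0)"
    have "S n = 0" "n \<le> k"
      using \<open>S k = 0\<close> by (auto simp: n_def intro: LeastI Least_le)
    moreover have "n \<noteq> 0" using \<open>S n = 0\<close> \<open>S 0 = 1\<close> by (intro notI) simp
    moreover have "S (n - 1) \<noteq> 0"
      using not_less_Least[of "n - 1" "\<lambda>i. S i = 0"] \<open>n \<noteq> 0\<close> by (simp add: n_def)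
    ultimately show ?thesis using that[of "n - 1"] by auto
  qed
  have T': "Suc n \<le> card T" using T n by simp
  have "S n = 1" using sum_cell_zero_one[OF T(1) T', of z] n(2) by (simp add: S_def)
  then obtain Wl Wu where W: "Wl \<in> lower_faces (Suc n) T" "Wu \<in> upper_faces (Suc n) T"
    "\<forall>x. (\<Sum>W\<in>lower_faces (Suc (Suc n)) T. cell (Suc (Suc n)) W (z(Suc n := x))) =
      of_bool (0 < functional (z(Suc n := x)) (node_poly Wl)) -
      of_bool (0 < functional (z(Suc n := x)) (node_poly Wu))"
    unfolding S_def by (rule sum_cell_Suc[OF T(1) T']) blast
  have Wl: "Wl \<subseteq> T" "finite Wl" "card Wl = Suc n" and Wu: "finite Wu" "card Wu = Suc n"
    using faces_finite_card[OF T(1)] W by blast+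
  obtain c where c: "\<And>t. t \<in> T \<Longrightarrow> 0 \<le> c t" "\<And>i. i < Suc k \<Longrightarrow> z i = (\<Sum>t\<in>T. c t * of_int t ^ i)"
    using z(1) unfolding moment_cone_def by blast
  have "functional z (node_poly Wu) \<le> 0"
    by (rule functional_moment_cone_nonpos[OF z(1)])
      (use W(2) Wu n in \<open>auto simp: degree_node_poly upper_faces_def\<close>)
  moreover have "S (Suc n) = of_bool (0 < functional z (node_poly Wl)) - of_bool (0 < functional z (node_poly Wu))"
    using W(3)[rule_format, of "z (Suc n)"] by (simp add: S_def del: cell.simps)
  ultimately have "functional z (node_poly Wl) \<le> 0"
    using n(3) by (auto simp: not_less split: if_splits)
  \<comment> \<open>Monic of degree \<open>Suc k\<close> with integer coefficients, and zero
    wherever \<open>node_poly Wl\<close> is. It pins down coordinate \<open>Suc k\<close> of every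
    point of the cone over \<open>z\<close> and shows that this coordinate is integral.\<close>
  define p where "p = monom 1 (k - n) * node_poly Wl"
  have p: "lead_coeff p = 1" "degree p = Suc k" "coeff p i \<in> \<int>" for i
  proof -
    show "lead_coeff p = 1" by (simp only: p_def lead_coeff_mult lead_coeff_monom lead_coeff_node_poly mult_1)
    show "degree p = Suc k"
      using n Wl by (simp add: p_def degree_mult_eq degree_monom_eq degree_node_poly)
    show "coeff p i \<in> \<int>"
      using Wl by (simp add: p_def coeff_monom_mult coeff_node_poly_Ints)
  qed
  have zero_at: "functional (z(Suc k := x)) p = 0"
    if x: "\<And>t. t \<in> T \<Longrightarrow> 0 \<le> c t" "\<And>i. i < Suc (Suc k) \<Longrightarrow> (z(Suc k := x)) i = (\<Sum>t\<in>T. c t * of_int t ^ i)" for c x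
  proof -
    \<comment> \<open>These terms are nonnegative and sum to at most 0, so any representing measure
      lives on the zeros of \<open>node_poly Wl\<close>.\<close>
    have pos: "0 \<le> c t * poly (node_poly Wl) (of_int t)" if "t \<in> T" for t
      using W(1) x(1) that by (auto simp: lower_faces_def)
    have "functional z (node_poly Wl) = (\<Sum>t\<in>T. c t * poly (node_poly Wl) (of_int t))"
    proof (rule functional_moments)
      fix i assume "i \<le> degree (node_poly Wl)"
      then have "i < Suc k" using Wl n by (simp add: degree_node_poly)
      then show "z i = (\<Sum>t\<in>T. c t * real_of_int t ^ i)" using x(2)[of i] by simp
    qed
    then have "(\<Sum>t\<in>T. c t * poly (node_poly Wl) (of_int t)) = 0"
      using \<open>functional z (node_poly Wl) \<le> 0\<close> pos by (simp add: antisym sum_nonneg)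
    then have "\<forall>t\<in>T. c t * poly (node_poly Wl) (of_int t) = 0"
      using T(1) pos by (subst (asm) sum_nonneg_eq_0_iff) auto
    moreover have "functional (z(Suc k := x)) p = (\<Sum>t\<in>T. c t * poly p (of_int t))"
      by (rule functional_moments) (use x(2) p(2) in auto)
    ultimately show ?thesis
      by (auto simp: p_def intro!: sum.neutral)
  qed
  have "functional (z(Suc k := 0)) p \<in> \<int>"
    using z(3) p by (intro functional_Ints_general) (auto simp: le_Suc_eq)
  then obtain a' where "functional (z(Suc k := 0)) p = of_int a'"
    by (elim Ints_cases)
  moreover define a where "a = - a'"
  ultimately have a: "functional (z(Suc k := 0)) p = of_int (- a)" by simp
  have upd: "functional (z(Suc k := x)) p = x - of_int a" for x
    using functional_update_degree[OF p(1,2), of z x] a by simp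
  have uniq: "x = of_int a" if "z(Suc k := x) \<in> moment_cone (Suc (Suc k)) T" for x
  proof -
    obtain c' where c': "\<And>t. t \<in> T \<Longrightarrow> 0 \<le> c' t"
      "\<And>i. i < Suc (Suc k) \<Longrightarrow> (z(Suc k := x)) i = (\<Sum>t\<in>T. c' t * of_int t ^ i)"
      using \<open>z(Suc k := x) \<in> _\<close> unfolding moment_cone_def by blast
    show ?thesis using zero_at[OF c'] upd[of x] by simp
  qed
  have "z(Suc k := (\<Sum>t\<in>T. c t * of_int t ^ Suc k)) \<in> moment_cone (Suc (Suc k)) T"
    unfolding moment_cone_def using c by (intro CollectI exI[of _ c]) (auto simp: less_Suc_eq)
  with uniq[OF this] have "z(Suc k := of_int a) \<in> moment_cone (Suc (Suc k)) T" by simp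
  moreover have "x = a" if "z(Suc k := of_int x) \<in> moment_cone (Suc (Suc k)) T" for x :: int
    using uniq[OF that] by simp
  ultimately show ?thesis by (intro that[of a]) blast
qed

text \<open>The closed fibre is \<open>{a..b}\<close> while the cells cover only
  \<open>a < x \<le> b\<close>, so the closed fibre has exactly one lattice point more. The ends are
  integers because node polynomials have integer coefficients.\<close>

lemma fibre_interval:
  assumes T: "finite T" "Suc k \<le> card T" and z: "\<And>i. i \<le> k \<Longrightarrow> z i \<in> \<int>"
    and one: "(\<Sum>W\<in>lower_faces (Suc k) T. cell (Suc k) W z) = 1"
  obtains a b :: int where "a \<le> b"
    "{x::int. z(Suc k := of_int x) \<in> moment_cone (Suc (Suc k)) T} = {a..b}"
    "\<And>x::int. (\<Sum>W\<in>lower_faces (Suc (Suc k)) T. cell (Suc (Suc k)) W (z(Suc k := of_int x))) =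
      of_bool (a < x) - of_bool (b < x)"
proof -
  obtain Wl Wu where W: "Wl \<in> lower_faces (Suc k) T" "Wu \<in> upper_faces (Suc k) T"
    "z \<in> moment_cone (Suc k) Wl" "z \<in> moment_cone (Suc k) Wu"
    "\<forall>x. (\<Sum>W\<in>lower_faces (Suc (Suc k)) T. cell (Suc (Suc k)) W (z(Suc k := x))) =
      of_bool (0 < functional (z(Suc k := x)) (node_poly Wl)) -
      of_bool (0 < functional (z(Suc k := x)) (node_poly Wu))"
    by (rule sum_cell_Suc[OF T one])
  have Wl: "Wl \<subseteq> T" "finite Wl" "card Wl = Suc k"
    and Wu: "Wu \<subseteq> T" "finite Wu" "card Wu = Suc k"
    using faces_finite_card[OF T(1)] W by blast+
  have int: "functional (z(Suc k := 0)) (node_poly W) \<in> \<int>" if "finite W" "card W = Suc k" for W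
    using that z by (intro functional_Ints) (auto simp: le_Suc_eq)
  obtain a where a: "- functional (z(Suc k := 0)) (node_poly Wl) = of_int a"
    using Ints_minus[OF int[OF Wl(2,3)]] by (elim Ints_cases)
  obtain b where b: "- functional (z(Suc k := 0)) (node_poly Wu) = of_int b"
    using Ints_minus[OF int[OF Wu(2,3)]] by (elim Ints_cases)
  note upd = functional_node_poly_update_iff[OF Wl(2,3)] functional_node_poly_update_iff[OF Wu(2,3)]
  have cone: "z(Suc k := x) \<in> moment_cone (Suc k) V \<longleftrightarrow> z \<in> moment_cone (Suc k) V" for x V
    by (rule moment_cone_cong) auto
  have "functional z (node_poly Wu) \<le> functional z (node_poly Wl)"
    using upper_le_lower_functional[OF T(1) W(1,3,2)] .
  then have le: "a \<le> b"
    using functional_node_poly_update[OF Wl(2,3), of z "z (Suc k)"] a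
      functional_node_poly_update[OF Wu(2,3), of z "z (Suc k)"] b by simp
  have mem: "z(Suc k := of_int x) \<in> moment_cone (Suc (Suc k)) T \<longleftrightarrow> a \<le> x \<and> x \<le> b" for x
  proof
    assume x: "z(Suc k := of_int x) \<in> moment_cone (Suc (Suc k)) T"
    have "0 \<le> functional (z(Suc k := of_int x)) (node_poly Wl)"
      by (rule functional_moment_cone_nonneg[OF x])
        (use W(1) Wl in \<open>auto simp: degree_node_poly lower_faces_def\<close>)
    moreover have "functional (z(Suc k := of_int x)) (node_poly Wu) \<le> 0"
      by (rule functional_moment_cone_nonpos[OF x])
        (use W(2) Wu in \<open>auto simp: degree_node_poly upper_faces_def\<close>)
    ultimately show "a \<le> x \<and> x \<le> b" unfolding upd a b by simp
  next
    assume "a \<le> x \<and> x \<le> b"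
    then have "0 \<le> functional (z(Suc k := of_int x)) (node_poly Wl)"
      "functional (z(Suc k := of_int x)) (node_poly Wu) \<le> 0"
      unfolding upd a b by simp_all
    then show "z(Suc k := of_int x) \<in> moment_cone (Suc (Suc k)) T"
      using W(3,4) Wl Wu T(1) cone by (intro moment_cone_between[of Wl "Suc k" _ Wu T]) simp_all
  qed
  have sums: "(\<Sum>W\<in>lower_faces (Suc (Suc k)) T. cell (Suc (Suc k)) W (z(Suc k := of_int x))) =
      of_bool (a < x) - of_bool (b < x)" for x :: int
    unfolding W(5)[rule_format] upd a b by simp
  have "{x::int. z(Suc k := of_int x) \<in> moment_cone (Suc (Suc k)) T} = {a..b}"
    unfolding mem by auto
  with le sums show ?thesis by (intro that)
qed

section \<open>Recursion in the dimension for the number of lattice points\<close>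

lemma moment_cone_bound:
  assumes "z \<in> moment_cone k T" "i < k" "\<And>t. t \<in> T \<Longrightarrow> \<bar>real_of_int t\<bar> \<le> B"
  shows "\<bar>z i\<bar> \<le> z 0 * B ^ i"
proof -
  obtain c where c: "\<And>t. t \<in> T \<Longrightarrow> 0 \<le> c t" "\<And>i. i < k \<Longrightarrow> z i = (\<Sum>t\<in>T. c t * of_int t ^ i)"
    using assms(1) unfolding moment_cone_def by blast
  have "\<bar>z i\<bar> \<le> (\<Sum>t\<in>T. \<bar>c t * of_int t ^ i\<bar>)"
    using c(2)[OF assms(2)] by simp
  also have "\<dots> \<le> (\<Sum>t\<in>T. c t * B ^ i)"
    using c(1) assms(3) by (intro sum_mono) (auto simp: abs_mult power_abs intro!: mult_mono power_mono)
  also have "\<dots> = z 0 * B ^ i"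
    using c(2)[of 0] assms(2) by (simp add: sum_distrib_right)
  finally show ?thesis .
qed

definition lattice_points :: "nat \<Rightarrow> int set \<Rightarrow> int \<Rightarrow> (nat \<Rightarrow> int) set" where
  "lattice_points d T m =
    {z. z 0 = m \<and> (\<forall>i>d. z i = 0) \<and> real_of_int \<circ> z \<in> moment_cone (Suc d) T}"

lemma lattice_boxD:
  "z \<in> lattice_box d R m \<Longrightarrow> 1 \<le> i \<Longrightarrow> i \<le> d \<Longrightarrow> z i \<in> {-R..R}"
  by (auto simp: lattice_box_def)

lemma lattice_points_subset_box:
  assumes "0 \<le> m" "1 \<le> B" "\<And>t. t \<in> T \<Longrightarrow> \<bar>t\<bar> \<le> B" "m * B ^ d \<le> R"
  shows "lattice_points d T m \<subseteq> lattice_box d R m"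
proof
  fix z assume z: "z \<in> lattice_points d T m"
  have "z i \<in> {-R..R}" if "i \<le> d" for i
  proof -
    have cone: "real_of_int \<circ> z \<in> moment_cone (Suc d) T"
      using z by (simp only: lattice_points_def mem_Collect_eq)
    have "\<bar>(real_of_int \<circ> z) i\<bar> \<le> (real_of_int \<circ> z) 0 * of_int B ^ i"
      by (rule moment_cone_bound[OF cone]) (use assms(3) that in \<open>auto simp flip: of_int_abs\<close>)
    then have "real_of_int \<bar>z i\<bar> \<le> of_int (m * B ^ i)"
      using z by (simp add: lattice_points_def)
    then have "\<bar>z i\<bar> \<le> m * B ^ i" by (simp only: of_int_le_iff)
    also have "\<dots> \<le> m * B ^ d"
      using assms that by (intro mult_left_mono power_increasing) auto
    finally show ?thesis using assms(4) by auto
  qed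
  then show "z \<in> lattice_box d R m"
    using z by (auto simp: lattice_points_def lattice_box_def)
qed

lemma lattice_points_update_iff:
  assumes "z \<in> lattice_box k R m"
  shows "z(Suc k := x) \<in> lattice_points (Suc k) T m \<longleftrightarrow>
    (real_of_int \<circ> z)(Suc k := of_int x) \<in> moment_cone (Suc (Suc k)) T"
  using assms by (auto simp: lattice_points_def lattice_box_def fun_upd_comp)

text \<open>Over each lattice point of the base, the fibre has one point more than the cells cover;
  this includes degenerate fibres, with one point and no cell. No cells lie outside the
  base.\<close>

lemma card_lattice_points_Suc:
  assumes T: "finite T" "Suc (Suc k) \<le> card T" and m: "0 < m"
    and R: "lattice_points k T m \<subseteq> lattice_box k R m"
      "lattice_points (Suc k) T m \<subseteq> lattice_box (Suc k) R m"
  shows "real (card (lattice_points (Suc k) T m)) = real (card (lattice_points k T m)) +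
    (\<Sum>z\<in>lattice_box (Suc k) R m. \<Sum>W\<in>lower_faces (Suc (Suc k)) T. cell (Suc (Suc k)) W (real_of_int \<circ> z))"
proof -
  define S where "S = (\<lambda>z (x::int). \<Sum>W\<in>lower_faces (Suc (Suc k)) T.
    cell (Suc (Suc k)) W ((real_of_int \<circ> z)(Suc k := of_int x)))"
  define fib where "fib = (\<lambda>z. {x::int. (real_of_int \<circ> z)(Suc k := of_int x) \<in> moment_cone (Suc (Suc k)) T})"
  have T': "Suc k \<le> card T" using T by simp
  have fib: "fib z \<subseteq> {-R..R}" if "z \<in> lattice_points k T m" for z
  proof
    fix x assume "x \<in> fib z"
    then have "z(Suc k := x) \<in> lattice_box (Suc k) R m"
      using that R lattice_points_update_iff[of z k R m x T] by (auto simp: fib_def)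
    from lattice_boxD[OF this, of "Suc k"] show "x \<in> {-R..R}" by simp
  qed
  have inside: "real (card (fib z)) = 1 + (\<Sum>x\<in>{-R..R}. S z x)"
    if z: "z \<in> lattice_points k T m" for z
  proof -
    have z': "real_of_int \<circ> z \<in> moment_cone (Suc k) T" "(real_of_int \<circ> z) 0 > 0"
      "(real_of_int \<circ> z) i \<in> \<int>" for i
      using z m by (auto simp: lattice_points_def)
    consider "(\<Sum>W\<in>lower_faces (Suc k) T. cell (Suc k) W (real_of_int \<circ> z)) = 0"
      | "(\<Sum>W\<in>lower_faces (Suc k) T. cell (Suc k) W (real_of_int \<circ> z)) = 1"
      using sum_cell_zero_one[OF T(1) T'] by blast
    then show ?thesis
    proof cases
      case 1
      obtain a where "fib z = {a}"
        unfolding fib_def using fibre_degenerate[OF T(1) T' z' 1] by blast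
      moreover have "S z x = 0" for x
        unfolding S_def by (rule sum_cell_Suc_zero[OF T(1) T' 1])
      ultimately show ?thesis by simp
    next
      case 2
      obtain a b where ab: "a \<le> b" "fib z = {a..b}"
        "\<And>x::int. S z x = of_bool (a < x) - of_bool (b < x)"
        unfolding fib_def S_def using fibre_interval[OF T(1) T' z'(3) 2] by blast
      have "(\<Sum>x\<in>{-R..R}. S z x) = (\<Sum>x\<in>{a<..b}. 1)"
        using fib[OF z] ab by (intro sum.mono_neutral_cong_right) auto
      then show ?thesis using ab by simp
    qed
  qed
  have outside: "S z x = 0"
    if z: "z \<in> lattice_box k R m - lattice_points k T m" for z x
  proof (rule ccontr)
    assume "\<not> ?thesis"
    then have "(\<Sum>W\<in>lower_faces (Suc k) T. cell (Suc k) W (real_of_int \<circ> z)) \<noteq> 0"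
      unfolding S_def using sum_cell_Suc_zero[OF T(1) T'] by blast
    then obtain W where W: "W \<in> lower_faces (Suc k) T" "cell (Suc k) W (real_of_int \<circ> z) \<noteq> 0"
      by (meson sum.not_neutral_contains_not_neutral)
    then have "real_of_int \<circ> z \<in> moment_cone (Suc k) T"
      using faces_finite_card(1)[OF T(1) W(1)] cell_moment_cone moment_cone_mono T(1) by blast
    then show False using z by (auto simp: lattice_points_def lattice_box_def)
  qed
  have "lattice_points (Suc k) T m = (\<lambda>(z, x). z(Suc k := x)) ` (SIGMA z:lattice_points k T m. fib z)"
  proof (intro equalityI subsetI)
    fix z assume z: "z \<in> lattice_points (Suc k) T m"
    have "real_of_int \<circ> z(Suc k := 0) \<in> moment_cone (Suc k) T \<longleftrightarrow> real_of_int \<circ> z \<in> moment_cone (Suc k) T"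
      by (rule moment_cone_cong) auto
    moreover have "real_of_int \<circ> z \<in> moment_cone (Suc k) T"
      using z moment_cone_le[of _ "Suc (Suc k)" T "Suc k"] by (auto simp: lattice_points_def)
    ultimately have z0: "z(Suc k := 0) \<in> lattice_points k T m"
      using z by (auto simp: lattice_points_def)
    then have "z (Suc k) \<in> fib (z(Suc k := 0))"
      using z R(1) lattice_points_update_iff[of "z(Suc k := 0)" k R m "z (Suc k)" T] by (auto simp: fib_def)
    with z0 show "z \<in> (\<lambda>(z, x). z(Suc k := x)) ` (SIGMA z:lattice_points k T m. fib z)"
      by (intro rev_image_eqI[of "(z(Suc k := 0), z (Suc k))"]) auto
  next
    fix z assume "z \<in> (\<lambda>(z, x). z(Suc k := x)) ` (SIGMA z:lattice_points k T m. fib z)"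
    then show "z \<in> lattice_points (Suc k) T m"
      using R(1) lattice_points_update_iff[of _ k R m _ T] by (auto simp: fib_def)
  qed
  moreover have "inj_on (\<lambda>(z, x). z(Suc k := x)) (SIGMA z:lattice_points k T m. fib z)"
    by (rule inj_on_subset[OF inj_on_lattice_box_update[of k R m UNIV]]) (use R(1) in auto)
  ultimately have "card (lattice_points (Suc k) T m) = card (SIGMA z:lattice_points k T m. fib z)"
    by (simp add: card_image)
  also have "\<dots> = (\<Sum>z\<in>lattice_points k T m. card (fib z))"
    using R(1) fib by (intro card_SigmaI) (auto intro: finite_subset[OF _ finite_lattice_box] finite_subset[of _ "{-R..R}"])
  finally have "real (card (lattice_points (Suc k) T m)) =
      (\<Sum>z\<in>lattice_points k T m. 1 + (\<Sum>x\<in>{-R..R}. S z x))"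
    using inside by simp
  also have "\<dots> = real (card (lattice_points k T m)) +
      (\<Sum>z\<in>lattice_points k T m. \<Sum>x\<in>{-R..R}. S z x)"
    by (simp add: sum.distrib)
  also have "(\<Sum>z\<in>lattice_points k T m. \<Sum>x\<in>{-R..R}. S z x) =
      (\<Sum>z\<in>lattice_box k R m. \<Sum>x\<in>{-R..R}. S z x)"
    by (rule sum.mono_neutral_left) (use R(1) outside in auto)
  finally show ?thesis
    unfolding S_def by (simp only: sum_lattice_box_Suc fun_upd_comp)
qed

section \<open>Volumes as coefficients of the lattice point count\<close>

definition cyclic_volume :: "nat \<Rightarrow> int set \<Rightarrow> real" where
  "cyclic_volume k T = (\<Sum>W\<in>lower_faces (Suc k) T. vandermonde W / fact k)"

lemma cyclic_volume_0:
  assumes "finite T" "T \<noteq> {}"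
  shows "cyclic_volume 0 T = 1"
  using lower_faces_1[OF assms] vandermonde_insert[of "{}" "Min T"]
  by (simp add: cyclic_volume_def)

lemma sum_lattice_box_cells:
  assumes F: "finite F" "\<And>W. W \<in> F \<Longrightarrow> W \<subseteq> T \<and> finite W \<and> card W = Suc d" and m: "0 < m"
    and B: "1 \<le> B" "\<And>t. t \<in> T \<Longrightarrow> \<bar>t\<bar> \<le> B" "m * B ^ Suc d \<le> R"
  shows "(\<Sum>z\<in>lattice_box d R m. \<Sum>W\<in>F. cell (Suc d) W (real_of_int \<circ> z)) =
    (\<Sum>W\<in>F. vandermonde W / fact d) * of_int m ^ d"
proof -
  have "(\<Sum>z\<in>lattice_box d R m. \<Sum>W\<in>F. cell (Suc d) W (real_of_int \<circ> z)) =
    (\<Sum>W\<in>F. \<Sum>z\<in>lattice_box d R m. cell (Suc d) W (real_of_int \<circ> z))"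
    by (rule sum.swap)
  also have "\<dots> = (\<Sum>W\<in>F. vandermonde W / fact d * of_int m ^ d)"
  proof (intro sum.cong refl sum_cell_lattice_box)
    fix U k W and z :: "nat \<Rightarrow> real"
    assume U: "U \<in> F" and W: "W \<subseteq> U" "card W = Suc k" and z: "z 0 = real_of_int m" "cell (Suc k) W z \<noteq> 0"
    \<comment> \<open>The point over \<open>z\<close> on the hyperplane of \<open>W\<close>. Its
      last coordinate is minus the functional to be bounded, and as a moment of a measure of mass
      \<open>m\<close> it has absolute value at most \<open>m * B ^ Suc k\<close>. As
      \<open>k\<close> may reach \<open>d\<close>, the hypothesis on \<open>R\<close> has exponent
      \<open>Suc d\<close>.\<close>
    define y where "y = z(Suc k := - functional (z(Suc k := 0)) (node_poly W))"
    have fin: "finite W" using W(2) card.infinite by fastforce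
    have "y \<in> moment_cone (Suc (Suc k)) W"
      unfolding y_def using fin W z cell_moment_cone by (intro moment_cone_node_extension) auto
    then have "\<bar>y (Suc k)\<bar> \<le> y 0 * of_int B ^ Suc k"
      using F(2)[OF U] W(1) B(2) by (intro moment_cone_bound) (auto simp flip: of_int_abs)
    then have "\<bar>functional (z(Suc k := 0)) (node_poly W)\<bar> \<le> of_int (m * B ^ Suc k)"
      by (simp add: y_def z)
    also have "\<dots> \<le> of_int (m * B ^ Suc d)"
      unfolding of_int_le_iff using F(2)[OF U] W B(1) m card_mono[of U W]
      by (intro mult_left_mono power_increasing) auto
    also have "\<dots> \<le> of_int R" unfolding of_int_le_iff by (rule B(3))
    finally show "\<bar>functional (z(Suc k := 0)) (node_poly W)\<bar> \<le> of_int R" .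
  qed (use F m in auto)
  finally show ?thesis by (simp add: sum_distrib_right)
qed

lemma common_bound:
  assumes "finite (T :: int set)"
  obtains B where "1 \<le> B" "\<And>t. t \<in> T \<Longrightarrow> \<bar>t\<bar> \<le> B"
proof -
  have "\<bar>t\<bar> \<le> Max (insert 1 (abs ` T))" if "t \<in> T" for t
    using assms that by (intro Max_ge) auto
  then show ?thesis
    using assms by (intro that[of "Max (insert 1 (abs ` T))"]) (auto intro: Max_ge)
qed

text \<open>The cells of the two triangulations have the same sum at every point, so summing over
  lattice points with \<open>m = 1\<close> gives equal volumes.\<close>

lemma cyclic_volume_upper:
  assumes "finite T" "Suc k \<le> card T"
  shows "cyclic_volume k T = (\<Sum>W\<in>upper_faces (Suc k) T. vandermonde W / fact k)"
proof -
  obtain B where B: "1 \<le> B" "\<And>t. t \<in> T \<Longrightarrow> \<bar>t\<bar> \<le> B"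
    using common_bound[OF assms(1)] by blast
  have sums: "(\<Sum>z\<in>lattice_box k (B ^ Suc k) 1. \<Sum>W\<in>F. cell (Suc k) W (real_of_int \<circ> z)) =
      (\<Sum>W\<in>F. vandermonde W / fact k) * of_int 1 ^ k"
    if "F \<in> {lower_faces (Suc k) T, upper_faces (Suc k) T}" for F
  proof (rule sum_lattice_box_cells[OF _ _ _ B])
    show "finite F" using that assms(1) by auto
    show "W \<subseteq> T \<and> finite W \<and> card W = Suc k" if "W \<in> F" for W
      using that \<open>F \<in> _\<close> faces_finite_card[OF assms(1)] by blast
  qed simp_all
  show ?thesis
    using sums[of "lower_faces (Suc k) T"] sums[of "upper_faces (Suc k) T"]
      sum_cell_lower_upper[OF assms]
    by (simp add: cyclic_volume_def del: cell.simps)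
qed

text \<open>The Ehrhart coefficients of a cyclic polytope are the volumes of its projections (Liu).\<close>

lemma card_lattice_points:
  assumes T: "finite T" "Suc d \<le> card T" and m: "0 < m"
  shows "real (card (lattice_points d T m)) = (\<Sum>k\<le>d. cyclic_volume k T * of_int m ^ k)"
  using T(2)
proof (induction d)
  case 0
  have "T \<noteq> {}" using 0 by auto
  have "(\<lambda>_. 0)(0 := m) \<in> lattice_points 0 T m"
  proof -
    have "(\<Sum>t\<in>T. real_of_int m / card T) = m" using T(1) \<open>T \<noteq> {}\<close> by simp
    then show ?thesis
      unfolding lattice_points_def moment_cone_def using m
      by (auto intro!: exI[of _ "\<lambda>_. real_of_int m / card T"])
  qed
  moreover have "z = (\<lambda>_. 0)(0 := m)" if "z \<in> lattice_points 0 T m" for z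
    using that by (auto simp: lattice_points_def)
  ultimately have "lattice_points 0 T m = {(\<lambda>_. 0)(0 := m)}" by blast
  then show ?case by (simp add: cyclic_volume_0[OF T(1) \<open>T \<noteq> {}\<close>])
next
  case (Suc d)
  obtain B where B: "1 \<le> B" "\<And>t. t \<in> T \<Longrightarrow> \<bar>t\<bar> \<le> B"
    using common_bound[OF T(1)] by blast
  define R where "R = m * B ^ Suc (Suc d)"
  have le: "m * B ^ j \<le> R" if "j \<le> Suc (Suc d)" for j
    unfolding R_def using B(1) m that by (intro mult_left_mono power_increasing) auto
  have subs: "lattice_points j T m \<subseteq> lattice_box j R m" if "j \<le> Suc (Suc d)" for j
    by (rule lattice_points_subset_box[OF _ B le]) (use m that in auto)
  have "real (card (lattice_points (Suc d) T m)) = real (card (lattice_points d T m)) +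
    (\<Sum>z\<in>lattice_box (Suc d) R m. \<Sum>W\<in>lower_faces (Suc (Suc d)) T. cell (Suc (Suc d)) W (real_of_int \<circ> z))"
    using T(1) Suc.prems m by (intro card_lattice_points_Suc subs) simp_all
  also have "(\<Sum>z\<in>lattice_box (Suc d) R m. \<Sum>W\<in>lower_faces (Suc (Suc d)) T. cell (Suc (Suc d)) W (real_of_int \<circ> z)) =
      cyclic_volume (Suc d) T * of_int m ^ Suc d"
    unfolding cyclic_volume_def
  proof (rule sum_lattice_box_cells[OF _ _ m B le])
    show "finite (lower_faces (Suc (Suc d)) T)" using T(1) by simp
    show "W \<subseteq> T \<and> finite W \<and> card W = Suc (Suc d)" if "W \<in> lower_faces (Suc (Suc d)) T" for W
      using that faces_finite_card(1)[OF T(1)] by blast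
  qed simp_all
  finally show ?case using Suc by simp
qed

subsection \<open>Magic positivity\<close>

definition magic_positive :: "real poly \<Rightarrow> nat \<Rightarrow> bool" where
  "magic_positive f d \<longleftrightarrow> (\<exists>a. (\<forall>i\<le>d. 0 \<le> a i) \<and> magic_expansion f d a)"

definition magic_basis :: "nat \<Rightarrow> nat \<Rightarrow> real poly" where
  "magic_basis d i = [:0, 1:] ^ i * [:1, 1:] ^ (d - i)"

lemma magic_expansion_basis:
  "magic_expansion f d a \<longleftrightarrow> f = (\<Sum>i\<le>d. smult (a i) (magic_basis d i))"
  by (simp add: magic_expansion_def magic_basis_def)

lemma magic_positive_add:
  assumes "magic_positive f d" "magic_positive g d"
  shows "magic_positive (f + g) d"
proof -
  obtain a b where "\<forall>i\<le>d. 0 \<le> a i" "f = (\<Sum>i\<le>d. smult (a i) (magic_basis d i))"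
    "\<forall>i\<le>d. 0 \<le> b i" "g = (\<Sum>i\<le>d. smult (b i) (magic_basis d i))"
    using assms unfolding magic_positive_def magic_expansion_basis by blast
  then show ?thesis
    unfolding magic_positive_def magic_expansion_basis
    by (intro exI[of _ "\<lambda>i. a i + b i"]) (simp add: smult_add_left sum.distrib)
qed

lemma magic_positive_mult_one_plus_X:
  assumes "magic_positive f d"
  shows "magic_positive ([:1, 1:] * f) (Suc d)"
proof -
  obtain a where a: "\<forall>i\<le>d. 0 \<le> a i" "f = (\<Sum>i\<le>d. smult (a i) (magic_basis d i))"
    using assms unfolding magic_positive_def magic_expansion_basis by blast
  have "[:1, 1:] * magic_basis d i = magic_basis (Suc d) i" if "i \<le> d" for i
    using that unfolding magic_basis_def by (simp only: Suc_diff_le power_Suc mult.left_commute)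
  then have "[:1, 1:] * f = (\<Sum>i\<le>d. smult (a i) (magic_basis (Suc d) i))"
    unfolding a(2) sum_distrib_left mult_smult_right by (intro sum.cong) auto
  then show ?thesis
    unfolding magic_positive_def magic_expansion_basis using a(1)
    by (intro exI[of _ "\<lambda>i. if i \<le> d then a i else 0"]) simp
qed

lemma magic_positive_mult_X:
  assumes "magic_positive f d"
  shows "magic_positive ([:0, 1:] * f) (Suc d)"
proof -
  obtain a where a: "\<forall>i\<le>d. 0 \<le> a i" "f = (\<Sum>i\<le>d. smult (a i) (magic_basis d i))"
    using assms unfolding magic_positive_def magic_expansion_basis by blast
  have "[:0, 1:] * magic_basis d i = magic_basis (Suc d) (Suc i)" for i
    unfolding magic_basis_def by (simp only: power_Suc diff_Suc_Suc mult.assoc)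
  then have "[:0, 1:] * f = (\<Sum>i\<le>d. smult (a i) (magic_basis (Suc d) (Suc i)))"
    unfolding a(2) sum_distrib_left mult_smult_right by simp
  also have "\<dots> = (\<Sum>i\<le>Suc d. smult (case i of 0 \<Rightarrow> 0 | Suc j \<Rightarrow> a j) (magic_basis (Suc d) i))"
    by (subst sum.atMost_Suc_shift) simp
  finally show ?thesis
    unfolding magic_positive_def magic_expansion_basis using a(1)
    by (intro exI[of _ "\<lambda>i. case i of 0 \<Rightarrow> 0 | Suc j \<Rightarrow> a j"]) (auto split: nat.splits)
qed

lemma sum_by_parts:
  fixes Y :: "nat \<Rightarrow> real poly"
  shows "(\<Sum>i\<le>n. smult (a i) (Y i)) =
    (\<Sum>i<n. smult (\<Sum>l\<le>i. a l) (Y i - Y (Suc i))) + smult (\<Sum>l\<le>n. a l) (Y n)"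
  by (induction n) (simp_all add: smult_diff_right smult_add_left algebra_simps)

text \<open>Dropping the leading term replaces the magic coefficients by their partial sums.\<close>

lemma magic_positive_truncate:
  assumes "magic_positive (\<Sum>k\<le>Suc d. monom (e k) k) (Suc d)"
  shows "magic_positive (\<Sum>k\<le>d. monom (e k) k) d"
proof -
  obtain a where a: "\<forall>i\<le>Suc d. 0 \<le> a i"
    "(\<Sum>k\<le>Suc d. monom (e k) k) = (\<Sum>i\<le>Suc d. smult (a i) (magic_basis (Suc d) i))"
    using assms unfolding magic_positive_def magic_expansion_basis by blast
  define b where "b = (\<lambda>i. \<Sum>l\<le>i. a l)"
  define g where "g = (\<Sum>i\<le>d. smult (b i) (magic_basis d i))"
  \<comment> \<open>As \<open>(1 + x) - x = 1\<close>, neighbouring basis elements of level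
    \<open>Suc d\<close> differ by one of level \<open>d\<close>; summation by parts therefore
    descends a level.\<close>
  have basis: "magic_basis (Suc d) i - magic_basis (Suc d) (Suc i) = magic_basis d i" if "i \<le> d" for i
  proof -
    have "magic_basis (Suc d) i = [:1, 1:] * magic_basis d i"
      using that unfolding magic_basis_def by (simp only: Suc_diff_le power_Suc mult.left_commute)
    moreover have "magic_basis (Suc d) (Suc i) = [:0, 1:] * magic_basis d i"
      unfolding magic_basis_def by (simp only: power_Suc diff_Suc_Suc mult.assoc)
    moreover have "[:1, 1:] * magic_basis d i - [:0, 1:] * magic_basis d i = magic_basis d i"
      unfolding left_diff_distrib[symmetric] by simp
    ultimately show ?thesis by simp
  qed
  have "(\<Sum>k\<le>Suc d. monom (e k) k) = g + smult (b (Suc d)) (magic_basis (Suc d) (Suc d))"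
    unfolding a(2) sum_by_parts g_def b_def lessThan_Suc_atMost by (simp add: basis)
  also have "magic_basis (Suc d) (Suc d) = monom 1 (Suc d)"
    unfolding magic_basis_def by (simp add: monom_altdef del: power_Suc)
  finally have eq: "(\<Sum>k\<le>d. monom (e k) k) + monom (e (Suc d)) (Suc d) = g + monom (b (Suc d)) (Suc d)"
    by (simp add: smult_monom)
  have "degree (magic_basis d i) \<le> d" if "i \<le> d" for i
    using that by (simp add: magic_basis_def degree_mult_eq degree_power_eq)
  then have "degree g \<le> d"
    unfolding g_def by (intro degree_sum_le) (auto intro: order.trans[OF degree_smult_le])
  moreover have "degree (\<Sum>k\<le>d. monom (e k) k) \<le> d"
    by (intro degree_sum_le) (auto intro: order.trans[OF degree_monom_le])
  ultimately have "e (Suc d) = b (Suc d)"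
    using arg_cong[OF eq, of "\<lambda>p. coeff p (Suc d)"] by (simp add: coeff_eq_0)
  with eq have "(\<Sum>k\<le>d. monom (e k) k) = g" by simp
  moreover have "\<forall>i\<le>d. 0 \<le> b i" using a(1) by (auto simp: b_def intro!: sum_nonneg)
  ultimately show ?thesis
    unfolding magic_positive_def magic_expansion_basis g_def by blast
qed

text \<open>The upper bound carries the induction: the next sum is \<open>x (Suc i)\<close> minus
  the previous one, which is at most \<open>x i\<close>.\<close>

lemma alternating_sum_bounds:
  fixes x :: "nat \<Rightarrow> real"
  assumes "0 \<le> x 0" "\<And>k. k < i \<Longrightarrow> x k \<le> x (Suc k)"
  shows "0 \<le> (\<Sum>k\<le>i. (- 1) ^ (i - k) * x k) \<and> (\<Sum>k\<le>i. (- 1) ^ (i - k) * x k) \<le> x i"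
  using assms
proof (induction i)
  case (Suc i)
  have "(\<Sum>k\<le>Suc i. (- 1) ^ (Suc i - k) * x k) = x (Suc i) + (\<Sum>k\<le>i. - ((- 1) ^ (i - k) * x k))"
    by (simp add: Suc_diff_le)
  also have "\<dots> = x (Suc i) - (\<Sum>k\<le>i. (- 1) ^ (i - k) * x k)"
    by (simp add: sum_negf)
  finally show ?case
    using Suc.IH Suc.prems by fastforce
qed simp

lemma smult_sum_right: "smult c (\<Sum>i\<in>A. f i) = (\<Sum>i\<in>A. smult c (f i))"
  by (induction A rule: infinite_finite_induct) (simp_all add: smult_add_right)

text \<open>Expand \<open>x ^ k * ((1 + x) - x) ^ (n - k)\<close> by the binomial theorem.\<close>

lemma monom_magic_expansion:
  assumes "k \<le> n"
  shows "monom 1 k = (\<Sum>i=k..n. smult ((- 1) ^ (i - k) * real (n - k choose (i - k))) (magic_basis n i))"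
proof -
  have "(\<Sum>i=k..n. smult ((- 1) ^ (i - k) * real (n - k choose (i - k))) (magic_basis n i)) =
    (\<Sum>j\<le>n - k. smult ((- 1) ^ j * real (n - k choose j)) (magic_basis n (j + k)))"
    by (rule sum.reindex_bij_witness[of _ "\<lambda>j. j + k" "\<lambda>i. i - k"]) (use assms in auto)
  also have "\<dots> = (\<Sum>j\<le>n - k. [:0, 1:] ^ k * (of_nat (n - k choose j) * (- [:0, 1:]) ^ j * [:1, 1:] ^ (n - k - j)))"
  proof (intro sum.cong refl)
    fix j
    have "n - (j + k) = n - k - j" by simp
    moreover have "(- p) ^ j = smult ((- 1) ^ j) (p ^ j)" for p :: "real poly"
      by (cases "even j") simp_all
    moreover have "(of_nat (n - k choose j) :: real poly) = [:real (n - k choose j):]"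
      by (rule of_nat_poly)
    ultimately show "smult ((- 1) ^ j * real (n - k choose j)) (magic_basis n (j + k)) =
      [:0, 1:] ^ k * (of_nat (n - k choose j) * (- [:0, 1:]) ^ j * [:1, 1:] ^ (n - k - j))"
      by (simp only: magic_basis_def power_add) (simp add: mult_ac)
  qed
  also have "\<dots> = [:0, 1:] ^ k * (- [:0, 1:] + [:1, 1:]) ^ (n - k)"
    by (simp only: binomial_ring sum_distrib_left)
  also have "\<dots> = monom 1 k"
    by (simp add: monom_altdef flip: one_pCons)
  finally show ?thesis by simp
qed

text \<open>The magic coefficient \<open>a i\<close> is the alternating sum of
  \<open>(n - k choose i - k) * h k\<close>. From \<open>k\<close> to \<open>k + 1\<close> the
  binomial drops by at most the factor \<open>n - k\<close>, which the hypothesis compensates; so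
  the terms increase and the alternating sum is nonnegative.\<close>

lemma magic_positive_growth:
  assumes h: "0 \<le> h 0" "\<And>k. k < n \<Longrightarrow> real (n - k) * h k \<le> h (Suc k)"
  shows "magic_positive (\<Sum>k\<le>n. monom (h k) k) n"
proof -
  define x where "x = (\<lambda>i k. real (n - k choose (i - k)) * h k)"
  define a where "a = (\<lambda>i. \<Sum>k\<le>i. (- 1) ^ (i - k) * x i k)"
  have h0: "0 \<le> h k" if "k \<le> n" for k
    using that
  proof (induction k)
    case (Suc k)
    then have "0 \<le> real (n - k) * h k" by simp
    with h(2)[of k] Suc.prems show ?case by linarith
  qed (use h in simp)
  have "0 \<le> a i" if "i \<le> n" for i
  proof -
    have "x i k \<le> x i (Suc k)" if "k < i" for k
    proof -
      define N J where "N = n - Suc k" and "J = i - Suc k"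
      have NJ: "n - k = Suc N" "i - k = Suc J" "n - Suc k = N" "i - Suc k = J"
        using that \<open>i \<le> n\<close> by (auto simp: N_def J_def)
      have "(Suc N choose Suc J) \<le> (Suc N choose Suc J) * Suc J" by simp
      also have "\<dots> = Suc N * (N choose J)" by (simp only: Suc_times_binomial_eq)
      finally have "real (Suc N choose Suc J) \<le> real (Suc N) * real (N choose J)"
        unfolding of_nat_mult[symmetric] of_nat_le_iff .
      then have "real (Suc N choose Suc J) * h k \<le> real (Suc N) * real (N choose J) * h k"
        using h0[of k] that \<open>i \<le> n\<close> by (intro mult_right_mono) auto
      also have "\<dots> \<le> real (N choose J) * h (Suc k)"
        using h(2)[of k] that \<open>i \<le> n\<close> mult_left_mono[of "real (Suc N) * h k" "h (Suc k)" "real (N choose J)"]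
        unfolding NJ by (simp add: mult_ac)
      finally show ?thesis unfolding x_def NJ .
    qed
    moreover have "0 \<le> x i 0" using h by (simp add: x_def)
    ultimately show ?thesis
      unfolding a_def using alternating_sum_bounds[of "x i" i] by blast
  qed
  moreover have "(\<Sum>k\<le>n. monom (h k) k) = (\<Sum>i\<le>n. smult (a i) (magic_basis n i))"
  proof -
    have "(\<Sum>k\<le>n. monom (h k) k) = (\<Sum>k\<le>n. smult (h k) (monom 1 k))"
      by (simp add: smult_monom)
    also have "\<dots> = (\<Sum>k\<le>n. \<Sum>i=k..n. smult ((- 1) ^ (i - k) * x i k) (magic_basis n i))"
    proof (intro sum.cong refl)
      fix k assume "k \<in> {..n}"
      then have "k \<le> n" by simp
      show "smult (h k) (monom 1 k) = (\<Sum>i=k..n. smult ((- 1) ^ (i - k) * x i k) (magic_basis n i))"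
        unfolding monom_magic_expansion[OF \<open>k \<le> n\<close>] smult_sum_right
        by (simp add: x_def mult_ac)
    qed
    also have "\<dots> = (\<Sum>k\<in>{..n}. \<Sum>i | i \<in> {..n} \<and> k \<le> i. smult ((- 1) ^ (i - k) * x i k) (magic_basis n i))"
      by (intro sum.cong) auto
    also have "\<dots> = (\<Sum>i\<in>{..n}. \<Sum>k | k \<in> {..n} \<and> k \<le> i. smult ((- 1) ^ (i - k) * x i k) (magic_basis n i))"
      by (rule sum.swap_restrict) auto
    also have "\<dots> = (\<Sum>i\<le>n. smult (a i) (magic_basis n i))"
      unfolding a_def smult_sum by (intro sum.cong) auto
    finally show ?thesis .
  qed
  ultimately show ?thesis
    unfolding magic_positive_def magic_expansion_basis by blast
qed

subsection \<open>Growth of the volumes\<close>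

lemma fact_card_le_prod:
  fixes g :: "'a \<Rightarrow> int"
  assumes "finite S" "inj_on g S" "\<And>s. s \<in> S \<Longrightarrow> 1 \<le> g s"
  shows "fact (card S) \<le> (\<Prod>s\<in>S. g s)"
proof -
  have "fact (card A) \<le> \<Prod>A" if "finite A" "\<forall>a\<in>A. 1 \<le> a" for A :: "int set"
    using that
  proof (induction A rule: finite_linorder_max_induct)
    case (insert b A)
    have "A \<subseteq> {1..b - 1}" using insert by auto
    then have "card A \<le> card {1..b - 1}" by (intro card_mono) auto
    then have "int (Suc (card A)) \<le> b" using insert.prems by auto
    moreover have "fact (card A) \<le> \<Prod>A" using insert by auto
    ultimately have "int (Suc (card A)) * fact (card A) \<le> b * \<Prod>A"
      using insert.prems by (intro mult_mono) auto
    moreover have "b \<notin> A" using insert by auto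
    ultimately show ?case using insert.hyps by simp
  qed simp
  from this[of "g ` S"] show ?thesis
    using assms by (simp add: card_image prod.reindex)
qed

lemma fact_card_le_prod_real:
  fixes g :: "'a \<Rightarrow> int"
  assumes "finite S" "inj_on g S" "\<And>s. s \<in> S \<Longrightarrow> 1 \<le> g s"
  shows "fact (card S) \<le> (\<Prod>s\<in>S. real_of_int (g s))"
proof -
  have "real_of_int (fact (card S)) \<le> real_of_int (\<Prod>s\<in>S. g s)"
    unfolding of_int_le_iff using assms by (rule fact_card_le_prod)
  then show ?thesis by simp
qed

lemma fact_le_poly_node_poly:
  assumes "finite U" "\<forall>u\<in>U. u < t"
  shows "fact (card U) \<le> poly (node_poly U) (of_int t)"
proof -
  have "1 \<le> t - u" if "u \<in> U" for u using assms(2) that by force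
  then have "fact (card U) \<le> (\<Prod>u\<in>U. real_of_int (t - u))"
    using assms(1) by (intro fact_card_le_prod_real) (auto simp: inj_on_def)
  then show ?thesis by (simp add: poly_node_poly)
qed

text \<open>For \<open>t\<close> above \<open>U\<close> and \<open>card U = Suc k\<close>: the
  volume of the simplex of \<open>insert t U\<close> minus that of \<open>U\<close>. Summed over the
  upper faces it is the coefficient of \<open>x ^ k\<close> in \<open>H\<close>.\<close>

definition excess :: "nat \<Rightarrow> int \<Rightarrow> int set \<Rightarrow> real" where
  "excess k t U = vandermonde U / fact k * (poly (node_poly U) (of_int t) / real (Suc k) - 1)"

lemma excess_nonneg:
  assumes "finite U" "card U = Suc k" "\<forall>u\<in>U. u < t"
  shows "0 \<le> excess k t U"
proof -
  have "real (Suc k) * 1 \<le> real (Suc k) * fact k"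
    by (intro mult_left_mono) (auto simp: fact_ge_1)
  also have "\<dots> = fact (card U)" using assms by simp
  also have "\<dots> \<le> poly (node_poly U) (of_int t)" using assms by (intro fact_le_poly_node_poly)
  finally have "1 \<le> poly (node_poly U) (of_int t) / real (Suc k)"
    by (simp add: pos_le_divide_eq del: of_nat_Suc)
  then show ?thesis
    unfolding excess_def using vandermonde_pos[OF assms(1)] by (intro mult_nonneg_nonneg) auto
qed

text \<open>The cost of charging an upper face of size \<open>k\<close> to its extension by a node
  of rank \<open>i\<close>. Numerator: the required growth factor \<open>n - k + 1\<close> and the
  divisor \<open>k + 1\<close> in \<open>excess k\<close>. Denominator: lower bounds for the product
  of the distances of the new node to the old ones, and \<open>n - i + 1\<close> for its distance to
  \<open>t\<close>.\<close>

definition weight :: "nat \<Rightarrow> nat \<Rightarrow> nat \<Rightarrow> real" where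
  "weight n k i = real (n - k + 1) * real (k + 1) /
    (fact i * fact (k - i - 1) * real (n - i) * real (n - i + 1))"

text \<open>\<open>x\<close> is the first gap of \<open>U\<close>. Nodes of \<open>T\<close> outside
  \<open>U\<close> are at least \<open>x\<close>, so adjoining \<open>x\<close> keeps the sign
  condition. All nodes below \<open>x\<close> belong to \<open>U\<close>, hence \<open>x\<close> has
  rank \<open>i\<close> in \<open>T\<close> as well and \<open>n - i\<close> nodes lie above
  it.\<close>

lemma upper_face_extension:
  assumes T: "finite T" "card T = Suc n" and U: "U \<in> upper_faces (Suc k) T" and kn: "Suc k \<le> n"
  defines "x \<equiv> Min (T - U)"
  defines "i \<equiv> card {s \<in> insert x U. s < x}"
  shows "x \<in> T" "x \<notin> U" "insert x U \<in> upper_faces (Suc (Suc k)) T"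
    "i < Suc k" "odd (Suc k - i)" "int (n - i) \<le> Max T - x"
    "fact i * fact (Suc k - i - 1) * real (n - i) \<le> \<bar>poly (node_poly U) (of_int x)\<bar>"
proof -
  have U': "U \<subseteq> T" "finite U" "card U = Suc k" "\<And>s. s \<in> T \<Longrightarrow> poly (node_poly U) (of_int s) \<le> 0"
    using U T finite_subset by (auto simp: upper_faces_def)
  have "T - U \<noteq> {}"
  proof
    assume "T - U = {}"
    then have "T = U" using U' by auto
    then show False using U' T kn by simp
  qed
  then have "x \<in> T - U" unfolding x_def using T by (intro Min_in) auto
  then show x: "x \<in> T" "x \<notin> U" by auto
  have min: "x \<le> s" if "s \<in> T - U" for s
    unfolding x_def using T that by (intro Min_le) auto
  have "poly (node_poly (insert x U)) (of_int s) \<le> 0" if s: "s \<in> T" for s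
  proof (cases "s \<in> U")
    case True
    then have "poly (node_poly U) (of_int s) = 0" using U' node_poly_eq_0_iff by blast
    then show ?thesis using U' x by (simp add: poly_node_poly_insert)
  next
    case False
    then have "x \<le> s" using min s by auto
    then show ?thesis
      using U' x s by (simp add: poly_node_poly_insert mult_nonneg_nonpos)
  qed
  then show "insert x U \<in> upper_faces (Suc (Suc k)) T"
    using U' x by (auto simp: upper_faces_def)
  define A where "A = {s \<in> U. s < x}"
  define B where "B = {s \<in> U. x < s}"
  have AB: "U = A \<union> B" "A \<inter> B = {}" "finite A" "finite B"
    using U' x by (auto simp: A_def B_def) (metis linorder_neqE)
  have i: "i = card A" unfolding i_def A_def by (rule arg_cong[of _ _ card]) auto
  have cardB: "card B = Suc k - i"
    using card_Un_disjoint[OF AB(3,4,2)] AB(1) U'(3) i by simp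
  define M where "M = Max T"
  have T0: "T \<noteq> {}" using x by auto
  have M: "M \<in> T" "\<And>s. s \<in> T \<Longrightarrow> s \<le> M" using T T0 by (auto simp: M_def)
  have "M \<in> U"
  proof (rule ccontr)
    assume "M \<notin> U"
    then have "\<forall>u\<in>U. u < M" using U'(1) M(2) by (auto simp: less_le)
    from node_poly_pos_above[OF this] show False using U'(4)[OF M(1)] by simp
  qed
  then have MB: "M \<in> B" using x M(2)[OF x(1)] by (auto simp: B_def le_less)
  then have "card B > 0" using AB by (auto simp: card_gt_0_iff)
  then show "i < Suc k" using cardB by simp
  have split: "poly (node_poly U) (of_int x) = (\<Prod>s\<in>A. real_of_int (x - s)) * ((- 1) ^ card B * (\<Prod>s\<in>B. real_of_int (s - x)))"
  proof -
    have "poly (node_poly U) (of_int x) = (\<Prod>s\<in>A. real_of_int (x - s)) * (\<Prod>s\<in>B. real_of_int (x - s))"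
      unfolding poly_node_poly AB(1) using AB by (simp add: prod.union_disjoint)
    also have "(\<Prod>s\<in>B. real_of_int (x - s)) = (\<Prod>s\<in>B. (- 1) * real_of_int (s - x))" by simp
    also have "\<dots> = (- 1) ^ card B * (\<Prod>s\<in>B. real_of_int (s - x))"
      by (subst prod.distrib) simp
    finally show ?thesis .
  qed
  have pos: "0 < (\<Prod>s\<in>A. real_of_int (x - s))" "0 < (\<Prod>s\<in>B. real_of_int (s - x))"
    by (auto intro!: prod_pos simp: A_def B_def)
  have "odd (card B)"
  proof
    assume "even (card B)"
    then have "poly (node_poly U) (of_int x) > 0" using pos by (simp add: split)
    then show False using U'(4)[OF x(1)] by simp
  qed
  then show "odd (Suc k - i)" by (simp add: cardB)
  have "A = {s \<in> T. s < x}" using U' min by (fastforce simp: A_def)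
  then have "T = A \<union> insert x {s \<in> T. x < s}" using x by auto
  moreover have "card (A \<union> insert x {s \<in> T. x < s}) = card A + card (insert x {s \<in> T. x < s})"
    using T AB by (intro card_Un_disjoint) (auto simp: A_def)
  moreover have "card (insert x {s \<in> T. x < s}) = Suc (card {s \<in> T. x < s})"
    using T by (intro card_insert_disjoint) auto
  ultimately have "card {s \<in> T. x < s} = n - i" using T i by simp
  moreover have "card {s \<in> T. x < s} \<le> card {x<..M}"
    using M by (intro card_mono) auto
  ultimately show Mx: "int (n - i) \<le> Max T - x"
    using M(2)[OF x(1)] unfolding M_def by auto
  have "fact i \<le> (\<Prod>s\<in>A. real_of_int (x - s))"
    unfolding i using AB by (intro fact_card_le_prod_real) (auto simp: inj_on_def A_def)
  \<comment> \<open>The largest node is at distance at least \<open>n - i\<close>, the other nodes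
    above \<open>x\<close> at distinct positive distances; this is at least as strong as
    \<open>fact (Suc k - i)\<close>.\<close>
  moreover have "fact (Suc k - i - 1) * real (n - i) \<le> (\<Prod>s\<in>B. real_of_int (s - x))"
  proof -
    have "fact (card (B - {M})) \<le> (\<Prod>s\<in>B - {M}. real_of_int (s - x))"
      using AB by (intro fact_card_le_prod_real) (auto simp: inj_on_def B_def)
    moreover have "card (B - {M}) = Suc k - i - 1" using MB AB cardB by simp
    moreover have "real (n - i) \<le> real_of_int (M - x)" using Mx unfolding M_def by linarith
    moreover have "0 \<le> (\<Prod>s\<in>B - {M}. real_of_int (s - x))" by (intro prod_nonneg) (auto simp: B_def)
    ultimately have "fact (Suc k - i - 1) * real (n - i) \<le> (\<Prod>s\<in>B - {M}. real_of_int (s - x)) * real_of_int (M - x)"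
      by (intro mult_mono) auto
    also have "\<dots> = (\<Prod>s\<in>B. real_of_int (s - x))"
      using prod.remove[OF AB(4) MB, of "\<lambda>s. real_of_int (s - x)"] by simp
    finally show ?thesis .
  qed
  ultimately have "fact i * (fact (Suc k - i - 1) * real (n - i)) \<le>
      (\<Prod>s\<in>A. real_of_int (x - s)) * (\<Prod>s\<in>B. real_of_int (s - x))"
    using pos by (intro mult_mono) auto
  also have "\<dots> = \<bar>poly (node_poly U) (of_int x)\<bar>"
    using pos unfolding split by (simp add: abs_mult)
  finally show "fact i * fact (Suc k - i - 1) * real (n - i) \<le> \<bar>poly (node_poly U) (of_int x)\<bar>"
    by (simp only: mult.assoc)
qed

text \<open>Adjoining \<open>x\<close> multiplies the Vandermonde product by \<open>B\<close> and
  the node polynomial at \<open>t\<close> by \<open>s\<close>; \<open>weight\<close> is chosen such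
  that the lower bounds for \<open>B\<close> and \<open>s\<close> yield the factor
  \<open>n - Suc k + 1\<close>.\<close>

lemma excess_extension:
  assumes T: "finite T" "card T = Suc n" "\<forall>s\<in>T. s < t"
    and U: "U \<in> upper_faces (Suc k) T" and kn: "Suc k \<le> n"
  defines "x \<equiv> Min (T - U)"
  defines "i \<equiv> card {s \<in> insert x U. s < x}"
  shows "real (n - Suc k + 1) * excess k t U \<le> weight n (Suc k) i * excess (Suc k) t (insert x U)"
proof -
  note ext = upper_face_extension[OF T(1,2) U kn, folded x_def, folded i_def]
  have U': "U \<subseteq> T" "finite U" "card U = Suc k"
    using U T finite_subset by (auto simp: upper_faces_def)
  define A where "A = poly (node_poly U) (of_int t)"
  define B where "B = \<bar>poly (node_poly U) (of_int x)\<bar>"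
  define s where "s = real_of_int (t - x)"
  have "T \<noteq> {}" using ext(1) by auto
  then have "Max T < t" using T by simp
  then have "int (n - i) + 1 \<le> t - x" using ext(6) by linarith
  then have s: "real (n - i + 1) \<le> s" unfolding s_def by linarith
  have ni: "1 \<le> n - i" using ext(4) kn by simp
  then have s2: "2 \<le> s" using s by linarith
  have A: "0 < A" unfolding A_def using U' T by (intro node_poly_pos_above) auto
  define w where "w = weight n (Suc k) i"
  have w: "real (n - Suc k + 1) = w * (fact i * fact (Suc k - i - 1) * real (n - i) * real (n - i + 1)) / real (Suc k + 1)"
    using ni by (simp add: w_def weight_def field_simps del: of_nat_Suc of_nat_add)
  have w0: "0 \<le> w" by (simp add: w_def weight_def)
  have e0: "0 \<le> excess k t U" using U' T by (intro excess_nonneg) auto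
  have "fact i * fact (Suc k - i - 1) * real (n - i) * real (n - i + 1) \<le> B * s"
    using ext(7) s unfolding B_def by (intro mult_mono) auto
  then have "real (n - Suc k + 1) \<le> w * (B * s / real (Suc k + 1))"
    unfolding w using w0 by (simp add: divide_right_mono mult_left_mono)
  then have "real (n - Suc k + 1) * excess k t U \<le> w * (B * s / real (Suc k + 1)) * excess k t U"
    using e0 by (rule mult_right_mono)
  also have "\<dots> = w * (vandermonde U * B / fact (Suc k) * (s / real (Suc k + 1) * (A - real (Suc k))))"
    unfolding excess_def A_def[symmetric] by (simp add: field_simps)
  \<comment> \<open>This amounts to \<open>Suc k + 1 \<le> s * Suc k\<close>, which holds since
    \<open>s \<ge> 2\<close>.\<close>
  also have "\<dots> \<le> w * (vandermonde U * B / fact (Suc k) * (A * s / real (Suc k + 1) - 1))"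
  proof (intro mult_left_mono w0)
    define K where "K = real (Suc k)"
    have "K + 1 \<le> s * K" "0 < K + 1"
      using mult_right_mono[OF s2, of K] by (auto simp: K_def)
    then have "1 \<le> s * K / (K + 1)" by simp
    moreover have "s / (K + 1) * (A - K) = A * s / (K + 1) - s * K / (K + 1)"
      by (simp add: diff_divide_distrib algebra_simps)
    moreover have "real (Suc k + 1) = K + 1" by (simp add: K_def)
    ultimately show "s / real (Suc k + 1) * (A - real (Suc k)) \<le> A * s / real (Suc k + 1) - 1"
      by (simp add: K_def)
    show "0 \<le> vandermonde U * B / fact (Suc k)"
      using vandermonde_pos[OF U'(2)] by (simp add: B_def)
  qed
  also have "\<dots> = w * excess (Suc k) t (insert x U)"
    using U' ext(2) unfolding excess_def
    by (simp add: vandermonde_insert poly_node_poly_insert A_def B_def s_def mult_ac)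
  finally show ?thesis unfolding w_def .
qed

text \<open>At 6 the estimate reads \<open>112 \<le> 120\<close>; at 5 it would compare 48 with
  24.\<close>

lemma six_le_fact: "6 \<le> k \<Longrightarrow> (k + 1) * 2 ^ (k - 2) \<le> fact (k - 1)"
proof (induction k rule: dec_induct)
  case base
  show ?case by (simp add: fact_numeral)
next
  case (step k)
  have "Suc k - 2 = Suc (k - 2)" using step.hyps(1) by simp
  then have "(Suc k + 1) * 2 ^ (Suc k - 2) = 2 * (k + 2) * 2 ^ (k - 2)"
    by (simp only: power_Suc) simp
  also have "\<dots> \<le> k * (k + 1) * 2 ^ (k - 2)"
  proof (intro mult_right_mono)
    have "6 * (k + 1) \<le> k * (k + 1)" using step.hyps by (intro mult_right_mono) auto
    then show "2 * (k + 2) \<le> k * (k + 1)" by simp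
  qed simp
  also have "\<dots> \<le> k * fact (k - 1)"
    using mult_le_mono2[OF step.IH, of k] by (simp only: mult.assoc)
  also have "\<dots> = fact (Suc k - 1)"
    using step.hyps by (simp add: fact_reduce)
  finally show ?case .
qed

text \<open>Computed for \<open>k \<le> 5\<close>; from 6 on,
  \<open>(n - k + 1) * 2 \<le> (n - i) * (n - i + 1)\<close> and the row sum
  \<open>2 ^ (k - 1)\<close> of the binomials suffice. For the two excluded pairs the sum is
  \<open>3/2\<close> and \<open>7/6\<close>.\<close>

lemma sum_weight_le_1:
  assumes "1 \<le> k" "k \<le> n" "(k, n) \<noteq> (2, 2)" "(k, n) \<noteq> (3, 3)"
  shows "(\<Sum>i | i < k \<and> odd (k - i). weight n k i) \<le> 1"
proof -
  consider "k = 1" | "k = 2" "3 \<le> n" | "k = 3" "4 \<le> n" | "k = 4" | "k = 5" | "6 \<le> k"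
    using assms by fastforce
  then show ?thesis
  proof cases
    case 1
    have "{i. i < k \<and> odd (k - i)} = {0}" using 1 by auto
    moreover obtain m where "n = m + 1" using assms 1 by (intro that[of "n - 1"]) simp
    ultimately show ?thesis using 1
      by (simp add: weight_def divide_simps) (simp add: algebra_simps)
  next
    case 2
    have "{i. i < k \<and> odd (k - i)} = {1}"
      using 2 by (intro set_eqI; unfold mem_Collect_eq insert_iff empty_iff; presburger)
    moreover obtain m where "n = m + 3" using 2 by (intro that[of "n - 3"]) simp
    ultimately show ?thesis using 2
      by (simp add: weight_def divide_simps) (simp add: algebra_simps)
  next
    case 3
    have "{i. i < k \<and> odd (k - i)} = {0, 2}"
      using 3 by (intro set_eqI; unfold mem_Collect_eq insert_iff empty_iff; presburger)
    moreover obtain m where "n = m + 4" using 3 by (intro that[of "n - 4"]) simp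
    ultimately show ?thesis using 3
      by (simp add: weight_def fact_numeral divide_simps) (simp add: algebra_simps)
  next
    case 4
    have "{i. i < k \<and> odd (k - i)} = {1, 3}"
      using 4 by (intro set_eqI; unfold mem_Collect_eq insert_iff empty_iff; presburger)
    moreover obtain m where "n = m + 4" using 4 assms by (intro that[of "n - 4"]) simp
    ultimately show ?thesis using 4
      by (simp add: weight_def fact_numeral divide_simps) (simp add: algebra_simps)
  next
    case 5
    have "{i. i < k \<and> odd (k - i)} = {0, 2, 4}"
      using 5 by (intro set_eqI; unfold mem_Collect_eq insert_iff empty_iff; presburger)
    moreover obtain m where "n = m + 5" using 5 assms by (intro that[of "n - 5"]) simp
    ultimately show ?thesis using 5
      by (simp add: weight_def fact_numeral divide_simps) (simp add: algebra_simps)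
  next
    case 6
    have "weight n k i \<le> real (k + 1) / (2 * fact (k - 1)) * real (k - 1 choose i)"
      if "i < k" for i
    proof -
      have "weight n k i \<le> real (k + 1) / (2 * (fact i * fact (k - 1 - i)))"
      proof -
        have "real (n - k + 1) * 2 \<le> real (n - i) * real (n - i + 1)"
          using that assms by (intro mult_mono) auto
        moreover have "0 < real (n - i) * real (n - i + 1)" using that assms by auto
        ultimately have "real (n - k + 1) / (real (n - i) * real (n - i + 1)) \<le> 1 / 2"
          by (simp add: pos_divide_le_eq del: of_nat_add)
        then have "real (k + 1) / (fact i * fact (k - 1 - i)) *
            (real (n - k + 1) / (real (n - i) * real (n - i + 1))) \<le>
          real (k + 1) / (fact i * fact (k - 1 - i)) * (1 / 2)"
          by (intro mult_left_mono) auto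
        then show ?thesis
          by (simp add: weight_def mult_ac)
      qed
      also have "\<dots> = real (k + 1) / (2 * fact (k - 1)) * real (k - 1 choose i)"
        using that by (simp add: binomial_fact field_simps)
      finally show ?thesis .
    qed
    then have "(\<Sum>i | i < k \<and> odd (k - i). weight n k i) \<le>
      (\<Sum>i | i < k \<and> odd (k - i). real (k + 1) / (2 * fact (k - 1)) * real (k - 1 choose i))"
      by (intro sum_mono) auto
    also have "\<dots> \<le> (\<Sum>i\<le>k - 1. real (k + 1) / (2 * fact (k - 1)) * real (k - 1 choose i))"
      by (intro sum_mono2) auto
    also have "\<dots> = real (k + 1) / (2 * fact (k - 1)) * 2 ^ (k - 1)"
      unfolding sum_distrib_left[symmetric] of_nat_sum[symmetric] choose_row_sum by simp
    also have "\<dots> = real ((k + 1) * 2 ^ (k - 2)) / fact (k - 1)"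
    proof -
      have "k - 1 = Suc (k - 2)" using 6 by simp
      then have eq: "(2 :: real) ^ (k - 1) = 2 * 2 ^ (k - 2)" by simp
      show ?thesis unfolding eq of_nat_mult of_nat_power of_nat_numeral by simp
    qed
    also have "\<dots> \<le> 1"
    proof -
      have "real ((k + 1) * 2 ^ (k - 2)) \<le> real (fact (k - 1))"
        unfolding of_nat_le_iff by (rule six_le_fact[OF 6])
      then show ?thesis unfolding of_nat_fact by (simp only: divide_le_eq_1_pos fact_gt_zero)
    qed
    finally show ?thesis .
  qed
qed

text \<open>Each upper face is charged to its extension \<open>\<phi> U\<close>. A face
  \<open>W\<close> is charged at most once per rank of the removed node, and only for ranks
  \<open>i\<close> with \<open>Suc k - i\<close> odd; by \<open>sum_weight_le_1\<close> its total
  charge is at most its excess.\<close>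

lemma sum_excess_growth:
  assumes T: "finite T" "card T = Suc n" "\<forall>s\<in>T. s < t"
    and k: "Suc k \<le> n" "(Suc k, n) \<noteq> (2, 2)" "(Suc k, n) \<noteq> (3, 3)"
  shows "real (n - k) * (\<Sum>U\<in>upper_faces (Suc k) T. excess k t U) \<le>
    (\<Sum>U\<in>upper_faces (Suc (Suc k)) T. excess (Suc k) t U)"
proof -
  define x where "x = (\<lambda>U. Min (T - U))"
  define \<phi> where "\<phi> = (\<lambda>U. insert (x U) U)"
  define i where "i = (\<lambda>U. card {s \<in> \<phi> U. s < x U})"
  define F where "F = upper_faces (Suc k) T"
  define G where "G = upper_faces (Suc (Suc k)) T"
  have ext: "x U \<notin> U" "\<phi> U \<in> G" "i U < Suc k" "odd (Suc k - i U)" if "U \<in> F" for U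
    using upper_face_extension[OF T(1,2) that[unfolded F_def] k(1)]
    unfolding G_def i_def \<phi>_def x_def by blast+
  have fin: "finite F" "finite G" using T by (auto simp: F_def G_def)
  have nk: "real (n - k) = real (n - Suc k + 1)" using k by simp
  have "real (n - k) * (\<Sum>U\<in>F. excess k t U) = (\<Sum>U\<in>F. real (n - k) * excess k t U)"
    by (simp add: sum_distrib_left)
  also have "\<dots> \<le> (\<Sum>U\<in>F. weight n (Suc k) (i U) * excess (Suc k) t (\<phi> U))"
    unfolding F_def nk i_def \<phi>_def x_def by (intro sum_mono excess_extension[OF T _ k(1)])
  also have "\<dots> = (\<Sum>W\<in>G. \<Sum>U\<in>{U \<in> F. \<phi> U = W}. weight n (Suc k) (i U) * excess (Suc k) t (\<phi> U))"
    using ext(2) by (intro sum.group[symmetric] fin) auto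
  also have "\<dots> \<le> (\<Sum>W\<in>G. excess (Suc k) t W)"
  proof (intro sum_mono)
    fix W assume W: "W \<in> G"
    then have W': "finite W" "card W = Suc (Suc k)" "W \<subseteq> T"
      using T finite_subset by (auto simp: G_def upper_faces_def)
    have e0: "0 \<le> excess (Suc k) t W" using W' T by (intro excess_nonneg) auto
    have "(\<Sum>U\<in>{U \<in> F. \<phi> U = W}. weight n (Suc k) (i U)) =
        (\<Sum>j\<in>i ` {U \<in> F. \<phi> U = W}. weight n (Suc k) j)"
    proof (rule sum.reindex[symmetric, unfolded o_def])
      show "inj_on i {U \<in> F. \<phi> U = W}"
      proof (rule inj_onI)
        fix U V assume U: "U \<in> {U \<in> F. \<phi> U = W}" and V: "V \<in> {U \<in> F. \<phi> U = W}" and "i U = i V"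
        have xW: "x U \<in> W" "x V \<in> W" using U V by (auto simp: \<phi>_def)
        have less: "card {s \<in> W. s < a} < card {s \<in> W. s < b}" if "a < b" "a \<in> W" for a b
          using that W'(1) by (intro psubset_card_mono) auto
        have "card {s \<in> W. s < x U} = card {s \<in> W. s < x V}"
          using \<open>i U = i V\<close> U V by (simp add: i_def)
        then have "x U = x V"
          using less[of "x U" "x V"] less[of "x V" "x U"] xW by (cases "x U" "x V" rule: linorder_cases) auto
        moreover have "U = W - {x U}" "V = W - {x V}"
          using U V ext(1)[of U] ext(1)[of V] by (auto simp: \<phi>_def)
        ultimately show "U = V" by simp
      qed
    qed
    also have "\<dots> \<le> (\<Sum>j | j < Suc k \<and> odd (Suc k - j). weight n (Suc k) j)"
      using ext(3,4) by (intro sum_mono2) (auto simp: weight_def)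
    also have "\<dots> \<le> 1"
      using k by (intro sum_weight_le_1) auto
    finally have "(\<Sum>U\<in>{U \<in> F. \<phi> U = W}. weight n (Suc k) (i U)) * excess (Suc k) t W \<le> 1 * excess (Suc k) t W"
      using e0 by (rule mult_right_mono)
    then show "(\<Sum>U\<in>{U \<in> F. \<phi> U = W}. weight n (Suc k) (i U) * excess (Suc k) t (\<phi> U)) \<le> excess (Suc k) t W"
      by (simp add: sum_distrib_right)
  qed
  finally show ?thesis by (simp only: F_def G_def)
qed

section \<open>The two cases in which the weights are too large\<close>

text \<open>The case \<open>(2, 2)\<close> with denominators cleared: \<open>p\<close>,
  \<open>q\<close>, \<open>s\<close> are the gaps in \<open>u0 < u1 < u2 < t\<close>. Equality holds
  when all gaps are 1.\<close>

lemma volume_growth_2_int: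
  fixes p q s :: int
  assumes "1 \<le> p" "1 \<le> q" "1 \<le> s"
  shows "3 * (p + q) * (s * (s + p + q) - 2) \<le> p * q * (p + q) * (s * (s + q) * (s + p + q) - 3)"
proof -
  define X where "X = s * (s + p + q)"
  have "3 \<le> X"
    using mult_mono[of 1 s 3 "s + p + q"] assms by (simp add: X_def)
  have "3 * (X - 2) \<le> p * q * (X * (s + q) - 3)"
  proof (cases "s = 1 \<and> q = 1")
    case True
    have "3 * p \<le> p * (2 * p + 1)"
      using assms mult_left_mono[of 3 "2 * p + 1" p] by simp
    then show ?thesis using True by (simp add: X_def algebra_simps)
  next
    case False
    then have "3 \<le> s + q" using assms by auto
    then have "X * 3 \<le> X * (s + q)" using \<open>3 \<le> X\<close> by (intro mult_left_mono) auto
    moreover from calculation have "0 \<le> X * (s + q) - 3" using \<open>3 \<le> X\<close> by linarith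
    moreover have "1 \<le> p * q" using mult_mono[of 1 p 1 q] assms by simp
    ultimately have "1 * (X * (s + q) - 3) \<le> p * q * (X * (s + q) - 3)"
      by (intro mult_right_mono)
    moreover have "3 * (X - 2) \<le> 1 * (X * (s + q) - 3)"
      using \<open>X * 3 \<le> X * (s + q)\<close> by simp
    ultimately show ?thesis by (rule order.trans[rotated])
  qed
  then have "(p + q) * (3 * (X - 2)) \<le> (p + q) * (p * q * (X * (s + q) - 3))"
    using assms by (intro mult_left_mono) auto
  then show ?thesis unfolding X_def by (simp only: mult_ac)
qed

text \<open>The case \<open>(3, 3)\<close> with denominators cleared: \<open>p\<close>,
  \<open>q\<close>, \<open>r\<close>, \<open>s\<close> are the gaps in
  \<open>u0 < u1 < u2 < u3 < t\<close>, and \<open>a\<close>, \<open>b\<close>, \<open>c\<close> the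
  distances of \<open>u0\<close>, \<open>u1\<close>, \<open>u2\<close> to \<open>t\<close>. Again
  equality holds when all gaps are 1.\<close>

lemma volume_growth_3_int:
  fixes p q r s :: int
  assumes "1 \<le> p" "1 \<le> q" "1 \<le> r" "1 \<le> s"
  defines "c \<equiv> s + r"
  defines "b \<equiv> c + q"
  defines "a \<equiv> b + p"
  shows "4 * p * (p + q + r) * (q + r) * (a * b * s - 3) + 4 * q * (q + r) * r * (b * c * s - 3) \<le>
    p * (p + q) * (p + q + r) * q * (q + r) * r * (a * b * c * s - 4)"
proof -
  define K where "K = p * (p + q + r)"
  define Q where "Q = q * r"
  define Z where "Z = a * b * s"
  define Y where "Y = b * c * s"
  define M where "M = a * b * c * s - 4"
  have abc: "2 \<le> c" "3 \<le> b" "4 \<le> a" using assms by (simp_all add: a_def b_def c_def)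
  have "3 \<le> K" using mult_mono[of 1 p 3 "p + q + r"] assms by (simp add: K_def)
  have "12 \<le> Z" using mult_mono[of 12 "a * b" 1 s] mult_mono[of 4 a 3 b] abc assms by (simp add: Z_def)
  have "6 \<le> Y" using mult_mono[of 6 "b * c" 1 s] mult_mono[of 3 b 2 c] abc assms by (simp add: Y_def)
  have "Z * c = M + 4" "a * Y = M + 4" by (simp_all add: M_def Z_def Y_def)
  moreover have "Z * 2 \<le> Z * c" "4 * Y \<le> a * Y"
    using abc \<open>12 \<le> Z\<close> \<open>6 \<le> Y\<close> by (auto intro!: mult_left_mono mult_right_mono)
  ultimately have "Z * 2 \<le> M + 4" "4 * Y \<le> M + 4" by simp_all
  then have MZ: "4 * (Z - 3) \<le> 2 * M" and MY: "4 * (Y - 3) \<le> M - 8" by simp_all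
  have "0 \<le> M" using MZ \<open>12 \<le> Z\<close> by simp
  have "1 \<le> Q" using mult_mono[of 1 q 1 r] assms by (simp add: Q_def)
  \<comment> \<open>The common factor \<open>q + r\<close> is left out. Crude bounds suffice if
    \<open>Q\<close> or \<open>p\<close> is at least 2; only \<open>Q = p = 1\<close> needs the
    actual values.\<close>
  have main: "K * (4 * (Z - 3)) + Q * (4 * (Y - 3)) \<le> K * (p + q) * Q * M"
  proof (cases "Q = 1")
    case False
    then have "2 \<le> Q" using \<open>1 \<le> Q\<close> by simp
    define A where "A = K * Q"
    have "3 * Q \<le> A" "K * 2 \<le> A" "K * 2 * Q = A + A"
      using \<open>3 \<le> K\<close> \<open>2 \<le> Q\<close> unfolding A_def by (auto intro!: mult_right_mono mult_left_mono)
    then have "2 * K + Q \<le> K * 2 * Q" using \<open>2 \<le> Q\<close> by linarith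
    also have "\<dots> \<le> K * (p + q) * Q"
      using assms \<open>3 \<le> K\<close> \<open>1 \<le> Q\<close> by (intro mult_right_mono mult_left_mono) auto
    finally have "(2 * K + Q) * M \<le> K * (p + q) * Q * M"
      using \<open>0 \<le> M\<close> by (rule mult_right_mono)
    moreover have "K * (4 * (Z - 3)) \<le> K * (2 * M)" "Q * (4 * (Y - 3)) \<le> Q * M"
      using MZ MY \<open>3 \<le> K\<close> \<open>1 \<le> Q\<close> by (auto intro!: mult_left_mono)
    ultimately show ?thesis by (simp add: algebra_simps)
  next
    case True
    then have qr: "q = 1" "r = 1"
      using assms by (auto simp: Q_def zmult_eq_1_iff)
    show ?thesis
    proof (cases "p = 1")
      case False
      then have "K * 3 * M \<le> K * (p + q) * M"
        using assms qr \<open>3 \<le> K\<close> \<open>0 \<le> M\<close> by (intro mult_right_mono mult_left_mono) auto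
      moreover have "K * (4 * (Z - 3)) \<le> K * (2 * M)"
        using MZ \<open>3 \<le> K\<close> by (intro mult_left_mono) auto
      moreover have "1 * M \<le> K * M" using \<open>3 \<le> K\<close> \<open>0 \<le> M\<close> by (intro mult_right_mono) auto
      ultimately show ?thesis using True MY by (simp add: algebra_simps)
    next
      case p: True
      have vals: "K = 3" "Z = s * (s + 2) * (s + 3)" "Y = s * (s + 1) * (s + 2)"
        "M = s * (s + 1) * (s + 2) * (s + 3) - 4"
        by (simp_all add: K_def Z_def Y_def M_def a_def b_def c_def p qr mult_ac add_ac)
      show ?thesis
      proof (cases "s = 1")
        case True
        then show ?thesis using \<open>Q = 1\<close> by (simp add: vals p qr)
      next
        case False
        then have "2 \<le> s" using assms by simp
        then have "4 * (s + 1) \<le> 6 * (s + 3) * 1" by simp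
        also have "\<dots> \<le> 6 * (s + 3) * (s - 1)"
          using \<open>2 \<le> s\<close> by (intro mult_left_mono) auto
        finally have "4 * (s + 1) \<le> 6 * (s + 3) * (s - 1)" .
        then have "s * (s + 2) * (4 * (s + 1)) \<le> s * (s + 2) * (6 * (s + 3) * (s - 1))"
          using \<open>2 \<le> s\<close> by (intro mult_left_mono) auto
        then show ?thesis using \<open>Q = 1\<close> by (simp add: vals p qr algebra_simps)
      qed
    qed
  qed
  have "(q + r) * (K * (4 * (Z - 3)) + Q * (4 * (Y - 3))) \<le> (q + r) * (K * (p + q) * Q * M)"
    using main assms by (intro mult_left_mono) auto
  also have "(q + r) * (K * (4 * (Z - 3)) + Q * (4 * (Y - 3))) =
      4 * p * (p + q + r) * (q + r) * (a * b * s - 3) + 4 * q * (q + r) * r * (b * c * s - 3)"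
    unfolding K_def Q_def Z_def Y_def by algebra
  also have "(q + r) * (K * (p + q) * Q * M) =
      p * (p + q) * (p + q + r) * q * (q + r) * r * (a * b * c * s - 4)"
    unfolding K_def Q_def M_def by algebra
  finally show ?thesis .
qed

lemma upper_faces_self:
  assumes "finite W" "card W = k"
  shows "upper_faces k W = {W}"
  using assms by (auto simp: upper_faces_def node_poly_eq_0_iff dest: card_subset_eq)
    (auto simp: node_poly_eq_0_iff[symmetric] simp del: node_poly_eq_0_iff)

lemma top_element:
  assumes "finite T" "card T = Suc n"
  obtains u S where "T = insert u S" "finite S" "card S = n" "\<forall>s\<in>S. s < (u::int)"
proof -
  have "T \<noteq> {}" using assms by auto
  then have "Max T \<in> T" using assms by simp
  moreover have "s < Max T" if "s \<in> T - {Max T}" for s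
    using that assms by (simp add: less_le)
  ultimately show ?thesis using assms by (intro that[of "Max T" "T - {Max T}"]) auto
qed

lemma vandermonde_insert_top:
  assumes "finite W" "\<forall>w\<in>W. w < t"
  shows "vandermonde (insert t W) = vandermonde W * poly (node_poly W) (of_int t)"
  using vandermonde_insert[of W t] node_poly_pos_above[of W t] assms by auto

lemma sum_excess_growth_2:
  assumes T: "finite T" "card T = 3" "\<forall>s\<in>T. s < t"
  shows "(\<Sum>U\<in>upper_faces 2 T. excess 1 t U) \<le> (\<Sum>U\<in>upper_faces 3 T. excess 2 t U)"
proof -
  have "card T = Suc 2" using T by simp
  then obtain u2 T2 where T2: "T = insert u2 T2" "finite T2" "card T2 = 2" "\<forall>s\<in>T2. s < u2"
    by (rule top_element[OF T(1)])
  have "card T2 = Suc 1" using T2 by simp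
  then obtain u1 T1 where T1: "T2 = insert u1 T1" "finite T1" "card T1 = 1" "\<forall>s\<in>T1. s < u1"
    by (rule top_element[OF T2(2)])
  obtain u0 where u0: "T1 = {u0}" using T1 by (auto simp: card_1_singleton_iff)
  have lt: "u0 < u1" "u1 < u2" "u2 < t" using T T1 T2 u0 by auto
  have "lower_faces 1 {u0, u1} = {{u0}}"
    using lower_faces_1[of "{u0, u1}"] lt by (simp add: min_def)
  then have "(\<Sum>U\<in>upper_faces 2 T. excess 1 t U) = excess 1 t {u2, u0}"
    using sum_upper_faces_insert_top[OF T2(2,4), of "excess 1 t" 1]
    by (simp add: T2(1) T1(1) u0 insert_commute numeral_2_eq_2)
  moreover have "upper_faces 3 T = {{u2, u1, u0}}"
    using upper_faces_self[OF T(1,2)] by (simp add: T2(1) T1(1) u0)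
  moreover have "excess 1 t {u2, u0} \<le> excess 2 t {u2, u1, u0}"
  proof -
    define p q s where "p = u1 - u0" and "q = u2 - u1" and "s = t - u2"
    have "3 * (p + q) * (s * (s + p + q) - 2) \<le> p * q * (p + q) * (s * (s + q) * (s + p + q) - 3)"
      using lt by (intro volume_growth_2_int) (auto simp: p_def q_def s_def)
    then have "real_of_int (3 * (p + q) * (s * (s + p + q) - 2)) \<le>
        real_of_int (p * q * (p + q) * (s * (s + q) * (s + p + q) - 3))"
      by (simp only: of_int_le_iff)
    then have "(real_of_int (3 * (p + q) * (s * (s + p + q) - 2))) / 6 \<le>
        real_of_int (p * q * (p + q) * (s * (s + q) * (s + p + q) - 3)) / 6"
      by (rule divide_right_mono) simp
    moreover have u: "u2 = u0 + p + q" "u1 = u0 + p" "t = u0 + p + q + s"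
      by (auto simp: p_def q_def s_def)
    have "vandermonde {u2, u0} = p + q" "vandermonde {u2, u1, u0} = p * (p + q) * q"
      "poly (node_poly {u2, u0}) t = s * (s + p + q)"
      "poly (node_poly {u2, u1, u0}) t = s * (s + q) * (s + p + q)"
      using lt by (simp_all add: vandermonde_insert_top poly_node_poly_insert) (simp_all add: u algebra_simps)
    ultimately show ?thesis
      unfolding excess_def by (simp add: field_simps)
  qed
  ultimately show ?thesis by simp
qed

lemma sum_excess_growth_3:
  assumes T: "finite T" "card T = 4" "\<forall>s\<in>T. s < t"
  shows "(\<Sum>U\<in>upper_faces 3 T. excess 2 t U) \<le> (\<Sum>U\<in>upper_faces 4 T. excess 3 t U)"
proof -
  have "card T = Suc 3" using T by simp
  then obtain u3 T3 where T3: "T = insert u3 T3" "finite T3" "card T3 = 3" "\<forall>s\<in>T3. s < u3"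
    by (rule top_element[OF T(1)])
  have "card T3 = Suc 2" using T3 by simp
  then obtain u2 T2 where T2: "T3 = insert u2 T2" "finite T2" "card T2 = 2" "\<forall>s\<in>T2. s < u2"
    by (rule top_element[OF T3(2)])
  have "card T2 = Suc 1" using T2 by simp
  then obtain u1 T1 where T1: "T2 = insert u1 T1" "finite T1" "card T1 = 1" "\<forall>s\<in>T1. s < u1"
    by (rule top_element[OF T2(2)])
  obtain u0 where u0: "T1 = {u0}" using T1 by (auto simp: card_1_singleton_iff)
  have lt: "u0 < u1" "u1 < u2" "u2 < u3" "u3 < t" using T T1 T2 T3 u0 by auto
  have T2': "T2 = {u0, u1}" using T1 u0 by auto
  have "lower_faces 2 T2 = {T2}"
    using T2 by (intro lower_faces_self) auto
  moreover have "upper_faces 1 T2 = {{u1}}"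
    using upper_faces_1[of T2] lt by (simp add: T2' max_def)
  ultimately have "(\<Sum>U\<in>lower_faces 2 T3. g U) = g {u0, u1} + g {u2, u1}" for g :: "int set \<Rightarrow> real"
    using sum_lower_faces_insert_top[OF T2(2,4), of g 1] by (simp add: T2(1) T2' numeral_2_eq_2)
  then have "(\<Sum>U\<in>upper_faces 3 T. excess 2 t U) = excess 2 t {u3, u1, u0} + excess 2 t {u3, u2, u1}"
    using sum_upper_faces_insert_top[OF T3(2,4), of "excess 2 t" 2]
    by (simp add: T3(1) insert_commute numeral_3_eq_3 numeral_2_eq_2)
  moreover have "upper_faces 4 T = {{u3, u2, u1, u0}}"
    using upper_faces_self[OF T(1,2)] by (simp add: T3(1) T2(1) T1(1) u0)
  moreover have "excess 2 t {u3, u1, u0} + excess 2 t {u3, u2, u1} \<le> excess 3 t {u3, u2, u1, u0}"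
  proof -
    define p q r s where "p = u1 - u0" and "q = u2 - u1" and "r = u3 - u2" and "s = t - u3"
    define v1 v2 v where "v1 = p * (p + q + r) * (q + r)" and "v2 = q * (q + r) * r"
      and "v = p * (p + q) * (p + q + r) * q * (q + r) * r"
    define a1 a2 a where "a1 = (s + r + q + p) * (s + r + q) * s" and "a2 = (s + r + q) * (s + r) * s"
      and "a = (s + r + q + p) * (s + r + q) * (s + r) * s"
    have "4 * p * (p + q + r) * (q + r) * ((s + r + q + p) * (s + r + q) * s - 3) +
        4 * q * (q + r) * r * ((s + r + q) * (s + r) * s - 3) \<le>
      p * (p + q) * (p + q + r) * q * (q + r) * r * ((s + r + q + p) * (s + r + q) * (s + r) * s - 4)"
      using lt by (intro volume_growth_3_int) (auto simp: p_def q_def r_def s_def)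
    then have "4 * v1 * (a1 - 3) + 4 * v2 * (a2 - 3) \<le> v * (a - 4)"
      by (simp only: v1_def v2_def v_def a1_def a2_def a_def mult.assoc)
    then have "real_of_int (4 * v1 * (a1 - 3) + 4 * v2 * (a2 - 3)) \<le> real_of_int (v * (a - 4))"
      by (simp only: of_int_le_iff)
    moreover have u: "u3 = u0 + p + q + r" "u2 = u0 + p + q" "u1 = u0 + p" "t = u0 + p + q + r + s"
      by (auto simp: p_def q_def r_def s_def)
    have vals: "vandermonde {u3, u1, u0} = v1" "vandermonde {u3, u2, u1} = v2"
      "vandermonde {u3, u2, u1, u0} = v"
      "poly (node_poly {u3, u1, u0}) t = a1" "poly (node_poly {u3, u2, u1}) t = a2"
      "poly (node_poly {u3, u2, u1, u0}) t = a"
      unfolding v1_def v2_def v_def a1_def a2_def a_def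
      using lt by (simp_all add: vandermonde_insert_top poly_node_poly_insert) (simp_all add: u algebra_simps)
    ultimately show ?thesis
      unfolding excess_def vals by (simp add: fact_numeral field_simps)
  qed
  ultimately show ?thesis by simp
qed

subsection \<open>Real-rooted polynomials with nonnegative coefficients\<close>

lemma map_poly_of_real_add:
  "map_poly of_real (p + q) = map_poly (of_real :: real \<Rightarrow> complex) p + map_poly of_real q"
  by (rule poly_eqI) (simp add: coeff_map_poly)

lemma map_poly_of_real_mult:
  "map_poly of_real (p * q) = map_poly (of_real :: real \<Rightarrow> complex) p * map_poly of_real q"
  by (rule poly_eqI) (simp add: coeff_map_poly coeff_mult)

lemma poly_map_poly_of_real:
  "poly (map_poly of_real p) (of_real x) = (of_real (poly p x) :: complex)"
  by (induction p) (auto simp: map_poly_pCons)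

lemma poly_map_poly_cnj:
  "poly (map_poly of_real p) (cnj z) = cnj (poly (map_poly of_real p) z)"
  by (induction p) (auto simp: map_poly_pCons)

lemma real_rooted_dvd:
  assumes "real_rooted p" "q dvd p"
  shows "real_rooted q"
  using assms unfolding real_rooted_def
  by (auto simp: map_poly_of_real_mult elim!: dvdE)

text \<open>Asked of all \<open>i < j\<close> and not only of neighbours: this rules out internal
  zeros, and it is preserved by multiplication with \<open>x + r\<close> for
  \<open>r \<ge> 0\<close>.\<close>

definition strongly_log_concave :: "(nat \<Rightarrow> real) \<Rightarrow> bool" where
  "strongly_log_concave a \<longleftrightarrow>
    (\<forall>i. 0 \<le> a i) \<and> (\<forall>i j. i < j \<longrightarrow> a i * a (Suc j) \<le> a (Suc i) * a j)"

lemma strongly_log_concave_linear_mult: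
  assumes p: "strongly_log_concave (coeff p)" and r: "0 \<le> r"
  shows "strongly_log_concave (coeff ([:r, 1:] * p))"
proof -
  define a where "a = coeff p"
  have a0: "0 \<le> a i" for i using p by (auto simp: strongly_log_concave_def a_def)
  have lc: "a i * a (Suc j) \<le> a (Suc i) * a j" if "i < j" for i j
    using p that by (auto simp: strongly_log_concave_def a_def)
  define e where "e = (\<lambda>i. if i = 0 then 0 else a (i - 1))"
  have e0: "0 \<le> e i" for i by (simp add: e_def a0)
  have b: "coeff ([:r, 1:] * p) i = e i + r * a i" for i
    by (cases i) (simp_all add: e_def a_def)
  have eS: "e (Suc i) = a i" for i by (simp add: e_def)
  have elc: "e i * a j \<le> a i * e j" if "i < j" for i j
    using that lc[of "i - 1" "j - 1"] by (cases i; cases j) (auto simp: e_def a0)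
  have "(e i + r * a i) * (a j + r * a (Suc j)) \<le> (a i + r * a (Suc i)) * (e j + r * a j)"
    if "i < j" for i j
  proof -
    have 1: "e i * a j \<le> a i * e j" using elc that .
    have 2: "a i * a (Suc j) \<le> a (Suc i) * a j" using lc that .
    have 3: "e i * a (Suc j) \<le> a (Suc i) * e j"
    proof -
      have "e i * a (Suc j) \<le> a i * a j"
        using elc[of i "Suc j"] that by (simp add: eS)
      also have "\<dots> \<le> a (Suc i) * e j"
        using that lc[of i "j - 1"] by (cases "j = Suc i") (auto simp: e_def mult.commute)
      finally show ?thesis .
    qed
    have "r * (e i * a (Suc j)) \<le> r * (a (Suc i) * e j)"
      "r * r * (a i * a (Suc j)) \<le> r * r * (a (Suc i) * a j)"
      using 2 3 r by (auto intro!: mult_left_mono)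
    with 1 show ?thesis by (simp add: algebra_simps)
  qed
  then show ?thesis
    unfolding strongly_log_concave_def b eS by (auto simp: a0 e0 r)
qed

text \<open>All roots are real and none is positive, so factors \<open>x + r\<close> with
  \<open>r \<ge> 0\<close> can be split off one by one.\<close>

lemma real_rooted_strongly_log_concave:
  assumes "real_rooted p" "lead_coeff p > 0" "\<And>x. x > 0 \<Longrightarrow> poly p x \<noteq> 0"
  shows "strongly_log_concave (coeff p)"
  using assms
proof (induction "degree p" arbitrary: p)
  case 0
  then obtain c where "p = [:c:]"
    by (metis degree_eq_zeroE)
  with 0 show ?case
    by (auto simp: strongly_log_concave_def coeff_pCons split: nat.splits)
next
  case (Suc n)
  have "degree (map_poly (of_real :: real \<Rightarrow> complex) p) > 0"
    using Suc.hyps by (subst degree_map_poly) auto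
  then obtain z where z: "poly (map_poly of_real p) (z :: complex) = 0"
    using alg_closed_imp_poly_has_root by blast
  then obtain x where x: "z = of_real x"
    using Suc.prems(1) by (auto simp: real_rooted_def elim: Reals_cases)
  with z have px: "poly p x = 0"
    by (simp add: poly_map_poly_of_real)
  then have "x \<le> 0" using Suc.prems(3)[of x] by linarith
  from px obtain q where q: "p = [:-x, 1:] * q"
    by (metis dvdE poly_eq_0_iff_dvd)
  have "q \<noteq> 0" using Suc.prems(2) q by auto
  then have "degree p = Suc (degree q)"
    unfolding q by (subst degree_mult_eq) auto
  moreover have "lead_coeff q > 0"
    using Suc.prems(2) unfolding q by (simp add: lead_coeff_mult del: mult_pCons_left)
  moreover have "real_rooted q"
    using Suc.prems(1) q real_rooted_dvd by (metis dvd_triv_right)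
  moreover have "poly q y \<noteq> 0" if "y > 0" for y
    using Suc.prems(3)[OF that] q by auto
  ultimately have "strongly_log_concave (coeff q)"
    using Suc.hyps by simp
  then show ?case
    using strongly_log_concave_linear_mult[of q "-x"] \<open>x \<le> 0\<close> q by simp
qed

text \<open>Let \<open>k\<close> attain the maximum on \<open>{..d}\<close>. A wrong step at
  \<open>i\<close>, compared with a step next to \<open>k\<close>, contradicts the defining
  inequality.\<close>

lemma strongly_log_concave_imp_unimodal:
  assumes "strongly_log_concave a"
  shows "unimodal_seq d a"
proof -
  have a0: "0 \<le> a i" for i using assms by (auto simp: strongly_log_concave_def)
  have lc: "a i * a (Suc j) \<le> a (Suc i) * a j" if "i < j" for i j
    using assms that by (auto simp: strongly_log_concave_def)
  obtain k where k: "k \<le> d" "\<And>i. i \<le> d \<Longrightarrow> a i \<le> a k"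
  proof -
    have "Max (a ` {..d}) \<in> a ` {..d}" by (intro Max_in) auto
    then obtain k where "k \<in> {..d}" "Max (a ` {..d}) = a k" by (elim imageE)
    moreover have "a i \<le> Max (a ` {..d})" if "i \<le> d" for i
      using that by (intro Max_ge) auto
    ultimately show ?thesis using that by (metis atMost_iff)
  qed
  have left: "a i \<le> a (Suc i)" if "i < k" for i
  proof (rule ccontr)
    assume less: "\<not> a i \<le> a (Suc i)"
    then have "Suc i \<noteq> k" using k that by auto
    then have "a i * a (Suc (k - 1)) \<le> a (Suc i) * a (k - 1)"
      using that by (intro lc) auto
    also have "\<dots> \<le> a (Suc i) * a k"
      using k by (intro mult_left_mono a0) auto
    finally have "a i * a k \<le> a (Suc i) * a k" using that by simp
    moreover have "a k > 0" using k(2)[of i] less a0[of "Suc i"] that k(1) by auto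
    ultimately show False using less by auto
  qed
  have right: "a (Suc i) \<le> a i" if "k \<le> i" "i < d" for i
  proof (rule ccontr)
    assume less: "\<not> a (Suc i) \<le> a i"
    then have "k < i" using k that by (metis Suc_leI le_neq_implies_less)
    then have "a k * a (Suc i) \<le> a (Suc k) * a i" by (rule lc)
    also have "\<dots> \<le> a k * a i"
      using k(2)[of "Suc k"] \<open>k < i\<close> that by (intro mult_right_mono a0) auto
    finally have "a k * a (Suc i) \<le> a k * a i" .
    moreover have "a k > 0" using k(2)[of "Suc i"] less a0[of i] that by auto
    ultimately show False using less by auto
  qed
  show ?thesis
    unfolding unimodal_seq_def using a0 k left right by auto
qed

lemma strongly_log_concave_imp_log_concave:
  assumes "strongly_log_concave a"
  shows "log_concave_seq d a"
proof -
  have "a (i - 1) * a (i + 1) \<le> (a i)\<^sup>2" if "0 < i" for i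
    using assms[unfolded strongly_log_concave_def, THEN conjunct2, rule_format, of "i - 1" i] that
    by (simp add: power2_eq_square)
  then show ?thesis
    using assms by (auto simp: log_concave_seq_def strongly_log_concave_def)
qed

subsection \<open>Refined Eulerian polynomials\<close>

text \<open>For \<open>i \<le> d\<close>: permutations of \<open>d + 1\<close> letters with first
  letter \<open>i + 1\<close>, counted by descents. The recursion reads off the rank
  \<open>j\<close> of the second letter, with a descent if \<open>j < i\<close>.\<close>

primrec refined_eulerian :: "nat \<Rightarrow> nat \<Rightarrow> real poly" where
  "refined_eulerian 0 i = 1"
| "refined_eulerian (Suc d) i =
    (\<Sum>j=i..d. refined_eulerian d j) + [:0, 1:] * (\<Sum>j<i. refined_eulerian d j)"

lemma coeff_refined_eulerian_nonneg: "0 \<le> coeff (refined_eulerian d i) n"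
proof (induction d arbitrary: i n)
  case (Suc d)
  have "0 \<le> coeff (\<Sum>j\<in>A. refined_eulerian d j) n" for A n
    by (simp add: coeff_sum sum_nonneg Suc)
  then show ?case
    by (simp add: coeff_pCons split: nat.splits)
qed (auto simp: coeff_1)

lemma sum_magic_basis_lessThan:
  fixes x :: real
  assumes "i \<le> Suc d"
  shows "(\<Sum>j<i. x ^ j * (x + 1) ^ (d - j)) = (x + 1) ^ Suc d - x ^ i * (x + 1) ^ (Suc d - i)"
  using assms
proof (induction i)
  case (Suc i)
  then have "Suc d - i = Suc (d - i)" by simp
  with Suc show ?case by (simp add: algebra_simps)
qed simp

lemma sum_magic_basis_atLeast:
  fixes x :: real
  assumes "i \<le> Suc d"
  shows "(\<Sum>j=i..d. x ^ j * (x + 1) ^ (d - j)) = x ^ i * (x + 1) ^ (Suc d - i) - x ^ Suc d"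
proof -
  have split: "{..<Suc d} = {..<i} \<union> {i..d}" using assms by auto
  have "(\<Sum>j<Suc d. x ^ j * (x + 1) ^ (d - j)) =
      (\<Sum>j<i. x ^ j * (x + 1) ^ (d - j)) + (\<Sum>j=i..d. x ^ j * (x + 1) ^ (d - j))"
    unfolding split by (rule sum.union_disjoint) auto
  then show ?thesis
    unfolding sum_magic_basis_lessThan[OF assms] sum_magic_basis_lessThan[OF order_refl]
    by simp
qed

text \<open>Multiplication by \<open>1 - fps_X\<close> takes differences of consecutive coefficients
  \<open>m ^ i * (m + 1) ^ (Suc d - i)\<close>. Such a difference splits at \<open>m ^ Suc d\<close>
  into the two geometric sums behind the recursion.\<close>

lemma fps_of_poly_refined_eulerian:
  assumes "i \<le> d"
  shows "fps_of_poly (refined_eulerian d i) =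
    (1 - fps_X) ^ (d + 1) * Abs_fps (\<lambda>m. real m ^ i * (real m + 1) ^ (d - i))"
  using assms
proof (induction d arbitrary: i)
  case 0
  have "(1 - fps_X) * Abs_fps (\<lambda>m. 1::real) = 1"
    by (rule fps_ext) (simp add: left_diff_distrib)
  then show ?case using 0 by simp
next
  case (Suc d)
  define G where "G = Abs_fps (\<lambda>m. real m ^ i * (real m + 1) ^ (Suc d - i))"
  define A where "A = Abs_fps (\<lambda>m. \<Sum>j=i..d. real m ^ j * (real m + 1) ^ (d - j))"
  define B where "B = Abs_fps (\<lambda>m. \<Sum>j<i. real m ^ j * (real m + 1) ^ (d - j))"
  have sums: "(\<Sum>j\<in>J. fps_of_poly (refined_eulerian d j)) =
      (1 - fps_X) ^ (d + 1) * Abs_fps (\<lambda>m. \<Sum>j\<in>J. real m ^ j * (real m + 1) ^ (d - j))"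
    if "J \<subseteq> {..d}" for J
  proof -
    have "(\<Sum>j\<in>J. fps_of_poly (refined_eulerian d j)) =
        (\<Sum>j\<in>J. (1 - fps_X) ^ (d + 1) * Abs_fps (\<lambda>m. real m ^ j * (real m + 1) ^ (d - j)))"
      using that Suc.IH by (intro sum.cong) auto
    also have "\<dots> = (1 - fps_X) ^ (d + 1) *
        (\<Sum>j\<in>J. Abs_fps (\<lambda>m. real m ^ j * (real m + 1) ^ (d - j)))"
      by (simp add: sum_distrib_left)
    also have "(\<Sum>j\<in>J. Abs_fps (\<lambda>m. real m ^ j * (real m + 1) ^ (d - j))) =
        Abs_fps (\<lambda>m. \<Sum>j\<in>J. real m ^ j * (real m + 1) ^ (d - j))"
      by (rule fps_ext) (simp add: fps_sum_nth)
    finally show ?thesis .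
  qed
  have AB: "A + fps_X * B = (1 - fps_X) * G"
  proof (rule fps_ext)
    fix n
    show "fps_nth (A + fps_X * B) n = fps_nth ((1 - fps_X) * G) n"
      unfolding A_def B_def G_def sum_magic_basis_lessThan[OF Suc.prems]
        sum_magic_basis_atLeast[OF Suc.prems]
      by (cases n) (simp_all add: left_diff_distrib algebra_simps)
  qed
  have "fps_of_poly (refined_eulerian (Suc d) i) =
      (1 - fps_X) ^ (d + 1) * A + fps_X * ((1 - fps_X) ^ (d + 1) * B)"
    using Suc.prems sums[of "{i..d}"] sums[of "{..<i}"]
    by (simp add: fps_of_poly_add fps_of_poly_mult fps_of_poly_sum A_def B_def fps_of_poly_pCons
        subset_iff del: mult_pCons_left)
  also have "\<dots> = (1 - fps_X) ^ (d + 1) * (A + fps_X * B)"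
    by (simp add: algebra_simps)
  finally show ?case
    unfolding AB G_def by (simp add: mult_ac)
qed

subsection \<open>Zeros in the upper half-plane\<close>

text \<open>The determinant of \<open>u\<close> and \<open>v\<close> as plane vectors.\<close>

definition cross :: "complex \<Rightarrow> complex \<Rightarrow> real" where
  "cross u v = Im (cnj u * v)"

lemma cross_add_left: "cross (u + v) w = cross u w + cross v w"
  by (simp add: cross_def algebra_simps)

lemma cross_add_right: "cross u (v + w) = cross u v + cross u w"
  by (simp add: cross_def algebra_simps)

lemma cross_self: "cross u u = 0"
  by (simp add: cross_def)

lemma cross_swap: "cross u v = - cross v u"
  by (simp add: cross_def)

lemma cross_mult: "cross (z * u) (z * v) = (cmod z)\<^sup>2 * cross u v"
  by (simp add: cross_def cmod_def algebra_simps power2_eq_square)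

lemma cross_self_mult: "cross u (z * u) = (cmod u)\<^sup>2 * Im z"
  by (simp add: cross_def cmod_def algebra_simps power2_eq_square)

lemma cross_of_real_right: "cross u (of_real a * v) = a * cross u v"
  by (simp add: cross_def algebra_simps)

lemma cross_of_real_left: "cross (of_real a * u) v = a * cross u v"
  by (simp add: cross_def algebra_simps)

lemma cross_sum_right: "cross u (\<Sum>i\<in>A. f i) = (\<Sum>i\<in>A. cross u (f i))"
  by (simp add: cross_def sum_distrib_left)

lemma cross_sum_left: "cross (\<Sum>i\<in>A. f i) u = (\<Sum>i\<in>A. cross (f i) u)"
  by (simp add: cross_def sum_distrib_right)

lemma cone_coordinates:
  assumes "Im z > 0" "u \<noteq> 0" "cross u v \<ge> 0" "cross v (z * u) \<ge> 0"
  obtains a b where "0 \<le> a" "0 \<le> b" "v = (of_real a + of_real b * z) * u"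
proof -
  define w where "w = v / u"
  have v: "v = w * u" using assms(2) by (simp add: w_def)
  have pos: "(cmod u)\<^sup>2 > 0" using assms(2) by simp
  have "cross u v = (cmod u)\<^sup>2 * Im w"
    unfolding v by (rule cross_self_mult)
  then have w1: "Im w \<ge> 0" using assms(3) pos by (simp add: zero_le_mult_iff)
  have "cross v (z * u) = (cmod u)\<^sup>2 * (Re w * Im z - Im w * Re z)"
    unfolding v by (simp add: cross_def cmod_def algebra_simps power2_eq_square)
  then have w2: "Re w * Im z - Im w * Re z \<ge> 0"
    using assms(4) pos by (simp add: zero_le_mult_iff)
  define b where "b = Im w / Im z"
  define a where "a = (Re w * Im z - Im w * Re z) / Im z"
  have "w = of_real a + of_real b * z"
    using assms(1) by (intro complex_eqI) (simp_all add: a_def b_def field_simps)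
  moreover have "0 \<le> a" "0 \<le> b" using w1 w2 assms(1) by (auto simp: a_def b_def)
  ultimately show ?thesis using v that by blast
qed

text \<open>In the basis \<open>u\<close>, \<open>z * u\<close> the vectors \<open>v\<close> and
  \<open>w\<close> have nonnegative coordinates \<open>(a, b)\<close> and \<open>(c, d)\<close>, and
  \<open>cross v w \<ge> 0\<close> says \<open>b * c \<le> a * d\<close>. After multiplication by
  \<open>d\<close>, completing the square shows the sign.\<close>

lemma cross_cone_rotate:
  assumes z: "Im z > 0" and u: "u \<noteq> 0"
    and v: "cross u v \<ge> 0" "cross v (z * u) \<ge> 0"
    and w: "cross u w \<ge> 0" "cross w (z * u) \<ge> 0"
    and vw: "cross v w \<ge> 0"
  shows "cross w (z * v) \<ge> 0"
proof -
  obtain a b where ab: "0 \<le> a" "0 \<le> b" "v = (of_real a + of_real b * z) * u"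
    using cone_coordinates[OF z u v] .
  obtain c d where cd: "0 \<le> c" "0 \<le> d" "w = (of_real c + of_real d * z) * u"
    using cone_coordinates[OF z u w] .
  define N where "N = (cmod u)\<^sup>2 * Im z"
  have N: "N > 0" using z u by (simp add: N_def)
  have "cross v w = N * (a * d - b * c)"
    unfolding ab cd N_def by (simp add: cross_def cmod_power2) algebra
  with vw N have le: "b * c \<le> a * d" by (simp add: zero_le_mult_iff)
  have eq: "cross w (z * v) = N * (c * a + 2 * Re z * (c * b) + d * b * ((Re z)\<^sup>2 + (Im z)\<^sup>2))"
    unfolding ab cd N_def by (simp add: cross_def cmod_power2) algebra
  have "0 \<le> c * a + 2 * Re z * (c * b) + d * b * ((Re z)\<^sup>2 + (Im z)\<^sup>2)"
  proof (cases "c * b = 0")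
    case True
    then show ?thesis using ab cd by auto
  next
    case False
    then have "c > 0" "b > 0" using ab cd by auto
    then have "d > 0" using le ab cd by (metis less_eq_real_def mult_pos_pos mult_zero_right not_le)
    have "d * (c * a + 2 * Re z * (c * b) + d * b * ((Re z)\<^sup>2 + (Im z)\<^sup>2)) =
      c * (a * d - b * c) + b * ((c + d * Re z)\<^sup>2 + (d * Im z)\<^sup>2)"
      by algebra
    also have "\<dots> \<ge> 0" using ab cd le by simp
    finally show ?thesis using \<open>d > 0\<close> by (simp add: zero_le_mult_iff)
  qed
  then show ?thesis unfolding eq using N by simp
qed

text \<open>
  \<open>cross u v \<ge> 0\<close> says that \<open>v\<close> comes after \<open>u\<close> in counterclockwise order. The values of the
  refined Eulerian polynomials at a point \<open>z\<close> of the upper half-plane are ordered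
  counterclockwise and fill an angle of at most \<open>arg z < \<pi>\<close>.
\<close>

definition counterclockwise :: "complex \<Rightarrow> nat \<Rightarrow> (nat \<Rightarrow> complex) \<Rightarrow> bool" where
  "counterclockwise z d f \<longleftrightarrow> f 0 \<noteq> 0 \<and>
    (\<forall>i j. i \<le> j \<and> j \<le> d \<longrightarrow> cross (f i) (f j) \<ge> 0 \<and> cross (f j) (z * f i) \<ge> 0)"

text \<open>The real linear form \<open>\<phi>\<close> is nonnegative on all \<open>f i\<close> and
  positive on \<open>f 0\<close>.\<close>

lemma counterclockwise_sum_nonzero:
  assumes f: "counterclockwise z d f" and z: "Im z > 0"
    and a: "\<And>i. i \<le> d \<Longrightarrow> 0 \<le> a i" "a 0 > 0"
  shows "(\<Sum>i\<le>d. of_real (a i) * f i) \<noteq> 0"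
proof
  define \<phi> where "\<phi> = (\<lambda>v. cross (f 0) v + cross v (z * f 0))"
  assume "(\<Sum>i\<le>d. of_real (a i) * f i) = 0"
  then have "\<phi> (\<Sum>i\<le>d. of_real (a i) * f i) = 0"
    by (simp add: \<phi>_def cross_def)
  moreover have "\<phi> (\<Sum>i\<le>d. of_real (a i) * f i) = (\<Sum>i\<le>d. a i * \<phi> (f i))"
    by (simp add: \<phi>_def cross_sum_left cross_sum_right cross_of_real_left cross_of_real_right
        sum.distrib distrib_left)
  moreover have "(\<Sum>i\<le>d. a i * \<phi> (f i)) > 0"
  proof (rule sum_pos2[of _ 0])
    show "0 < a 0 * \<phi> (f 0)"
      using f z a by (simp add: \<phi>_def cross_self cross_self_mult counterclockwise_def)
    show "0 \<le> a i * \<phi> (f i)" if "i \<in> {..d}" for i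
      using f that a(1)[of i] by (auto simp: \<phi>_def counterclockwise_def)
  qed auto
  ultimately show False by simp
qed

text \<open>With blocks \<open>a\<close>, \<open>b\<close>, \<open>c\<close> split at
  \<open>i\<close> and \<open>k\<close>, expansion leaves only nonnegative terms, as
  \<open>cross (z * a) c\<close> cancels against \<open>cross c (z * a)\<close>. Since
  \<open>g (Suc d) = z * g 0\<close>, all values lie in the cone of \<open>g 0\<close> and
  \<open>z * g 0\<close>, and \<open>cross_cone_rotate\<close> gives the second condition.\<close>

lemma counterclockwise_step:
  assumes f: "counterclockwise z d f" and z: "Im z > 0"
  defines "g \<equiv> \<lambda>i. (\<Sum>j=i..d. f j) + z * (\<Sum>j<i. f j)"
  shows "counterclockwise z (Suc d) g"
proof -
  have f1: "cross (f i) (f j) \<ge> 0" and f2: "cross (f j) (z * f i) \<ge> 0" if "i \<le> j" "j \<le> d" for i j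
    using f that by (auto simp: counterclockwise_def)
  have gg: "cross (g i) (g k) \<ge> 0" if "i \<le> k" "k \<le> Suc d" for i k
  proof -
    define a where "a = (\<Sum>j<i. f j)"
    define b where "b = (\<Sum>j=i..<k. f j)"
    define c where "c = (\<Sum>j=k..d. f j)"
    have split: "{i..d} = {i..<k} \<union> {k..d}" "{..<k} = {..<i} \<union> {i..<k}"
      using that by auto
    have "(\<Sum>j=i..d. f j) = b + c"
      unfolding b_def c_def split(1) by (rule sum.union_disjoint) auto
    moreover have "(\<Sum>j<k. f j) = a + b"
      unfolding a_def b_def split(2) by (rule sum.union_disjoint) auto
    ultimately have gi: "g i = (b + c) + z * a" and gk: "g k = c + z * (a + b)"
      by (simp_all add: g_def a_def c_def)
    have ab: "cross a b \<ge> 0" "cross a c \<ge> 0" "cross b c \<ge> 0"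
      "cross b (z * a) \<ge> 0" "cross c (z * a) \<ge> 0" "cross c (z * b) \<ge> 0"
      unfolding a_def b_def c_def using that
      by (auto simp: cross_sum_left cross_sum_right sum_distrib_left intro!: sum_nonneg f1 f2)
    have "cross (g i) (g k) = cross b c + cross b (z * a) + cross b (z * b)
       + cross c c + cross c (z * a) + cross c (z * b)
       + cross (z * a) c + cross (z * a) (z * a) + cross (z * a) (z * b)"
      unfolding gi gk by (simp add: cross_add_left cross_add_right distrib_left)
    also have "\<dots> = cross b c + cross b (z * a) + (cmod b)\<^sup>2 * Im z + cross c (z * b)
       + (cmod z)\<^sup>2 * cross a b"
      by (simp add: cross_self cross_self_mult cross_mult cross_swap[of "z * a" c])
    also have "\<dots> \<ge> 0" using ab z by simp
    finally show ?thesis .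
  qed
  have g0: "g 0 \<noteq> 0"
    using counterclockwise_sum_nonzero[OF f z, of "\<lambda>_. 1"] by (simp add: g_def atMost_atLeast0)
  have "g (Suc d) = z * g 0"
    by (simp add: g_def lessThan_Suc_atMost atMost_atLeast0)
  then have up: "cross (g i) (z * g 0) \<ge> 0" if "i \<le> Suc d" for i
    using gg[of i "Suc d"] that by simp
  show ?thesis
    unfolding counterclockwise_def
  proof (intro conjI allI impI; (elim conjE)?)
    show "g 0 \<noteq> 0" by (fact g0)
    show "cross (g i) (g j) \<ge> 0" if "i \<le> j" "j \<le> Suc d" for i j by (rule gg[OF that])
    show "cross (g j) (z * g i) \<ge> 0" if "i \<le> j" "j \<le> Suc d" for i j
      using that cross_cone_rotate[OF z g0 gg[of 0 i] up[of i] gg[of 0 j] up[of j] gg[of i j]]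
      by simp
  qed
qed

lemma counterclockwise_refined_eulerian:
  assumes "Im z > 0"
  shows "counterclockwise z d (\<lambda>i. poly (map_poly of_real (refined_eulerian d i)) z)"
proof (induction d)
  case 0
  then show ?case
    using assms by (simp add: counterclockwise_def cross_def)
next
  case (Suc d)
  have sum: "poly (map_poly of_real (\<Sum>j\<in>A. refined_eulerian d j)) z =
    (\<Sum>j\<in>A. poly (map_poly of_real (refined_eulerian d j)) z)" if "finite A" for A
    using that by (induction A rule: finite_induct) (simp_all add: map_poly_of_real_add)
  have X: "map_poly complex_of_real [:0, 1:] = [:0, 1:]"
    by (simp add: map_poly_pCons)
  have "poly (map_poly of_real (refined_eulerian (Suc d) i)) z =
      (\<Sum>j=i..d. poly (map_poly of_real (refined_eulerian d j)) z) +
      z * (\<Sum>j<i. poly (map_poly of_real (refined_eulerian d j)) z)" for i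
    by (simp only: refined_eulerian.simps map_poly_of_real_add map_poly_of_real_mult X
        poly_add poly_mult sum finite_atLeastAtMost finite_lessThan) simp
  then show ?case
    using counterclockwise_step[OF Suc assms] by simp
qed

lemma real_rooted_sum_refined_eulerian:
  assumes a: "\<And>i. i \<le> d \<Longrightarrow> 0 \<le> a i" "a 0 > 0"
  shows "real_rooted (\<Sum>i\<le>d. smult (a i) (refined_eulerian d i))"
    (is "real_rooted ?h")
proof -
  have up: "poly (map_poly of_real ?h) z \<noteq> 0" if "Im z > 0" for z :: complex
  proof -
    have "poly (map_poly of_real (\<Sum>i\<in>A. smult (a i) (refined_eulerian d i))) z =
      (\<Sum>i\<in>A. of_real (a i) * poly (map_poly of_real (refined_eulerian d i)) z)" if "finite A" for A
      using that
      by (induction A rule: finite_induct) (simp_all add: map_poly_of_real_add map_poly_smult)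
    then show ?thesis
      using counterclockwise_sum_nonzero[OF counterclockwise_refined_eulerian[OF that] that, of d a] a
      by simp
  qed
  show ?thesis
    unfolding real_rooted_def
  proof (intro allI impI)
    fix z :: complex
    assume z: "poly (map_poly of_real ?h) z = 0"
    \<comment> \<open>The coefficients are real, so zeros come in conjugate pairs and the lower
      half-plane is covered as well.\<close>
    then have cnj: "poly (map_poly of_real ?h) (cnj z) = 0"
      by (simp only: poly_map_poly_cnj complex_cnj_zero)
    have "\<not> Im z > 0" "\<not> Im (cnj z) > 0"
      using up z cnj by blast+
    then have "Im z = 0"
      by simp
    then show "z \<in> \<real>" by (simp add: complex_is_Real_iff)
  qed
qed

section \<open>From magic coefficients to the h-star polynomial\<close>

lemma hstar_magic:
  assumes E: "magic_expansion (ehrhart_poly d P) d a" and a: "\<And>i. i \<le> d \<Longrightarrow> 0 \<le> a i" "a 0 = 1"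
  shows "real_rooted (hstar_poly d P)" "log_concave_seq d (coeff (hstar_poly d P))"
    "unimodal_seq d (coeff (hstar_poly d P))"
proof -
  define h where "h = (\<Sum>i\<le>d. smult (a i) (refined_eulerian d i))"
  define S where "S = Abs_fps (\<lambda>m. poly (ehrhart_poly d P) (real m))"
  have val: "poly (ehrhart_poly d P) x = (\<Sum>i\<le>d. a i * (x ^ i * (x + 1) ^ (d - i)))" for x
    using E unfolding magic_expansion_def by (simp add: poly_sum add.commute)
  \<comment> \<open>The series starts with 1 by definition; \<open>a 0 = 1\<close> makes this agree
    with the polynomial at 0.\<close>
  have val0: "poly (ehrhart_poly d P) 0 = 1"
    unfolding val using a by (simp add: sum.atMost_shift power_0_left)
  have eq: "1 + Abs_fps (\<lambda>m. if m = 0 then 0 else poly (ehrhart_poly d P) (real m)) =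
    S"
  proof (rule fps_ext)
    fix n
    show "fps_nth (1 + Abs_fps (\<lambda>m. if m = 0 then 0 else poly (ehrhart_poly d P) (real m))) n =
      fps_nth S n"
      by (cases "n = 0") (use val0 in \<open>simp_all add: S_def\<close>)
  qed
  have "fps_of_poly h = (\<Sum>i\<le>d. fps_const (a i) * ((1 - fps_X) ^ (d + 1) *
      Abs_fps (\<lambda>m. real m ^ i * (real m + 1) ^ (d - i))))"
    unfolding h_def fps_of_poly_sum
    by (intro sum.cong) (simp_all add: fps_of_poly_smult fps_of_poly_refined_eulerian)
  also have "\<dots> = (1 - fps_X) ^ (d + 1) *
      (\<Sum>i\<le>d. fps_const (a i) * Abs_fps (\<lambda>m. real m ^ i * (real m + 1) ^ (d - i)))"
    by (simp add: sum_distrib_left mult_ac)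
  also have "(\<Sum>i\<le>d. fps_const (a i) * Abs_fps (\<lambda>m. real m ^ i * (real m + 1) ^ (d - i))) =
      S"
    by (rule fps_ext) (simp add: fps_sum_nth val S_def)
  finally have mult: "fps_of_poly h =
      (1 - fps_X) ^ (d + 1) * S" .
  have unit: "(1 - fps_X :: real fps) ^ (d + 1) \<noteq> 0"
    by (rule fps_nonzeroI[of _ 0]) (simp add: fps_nth_power_0)
  have series: "S =
      fps_of_poly h / (1 - fps_X) ^ (d + 1)"
    unfolding mult by (rule nonzero_mult_div_cancel_left[OF unit, symmetric])
  have hstar: "hstar_poly d P = h"
    by (rule hstar_poly_eqI) (rule trans[OF eq series])
  have h: "real_rooted h"
    unfolding h_def by (rule real_rooted_sum_refined_eulerian) (use a in auto)
  have nonneg: "0 \<le> coeff h n" for n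
    unfolding h_def coeff_sum using a coeff_refined_eulerian_nonneg by (auto intro!: sum_nonneg)
  have "h \<noteq> 0"
  proof
    assume "h = 0"
    with series have "S = 0"
      by simp
    then have "fps_nth S 0 = 0" by (simp only: fps_zero_nth)
    then show False using val0 by (simp add: S_def)
  qed
  have "strongly_log_concave (coeff h)"
  proof (rule real_rooted_strongly_log_concave[OF h])
    show pos: "lead_coeff h > 0"
      using \<open>h \<noteq> 0\<close> nonneg[of "degree h"] by (simp add: less_le)
    show "poly h x \<noteq> 0" if "x > 0" for x
    proof -
      have "poly h x > 0"
        unfolding poly_altdef using that nonneg pos
        by (intro sum_pos2[of _ "degree h"]) auto
      then show ?thesis by simp
    qed
  qed
  then show "real_rooted (hstar_poly d P)" "log_concave_seq d (coeff (hstar_poly d P))"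
    "unimodal_seq d (coeff (hstar_poly d P))"
    using h strongly_log_concave_imp_log_concave strongly_log_concave_imp_unimodal
    unfolding hstar by auto
qed

section \<open>Magic positivity of the volume polynomial\<close>

lemma sum_excess_growth_all:
  assumes T: "finite T" "card T = Suc n" "\<forall>s\<in>T. s < t" and k: "k < n"
  shows "real (n - k) * (\<Sum>U\<in>upper_faces (Suc k) T. excess k t U) \<le>
    (\<Sum>U\<in>upper_faces (Suc (Suc k)) T. excess (Suc k) t U)"
proof -
  consider "(Suc k, n) = (2, 2)" | "(Suc k, n) = (3, 3)"
    | "(Suc k, n) \<noteq> (2, 2)" "(Suc k, n) \<noteq> (3, 3)" by blast
  then show ?thesis
  proof cases
    case 1
    then have "k = 1" "n = 2" by auto
    then show ?thesis
      using sum_excess_growth_2[of T t] T by (simp add: numeral_2_eq_2 numeral_3_eq_3)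
  next
    case 2
    then have "k = 2" "n = 3" by auto
    then show ?thesis
      using sum_excess_growth_3[of T t] T by (simp add: numeral_eq_Suc)
  next
    case 3
    then show ?thesis using sum_excess_growth[OF T] k by simp
  qed
qed

definition volume_poly :: "nat \<Rightarrow> int set \<Rightarrow> real poly" where
  "volume_poly d T = (\<Sum>k\<le>d. monom (cyclic_volume k T) k)"

text \<open>The new simplices of the lower triangulation are the cones from \<open>t\<close> over
  the upper faces, which triangulate \<open>C_k(T)\<close>; the excess compares the volume of a cone
  with that of its base.\<close>

lemma cyclic_volume_insert_top:
  assumes T: "finite T" "Suc k \<le> card T" and t: "\<forall>s\<in>T. s < t"
  shows "cyclic_volume (Suc k) (insert t T) =
    cyclic_volume (Suc k) T + cyclic_volume k T + (\<Sum>U\<in>upper_faces (Suc k) T. excess k t U)"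
proof -
  have "cyclic_volume (Suc k) (insert t T) = cyclic_volume (Suc k) T +
      (\<Sum>U\<in>upper_faces (Suc k) T. vandermonde (insert t U) / fact (Suc k))"
    unfolding cyclic_volume_def by (rule sum_lower_faces_insert_top[OF T(1) t])
  also have "(\<Sum>U\<in>upper_faces (Suc k) T. vandermonde (insert t U) / fact (Suc k)) =
      (\<Sum>U\<in>upper_faces (Suc k) T. vandermonde U / fact k + excess k t U)"
  proof (intro sum.cong refl)
    fix U assume "U \<in> upper_faces (Suc k) T"
    then have "U \<subseteq> T" "finite U" using faces_finite_card(2)[OF T(1)] by blast+
    then have "vandermonde (insert t U) = vandermonde U * poly (node_poly U) (of_int t)"
      using t by (intro vandermonde_insert_top) auto
    then show "vandermonde (insert t U) / fact (Suc k) = vandermonde U / fact k + excess k t U"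
      by (simp add: excess_def right_diff_distrib mult.commute)
  qed
  also have "\<dots> = cyclic_volume k T + (\<Sum>U\<in>upper_faces (Suc k) T. excess k t U)"
    by (simp add: sum.distrib cyclic_volume_upper[OF T])
  finally show ?thesis by simp
qed

lemma magic_positive_volume_poly_simplex:
  assumes "finite T" "card T = Suc n"
  shows "magic_positive (volume_poly n T) n"
  using assms
proof (induction n arbitrary: T)
  case 0
  then have "T \<noteq> {}" by auto
  then show ?case
    using 0 unfolding magic_positive_def magic_expansion_basis
    by (intro exI[of _ "\<lambda>_. 1"]) (simp add: volume_poly_def cyclic_volume_0 magic_basis_def)
next
  case (Suc n)
  obtain t S where S: "T = insert t S" "finite S" "card S = Suc n" "\<forall>s\<in>S. s < t"
    using Suc.prems by (rule top_element)
  define h where "h = (\<lambda>k. \<Sum>U\<in>upper_faces (Suc k) S. excess k t U)"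
  define H where "H = (\<Sum>k\<le>n. monom (h k) k)"
  have "0 \<le> h 0"
    unfolding h_def using S faces_finite_card(2)[OF S(2)]
    by (intro sum_nonneg excess_nonneg) blast+
  moreover have "real (n - k) * h k \<le> h (Suc k)" if "k < n" for k
    unfolding h_def by (rule sum_excess_growth_all[OF S(2,3,4) that])
  ultimately have H: "magic_positive H n"
    unfolding H_def by (rule magic_positive_growth)
  have "S \<noteq> {}" using S by auto
  \<comment> \<open>\<open>n + 1\<close> points span no simplex of dimension \<open>n + 1\<close>,
    so \<open>volume_poly n S\<close> loses nothing by stopping at degree \<open>n\<close>.\<close>
  have top: "cyclic_volume (Suc n) S = 0"
  proof -
    have "lower_faces (Suc (Suc n)) S = {}"
      using S(3) by (auto simp: lower_faces_def dest: card_mono[OF S(2)])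
    then show ?thesis by (simp add: cyclic_volume_def)
  qed
  have "volume_poly (Suc n) T = [:1, 1:] * volume_poly n S + [:0, 1:] * H"
  proof (rule poly_eqI)
    fix i
    have coeff: "coeff (\<Sum>k\<le>d. monom (e k) k) i = (if i \<le> d then e i else 0)" for e :: "nat \<Rightarrow> real" and d i
      by (simp add: coeff_sum)
    show "coeff (volume_poly (Suc n) T) i = coeff ([:1, 1:] * volume_poly n S + [:0, 1:] * H) i"
    proof (cases i)
      case 0
      then show ?thesis
        using S \<open>S \<noteq> {}\<close> by (simp add: volume_poly_def coeff H_def cyclic_volume_0)
    next
      case (Suc k)
      have "cyclic_volume (Suc k) T = cyclic_volume (Suc k) S + cyclic_volume k S + h k" if "k \<le> n"
        unfolding S(1) h_def using S that by (intro cyclic_volume_insert_top) auto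
      then show ?thesis
        using top by (auto simp: volume_poly_def coeff H_def Suc le_Suc_eq)
    qed
  qed
  then show ?case
    using Suc.IH[OF S(2,3)] H
    by (simp only: magic_positive_add magic_positive_mult_one_plus_X magic_positive_mult_X)
qed

text \<open>For \<open>d = card T - 1\<close> the polytope is a simplex. The coefficients do not
  depend on \<open>d\<close>, so every smaller \<open>d\<close> is reached by truncation.\<close>

lemma magic_positive_volume_poly:
  assumes "finite T" "d < card T"
  shows "magic_positive (volume_poly d T) d"
proof -
  have "d \<le> card T - 1" using assms(2) by simp
  then show ?thesis
  proof (induction rule: inc_induct)
    case base
    have "card T = Suc (card T - 1)" using assms by simp
    then show ?case by (rule magic_positive_volume_poly_simplex[OF assms(1)])
  next
    case (step d)
    from step.IH show ?case unfolding volume_poly_def by (rule magic_positive_truncate)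
  qed
qed

text \<open>Makes the degree exactly \<open>d\<close>. Each new largest node adds at least the
  volume one dimension lower.\<close>

lemma cyclic_volume_pos:
  assumes "finite T" "k < card T"
  shows "0 < cyclic_volume k T"
proof -
  have nonneg: "0 \<le> cyclic_volume k S" if "finite S" for k S
    unfolding cyclic_volume_def using faces_finite_card(1)[OF that]
    by (intro sum_nonneg divide_nonneg_nonneg less_imp_le[OF vandermonde_pos]) auto
  have "\<forall>k<card T. 0 < cyclic_volume k T"
    using assms(1)
  proof (induction T rule: finite_linorder_max_induct)
    case (insert t T)
    have "0 < cyclic_volume k (insert t T)" if k: "k < card (insert t T)" for k
    proof (cases k)
      case 0
      then show ?thesis using insert.hyps cyclic_volume_0[of "insert t T"] by simp
    next
      case (Suc j)
      have "t \<notin> T" using insert.hyps by auto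
      then have j: "Suc j \<le> card T" using k Suc insert.hyps by simp
      have "0 \<le> (\<Sum>U\<in>upper_faces (Suc j) T. excess j t U)"
        using faces_finite_card(2)[OF insert.hyps(1)] insert.hyps(2)
        by (intro sum_nonneg excess_nonneg) blast+
      moreover have "0 < cyclic_volume j T" using insert.IH j by simp
      ultimately show ?thesis
        using cyclic_volume_insert_top[OF insert.hyps(1) j insert.hyps(2)] nonneg[OF insert.hyps(1), of "Suc j"]
        by (simp add: Suc)
    qed
    then show ?case by blast
  qed simp
  then show ?thesis using assms(2) by simp
qed

subsection \<open>The Ehrhart polynomial of a cyclic polytope\<close>

lemma sum_fun_apply: "(\<Sum>t\<in>T. f t) i = (\<Sum>t\<in>T. f t i)"
  by (induction T rule: infinite_finite_induct) auto

lemma inj_moment_point: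
  assumes "1 \<le> d"
  shows "inj (moment_point d)"
proof (rule injI)
  fix s t assume "moment_point d s = moment_point d t"
  then have "moment_point d s 1 = moment_point d t 1" by simp
  then show "s = t" using assms by (simp add: moment_point_def)
qed

lemma cyclic_polytope_eq:
  assumes "finite T" "1 \<le> d"
  shows "cyclic_polytope d T =
    {y. \<exists>c. (\<forall>t\<in>T. 0 \<le> c t) \<and> sum c T = 1 \<and> (\<Sum>t\<in>T. c t *\<^sub>R moment_point d t) = y}"
proof -
  have inj: "inj_on (moment_point d) T"
    using inj_moment_point[OF assms(2)] by (rule inj_on_subset) auto
  show ?thesis
    unfolding cyclic_polytope_def convex_hull_finite[OF finite_imageI[OF assms(1)]]
  proof (intro Collect_cong iffI)
    fix y
    assume "\<exists>u. (\<forall>x\<in>moment_point d ` T. 0 \<le> u x) \<and> sum u (moment_point d ` T) = 1 \<and>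
      (\<Sum>x\<in>moment_point d ` T. u x *\<^sub>R x) = y"
    then obtain u where "\<forall>x\<in>moment_point d ` T. 0 \<le> u x" "sum u (moment_point d ` T) = 1"
      "(\<Sum>x\<in>moment_point d ` T. u x *\<^sub>R x) = y" by blast
    then show "\<exists>c. (\<forall>t\<in>T. 0 \<le> c t) \<and> sum c T = 1 \<and> (\<Sum>t\<in>T. c t *\<^sub>R moment_point d t) = y"
      by (intro exI[of _ "u \<circ> moment_point d"]) (simp add: sum.reindex[OF inj] o_def)
  next
    fix y
    assume "\<exists>c. (\<forall>t\<in>T. 0 \<le> c t) \<and> sum c T = 1 \<and> (\<Sum>t\<in>T. c t *\<^sub>R moment_point d t) = y"
    then obtain c where c: "\<forall>t\<in>T. 0 \<le> c t" "sum c T = 1" "(\<Sum>t\<in>T. c t *\<^sub>R moment_point d t) = y"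
      by blast
    have inv: "inv (moment_point d) (moment_point d t) = t" for t
      by (rule inv_f_f[OF inj_moment_point[OF assms(2)]])
    show "\<exists>u. (\<forall>x\<in>moment_point d ` T. 0 \<le> u x) \<and> sum u (moment_point d ` T) = 1 \<and>
      (\<Sum>x\<in>moment_point d ` T. u x *\<^sub>R x) = y"
      using c by (intro exI[of _ "c \<circ> inv (moment_point d)"]) (simp add: sum.reindex[OF inj] inv)
  qed
qed

lemma sum_moment_point:
  "(\<Sum>t\<in>T. c t * moment_point d t i) = (if i \<in> {1..d} then \<Sum>t\<in>T. c t * of_int t ^ i else 0)"
  unfolding moment_point_def
  by (cases "i \<in> {1..d}") (simp_all only: if_True if_False mult_zero_right sum.neutral_const)

lemma dilated_cyclic_polytope_iff:
  assumes T: "finite T" "1 \<le> d" and m: "0 < m"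
  shows "y \<in> (*\<^sub>R) m ` cyclic_polytope d T \<longleftrightarrow>
    (\<exists>c. (\<forall>t\<in>T. 0 \<le> c t) \<and> sum c T = m \<and>
      (\<forall>i. y i = (if i \<in> {1..d} then \<Sum>t\<in>T. c t * of_int t ^ i else 0)))"
  (is "?L \<longleftrightarrow> ?R")
proof
  assume ?L
  then obtain c where c: "\<forall>t\<in>T. 0 \<le> c t" "sum c T = 1" "y = m *\<^sub>R (\<Sum>t\<in>T. c t *\<^sub>R moment_point d t)"
    unfolding cyclic_polytope_eq[OF T] by blast
  have "y i = (if i \<in> {1..d} then \<Sum>t\<in>T. m * c t * of_int t ^ i else 0)" for i
    unfolding c(3) scaleR_fun_def sum_fun_apply real_scaleR_def sum_moment_point
    by (simp add: sum_distrib_left mult.assoc)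
  moreover have "(\<Sum>t\<in>T. m * c t) = m" using c(2) by (simp flip: sum_distrib_left)
  ultimately show ?R
    using c(1) m by (intro exI[of _ "\<lambda>t. m * c t"]) auto
next
  assume ?R
  then obtain c where c: "\<forall>t\<in>T. 0 \<le> c t" "sum c T = m"
    "\<And>i. y i = (if i \<in> {1..d} then \<Sum>t\<in>T. c t * of_int t ^ i else 0)" by blast
  have "y = m *\<^sub>R (\<Sum>t\<in>T. (c t / m) *\<^sub>R moment_point d t)"
  proof
    fix i
    show "y i = (m *\<^sub>R (\<Sum>t\<in>T. (c t / m) *\<^sub>R moment_point d t)) i"
      unfolding scaleR_fun_def sum_fun_apply real_scaleR_def sum_moment_point c(3) using m
      by (simp add: sum_distrib_left)
  qed
  moreover have "(\<Sum>t\<in>T. c t / m) = 1" using c(2) m by (simp flip: sum_divide_distrib)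
  ultimately show ?L
    unfolding cyclic_polytope_eq[OF T] using c(1) m
    by (intro image_eqI[of _ _ "\<Sum>t\<in>T. (c t / m) *\<^sub>R moment_point d t"] CollectI exI[of _ "\<lambda>t. c t / m"]) auto
qed

text \<open>Dropping coordinate 0, which is constantly \<open>m\<close>, identifies the homogenized
  lattice points with those of the dilate.\<close>

lemma card_dilated_cyclic_polytope:
  assumes T: "finite T" "1 \<le> d" and m: "0 < m"
  shows "card ((*\<^sub>R) (real m) ` cyclic_polytope d T \<inter> int_lattice d) = card (lattice_points d T (int m))"
proof -
  have m': "0 < real m" using m by simp
  define g where "g = (\<lambda>(z :: nat \<Rightarrow> int) i. if i \<in> {1..d} then real_of_int (z i) else 0)"
  have "bij_betw g (lattice_points d T (int m)) ((*\<^sub>R) (real m) ` cyclic_polytope d T \<inter> int_lattice d)"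
  proof (rule bij_betwI')
    fix z z' assume z: "z \<in> lattice_points d T (int m)" "z' \<in> lattice_points d T (int m)"
    show "g z = g z' \<longleftrightarrow> z = z'"
    proof
      assume eq: "g z = g z'"
      show "z = z'"
      proof
        fix i
        show "z i = z' i"
          using fun_cong[OF eq, of i] z by (cases "i = 0"; cases "i \<le> d") (auto simp: g_def lattice_points_def)
      qed
    qed simp
  next
    fix z assume z: "z \<in> lattice_points d T (int m)"
    then obtain c where c: "\<forall>t\<in>T. 0 \<le> c t" "\<And>i. i < Suc d \<Longrightarrow> real_of_int (z i) = (\<Sum>t\<in>T. c t * of_int t ^ i)"
      unfolding lattice_points_def moment_cone_def by auto
    have "g z \<in> (*\<^sub>R) (real m) ` cyclic_polytope d T"
      unfolding dilated_cyclic_polytope_iff[OF T m']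
    proof (intro exI conjI)
      show "sum c T = real m" using c(2)[of 0] z by (simp add: lattice_points_def)
      show "\<forall>i. g z i = (if i \<in> {1..d} then \<Sum>t\<in>T. c t * of_int t ^ i else 0)"
        using c(2) by (auto simp: g_def)
    qed (fact c(1))
    moreover have "g z \<in> int_lattice d" by (auto simp: g_def int_lattice_def)
    ultimately show "g z \<in> (*\<^sub>R) (real m) ` cyclic_polytope d T \<inter> int_lattice d" by blast
  next
    fix y assume y: "y \<in> (*\<^sub>R) (real m) ` cyclic_polytope d T \<inter> int_lattice d"
    then have "y \<in> (*\<^sub>R) (real m) ` cyclic_polytope d T" by blast
    then obtain c where c: "\<forall>t\<in>T. 0 \<le> c t" "sum c T = real m"
      "\<And>i. y i = (if i \<in> {1..d} then \<Sum>t\<in>T. c t * of_int t ^ i else 0)"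
      unfolding dilated_cyclic_polytope_iff[OF T m'] by blast
    define z where "z = (\<lambda>i. if i = 0 then int m else \<lfloor>y i\<rfloor>)"
    have zy: "real_of_int (z i) = y i" if "i \<in> {1..d}" for i
      using y that by (auto simp: z_def int_lattice_def elim!: Ints_cases)
    have "real_of_int (z i) = (\<Sum>t\<in>T. c t * of_int t ^ i)" if "i < Suc d" for i
      using zy[of i] c(2,3) that by (cases "i = 0") (auto simp: z_def)
    then have "real_of_int \<circ> z \<in> moment_cone (Suc d) T"
      unfolding moment_cone_def using c(1) by (intro CollectI exI[of _ c]) auto
    moreover have "z 0 = int m" "z i = 0" if "d < i" for i
      using c(3)[of i] that by (auto simp: z_def)
    ultimately have "z \<in> lattice_points d T (int m)"
      by (auto simp: lattice_points_def z_def c(3))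
    moreover have "y = g z"
      using zy c(3) by (auto simp: g_def fun_eq_iff)
    ultimately show "\<exists>z\<in>lattice_points d T (int m). y = g z" by blast
  qed
  then show ?thesis by (rule bij_betw_same_card[symmetric])
qed

lemma ehrhart_cyclic_polytope:
  assumes "finite T" "1 \<le> d" "d < card T"
  shows "ehrhart_poly d (cyclic_polytope d T) = volume_poly d T"
proof (rule ehrhart_poly_eqI)
  fix m :: nat assume m: "0 < m"
  have "real (card ((*\<^sub>R) (real m) ` cyclic_polytope d T \<inter> int_lattice d)) =
      (\<Sum>k\<le>d. cyclic_volume k T * real m ^ k)"
    unfolding card_dilated_cyclic_polytope[OF assms(1,2) m]
    using card_lattice_points[OF assms(1), of d "int m"] assms(3) m by simp
  then show "poly (volume_poly d T) (real m) = real (card ((*\<^sub>R) (real m) ` cyclic_polytope d T \<inter> int_lattice d))"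
    by (simp add: volume_poly_def poly_sum poly_monom)
qed

text \<open>At \<open>m = 1\<close> the number of lattice points is the sum of the volumes, so the
  counts in consecutive dimensions differ by a single volume.\<close>

lemma cyclic_volume_Ints:
  assumes "finite T" "k < card T"
  shows "cyclic_volume k T \<in> \<int>"
proof (cases k)
  case 0
  then have "T \<noteq> {}" using assms by auto
  then show ?thesis using 0 assms cyclic_volume_0 by simp
next
  case (Suc j)
  have count: "real (card (lattice_points i T 1)) = (\<Sum>k\<le>i. cyclic_volume k T)" if "i \<le> k" for i
    using card_lattice_points[OF assms(1), of i 1] assms(2) that by simp
  have "cyclic_volume k T = real (card (lattice_points k T 1)) - real (card (lattice_points j T 1))"
    using count[of k] count[of j] Suc by simp
  then show ?thesis by simp
qed

text \<open>Evaluation at -1 isolates the top coefficient up to sign. Removing its term leaves a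
  multiple of \<open>1 + x\<close>, and the quotient is integral because the constant term of
  \<open>1 + x\<close> is 1.\<close>

lemma magic_expansion_Ints:
  assumes "magic_expansion f d a" "\<And>i. coeff f i \<in> \<int>" "i \<le> d"
  shows "a i \<in> \<int>"
  using assms
proof (induction d arbitrary: f i)
  case 0
  then have "f = [:a 0:]" by (simp add: magic_expansion_def)
  then show ?case using 0(2)[of 0] 0(3) by simp
next
  case (Suc d)
  define g where "g = (\<Sum>i\<le>d. smult (a i) ([:0, 1:] ^ i * [:1, 1:] ^ (d - i)))"
  have f: "f = [:1, 1:] * g + smult (a (Suc d)) ([:0, 1:] ^ Suc d)"
    using Suc.prems(1) unfolding magic_expansion_Suc g_def .
  have "poly f (- 1) = a (Suc d) * (- 1) ^ Suc d"
    by (subst f) simp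
  moreover have "poly f (- 1) \<in> \<int>"
    unfolding poly_altdef using Suc.prems(2) by (intro Ints_sum Ints_mult Ints_power) auto
  ultimately have "a (Suc d) * (- 1) ^ Suc d \<in> \<int>" by simp
  then have top: "a (Suc d) \<in> \<int>"
    by (cases "even d") auto
  have mon: "[:0, 1 :: real:] ^ Suc d = monom 1 (Suc d)" by (simp add: monom_altdef)
  note coeff_f = Suc.prems(2)
  have gi: "coeff g i \<in> \<int>" for i
  proof (induction i)
    case 0
    have "coeff f 0 = coeff g 0" unfolding f mon by (simp add: coeff_monom)
    then show ?case using coeff_f[of 0] by simp
  next
    case (Suc i)
    have "coeff f (Suc i) = coeff g (Suc i) + coeff g i + a (Suc d) * (if i = d then 1 else 0)"
      unfolding f mon by (simp add: coeff_monom)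
    then have "coeff g (Suc i) = coeff f (Suc i) - coeff g i - a (Suc d) * (if i = d then 1 else 0)"
      by simp
    then show ?case using Suc.IH coeff_f top by auto
  qed
  have "magic_expansion g d a" by (simp add: magic_expansion_def g_def)
  then show ?case
    using Suc.IH[of g] gi Suc.prems(3) top by (auto simp: le_Suc_eq)
qed

theorem corollary1p2:
  fixes T :: "int set" and d :: nat
  assumes "finite T" and "1 \<le> d" and "d < card T"
  shows "(\<forall>i\<le>d. magic_coeff (ehrhart_poly d (cyclic_polytope d T)) i \<in> \<nat>) \<and>
    real_rooted (hstar_poly d (cyclic_polytope d T)) \<and>
    log_concave_seq d (coeff (hstar_poly d (cyclic_polytope d T))) \<and>
    unimodal_seq d (coeff (hstar_poly d (cyclic_polytope d T)))"
proof -
  define E where "E = ehrhart_poly d (cyclic_polytope d T)"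
  have E: "E = volume_poly d T" unfolding E_def using assms by (rule ehrhart_cyclic_polytope)
  have coeff: "coeff E k = (if k \<le> d then cyclic_volume k T else 0)" for k
    by (simp add: E volume_poly_def coeff_sum)
  \<comment> \<open>\<open>magic_coeff\<close> expands with respect to the degree of the polynomial,
    so the degree must be exactly \<open>d\<close>.\<close>
  have "degree E \<le> d" by (rule degree_le) (simp add: coeff)
  moreover have "coeff E d \<noteq> 0" using coeff[of d] cyclic_volume_pos[OF assms(1,3)] by simp
  ultimately have deg: "degree E = d" by (intro antisym le_degree)
  obtain a where a: "\<forall>i\<le>d. 0 \<le> a i" "magic_expansion E d a"
    using magic_positive_volume_poly[OF assms(1,3)] unfolding magic_positive_def E by blast
  have "magic_expansion E d (magic_coeff E)"
    using magic_coeff_expansion[of E] unfolding deg magic_expansion_def .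
  then have magic: "magic_coeff E i = a i" if "i \<le> d" for i
    using magic_expansion_unique[OF _ a(2) that] by blast
  have "coeff E k \<in> \<int>" for k
    using cyclic_volume_Ints[OF assms(1)] assms(3) by (simp add: coeff)
  then have "a i \<in> \<int>" if "i \<le> d" for i
    using magic_expansion_Ints[OF a(2) _ that] by blast
  then have nat: "\<forall>i\<le>d. magic_coeff E i \<in> \<nat>"
    using a(1) magic by (auto simp: Nats_altdef2)
  have a0: "a 0 = 1"
  proof -
    have "poly E 0 = (\<Sum>i\<le>d. a i * (0 ^ i * 1 ^ (d - i)))"
      using a(2) unfolding magic_expansion_def by (simp add: poly_sum)
    also have "\<dots> = a 0"
      by (simp add: sum.atMost_shift power_0_left)
    finally have "a 0 = coeff E 0" by (simp add: poly_0_coeff_0)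
    moreover have "T \<noteq> {}" using assms by auto
    ultimately show ?thesis using coeff[of 0] cyclic_volume_0[OF assms(1)] by simp
  qed
  show ?thesis
    using nat hstar_magic[OF a(2)[unfolded E_def] a(1)[rule_format] a0] unfolding E_def by blast
qed

end
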